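(* Let $a_+\in[a_c,a_m)$ and set $$\Gamma(x)=f_u(x,0)\int_0^{a_c}\beta(a,x)e^{-\int_0^a\mu(s,x)ds}\,da,\qquad x\in[0,1].$$ For any compact subset $I\subset(0,1)$: if $\Gamma(x)>1$ for all $x\in I$, then as $d\to0$, $$u^*_{0,d}(a,x)\to v^*(a,x),\qquad\forall(a,x)\in[0,a_+]\times I,$$ where $v^*$, with $v^*(\cdot,x)\in W^{1,1}(0,a_+)$ for any $x\in I$, is the unique positive solution of the problem $$\begin{cases}v_a(a,x)=-\mu(a,x)v(a,x),\quad a\in(0,a_+),\\ v(0,x)=f\left(x,\int_0^{a_+}\beta(a,x)v(a,x)\,da\right).\end{cases}$$ Otherwise, if $\Gamma(x)\le1$ for all $x\in I$, then as $d\to0$, $$u^*_{0,d}(a,x)\to0,\qquad\forall(a,x)\in[0,a_+]\times I.$$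
   Context: Setting. Let $a_m\in(0,\infty]$ (maximum age). The functions $\beta,\mu$ of $(a,x)$, $a\in(0,a_m)$, $x\in[0,1]$, are nonnegative and satisfy: (i) $x\mapsto\beta(\cdot,x)$ is of class $C^2$ from $[0,1]$ to $L^\infty(0,a_m)$, with values in nonnegative functions; (ii) there is $a_c\in(0,a_m)$ such that $\beta\equiv0$ on $[a_c,a_m)\times[0,1]$ and $\int_a^{a_c}\underline\beta(l)\,dl>0$ for every $a\in[0,a_c)$, where $\underline\beta(a)=\min_{x\in[0,1]}\beta(a,x)$; (iii) $x\mapsto\mu(\cdot,x)$ is continuous from $[0,1]$ to $L^\infty_{\rm loc}(0,a_m)$ with values in nonnegative functions, i.e. $\mu(\cdot,x)\in L^\infty(0,a_+)$ for every $a_+<a_m$, continuously in $x$. The function $f=f(x,u)$ satisfies: (i) $f\in C^{2,1}([0,1]\times[0,\infty))$; (ii) $f_u(x,u)>0$ for all $u\in[0,\infty)$, $x\in[0,1]$; (iii) $f(x,0)\equiv0$ and $f(x,u)/u$ is strictly decreasing with respect to $u$ for all $x\in[0,1]$; (iv) there is a constant $L>0$ with $f(x,u)\le L$ for all $u\in[0,\infty)$, $x\in[0,1]$. For $d>0$, $u^*_{0,d}$ denotes the unique positive solution (positive equilibrium in the absence of advection), whenever it exists, of $$\begin{cases}u_a=du_{xx}-\mu(a,x)u,&(a,x)\in(0,a_m)\times(0,1),\\ u(0,x)=f\left(x,\int_0^{a_m}\beta(a,x)u(a,x)\,da\right),&x\in(0,1),\\ u_x(a,x)=0,&(a,x)\in(0,a_m)\times\{0,1\}.\end{cases}$$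 Limits as $d\to0$ are taken along those $d$ for which $u^*_{0,d}$ exists. *)

theory Defs
  imports "HOL-Analysis.Analysis" "HOL-Probability.Essential_Supremum"
begin

section \<open>Maps from an interval into $L^\infty$\<close>

text \<open>
  Elements of $L^\infty(S)$ are represented by functions and the topology is that of the essential
  supremum seminorm; for a map \<open>F\<close> of $(a,x)$, the slice \<open>\<lambda>a. F a x\<close> is the value at \<open>x\<close>.
\<close>

definition Linf_norm :: "real set \<Rightarrow> (real \<Rightarrow> real) \<Rightarrow> ereal" where
  "Linf_norm S g = esssup (lebesgue_on S) (\<lambda>a. ereal \<bar>g a\<bar>)"

definition in_Linf :: "real set \<Rightarrow> (real \<Rightarrow> real) \<Rightarrow> bool" where
  "in_Linf S g \<longleftrightarrow> g \<in> borel_measurable (lebesgue_on S) \<and> Linf_norm S g < \<infinity>"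

definition cont_into_Linf :: "real set \<Rightarrow> real set \<Rightarrow> (real \<Rightarrow> real \<Rightarrow> real) \<Rightarrow> bool" where
  "cont_into_Linf S T F \<longleftrightarrow>
     (\<forall>x\<in>T. in_Linf S (\<lambda>a. F a x)) \<and>
     (\<forall>x\<in>T. ((\<lambda>y. Linf_norm S (\<lambda>a. F a y - F a x)) \<longlongrightarrow> 0) (at x within T))"

definition has_Linf_derivative ::
  "real set \<Rightarrow> real set \<Rightarrow> (real \<Rightarrow> real \<Rightarrow> real) \<Rightarrow> (real \<Rightarrow> real \<Rightarrow> real) \<Rightarrow> bool" where
  "has_Linf_derivative S T F F' \<longleftrightarrow>
     (\<forall>x\<in>T. ((\<lambda>y. Linf_norm S (\<lambda>a. (F a y - F a x) / (y - x) - F' a x)) \<longlongrightarrow> 0) (at x within T))"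

definition C2_into_Linf :: "real set \<Rightarrow> real set \<Rightarrow> (real \<Rightarrow> real \<Rightarrow> real) \<Rightarrow> bool" where
  "C2_into_Linf S T F \<longleftrightarrow>
     (\<exists>F' F''. cont_into_Linf S T F \<and> cont_into_Linf S T F' \<and> cont_into_Linf S T F'' \<and>
        has_Linf_derivative S T F F' \<and> has_Linf_derivative S T F' F'')"


section \<open>The class $C^{2,1}$ in $(x,u)$\<close>

text \<open>
  Twice continuously differentiable in the first variable, once in the second; the derivatives are
  one-sided at boundary points.
\<close>

definition C21_on :: "real set \<Rightarrow> real set \<Rightarrow> (real \<Rightarrow> real \<Rightarrow> real) \<Rightarrow> bool" where
  "C21_on X U f \<longleftrightarrow>
     (\<exists>fx fxx fu.
        (\<forall>x\<in>X. \<forall>u\<in>U.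
           ((\<lambda>y. f y u) has_real_derivative fx x u) (at x within X) \<and>
           ((\<lambda>y. fx y u) has_real_derivative fxx x u) (at x within X) \<and>
           ((\<lambda>w. f x w) has_real_derivative fu x u) (at u within U)) \<and>
        continuous_on (X \<times> U) (case_prod f) \<and>
        continuous_on (X \<times> U) (case_prod fx) \<and>
        continuous_on (X \<times> U) (case_prod fxx) \<and>
        continuous_on (X \<times> U) (case_prod fu))"

definition partial_u :: "(real \<Rightarrow> real \<Rightarrow> real) \<Rightarrow> real \<Rightarrow> real \<Rightarrow> real" where
  "partial_u f x u = vector_derivative (\<lambda>w. f x w) (at u within {0..})"


section \<open>Weak derivatives\<close>

definition directional_derivative ::
  "'a::euclidean_space \<Rightarrow> ('a \<Rightarrow> real) \<Rightarrow> 'a \<Rightarrow> real" where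
  "directional_derivative v \<phi> = (\<lambda>p. frechet_derivative \<phi> (at p) v)"

text \<open>$C^\infty$: all iterated directional derivatives are differentiable everywhere.\<close>

definition smooth_fun :: "('a::euclidean_space \<Rightarrow> real) \<Rightarrow> bool" where
  "smooth_fun \<phi> \<longleftrightarrow> (\<forall>vs p. foldr directional_derivative vs \<phi> differentiable (at p))"

definition test_fun :: "'a::euclidean_space set \<Rightarrow> ('a \<Rightarrow> real) \<Rightarrow> bool" where
  "test_fun \<Omega> \<phi> \<longleftrightarrow>
     smooth_fun \<phi> \<and> compact (closure {p. \<phi> p \<noteq> 0}) \<and> closure {p. \<phi> p \<noteq> 0} \<subseteq> \<Omega>"

definition locally_integrable_on :: "('a::euclidean_space \<Rightarrow> real) \<Rightarrow> 'a set \<Rightarrow> bool" where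
  "locally_integrable_on g \<Omega> \<longleftrightarrow> (\<forall>K. compact K \<and> K \<subseteq> \<Omega> \<longrightarrow> set_integrable lebesgue K g)"

text \<open>\<open>g\<close> is the weak derivative of \<open>u\<close> in direction \<open>v\<close> on the open set \<open>\<Omega>\<close>.\<close>

definition weak_derivative ::
  "'a::euclidean_space set \<Rightarrow> 'a \<Rightarrow> ('a \<Rightarrow> real) \<Rightarrow> ('a \<Rightarrow> real) \<Rightarrow> bool" where
  "weak_derivative \<Omega> v u g \<longleftrightarrow>
     locally_integrable_on u \<Omega> \<and> locally_integrable_on g \<Omega> \<and>
     (\<forall>\<phi>. test_fun \<Omega> \<phi> \<longrightarrow>
        (LINT p:\<Omega>|lebesgue. u p * directional_derivative v \<phi> p) =
        - (LINT p:\<Omega>|lebesgue. g p * \<phi> p))"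

definition W11 :: "real set \<Rightarrow> (real \<Rightarrow> real) \<Rightarrow> bool" where
  "W11 \<Omega> v \<longleftrightarrow>
     set_integrable lebesgue \<Omega> v \<and> (\<exists>g. set_integrable lebesgue \<Omega> g \<and> weak_derivative \<Omega> 1 v g)"


section \<open>The age-structured problems\<close>

definition ages :: "ereal \<Rightarrow> real set" where
  "ages a_m = {a. 0 < a \<and> ereal a < a_m}"

text \<open>
  Positive solutions of the diffusive problem, in the strong (Sobolev) sense: \<open>u\<close> is continuous up
  to the initial age and the lateral boundary, \<open>u_x\<close> exists classically and is continuous on
  $(0,a_m)\times[0,1]$, \<open>u_a\<close> and \<open>u_xx\<close> are locally integrable weak derivatives, and the equation
  holds almost everywhere.  The mortality is merely $L^\infty_{loc}$ in age and continuous in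
  space, so classical derivatives \<open>u_a\<close> and \<open>u_xx\<close> cannot be expected.
\<close>

definition positive_equilibrium ::
  "ereal \<Rightarrow> (real \<Rightarrow> real \<Rightarrow> real) \<Rightarrow> (real \<Rightarrow> real \<Rightarrow> real) \<Rightarrow> (real \<Rightarrow> real \<Rightarrow> real) \<Rightarrow>
   real \<Rightarrow> (real \<Rightarrow> real \<Rightarrow> real) \<Rightarrow> bool" where
  "positive_equilibrium a_m \<beta> \<mu> f d u \<longleftrightarrow>
     continuous_on (insert 0 (ages a_m) \<times> {0..1}) (case_prod u) \<and>
     (\<forall>a\<in>insert 0 (ages a_m). \<forall>x\<in>{0..1}. 0 < u a x) \<and>
     (\<exists>ux ua uxx.
        (\<forall>a\<in>ages a_m. \<forall>x\<in>{0..1}.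
           ((\<lambda>y. u a y) has_real_derivative ux a x) (at x within {0..1})) \<and>
        continuous_on (ages a_m \<times> {0..1}) (case_prod ux) \<and>
        weak_derivative (ages a_m \<times> {0<..<1}) (1, 0) (case_prod u) (case_prod ua) \<and>
        weak_derivative (ages a_m \<times> {0<..<1}) (0, 1) (case_prod ux) (case_prod uxx) \<and>
        (AE (a, x) in lebesgue. (a, x) \<in> ages a_m \<times> {0<..<1} \<longrightarrow>
           ua a x = d * uxx a x - \<mu> a x * u a x) \<and>
        (\<forall>a\<in>ages a_m. \<forall>x\<in>{0, 1}. ux a x = 0)) \<and>
     (\<forall>x\<in>{0<..<1}. u 0 x = f x (LINT a:ages a_m|lebesgue. \<beta> a x * u a x))"

definition admissible_diffusion ::
  "ereal \<Rightarrow> (real \<Rightarrow> real \<Rightarrow> real) \<Rightarrow> (real \<Rightarrow> real \<Rightarrow> real) \<Rightarrow> (real \<Rightarrow> real \<Rightarrow> real) \<Rightarrow> real set" where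
  "admissible_diffusion a_m \<beta> \<mu> f = {d. 0 < d \<and> (\<exists>u. positive_equilibrium a_m \<beta> \<mu> f d u)}"

text \<open>
  Positive solutions on \<open>I\<close> of the problem without diffusion; continuity on the closed age interval
  selects the representative of the $W^{1,1}$ class for which \<open>v 0 x\<close> is meaningful.
\<close>

definition positive_limit_solution ::
  "real \<Rightarrow> (real \<Rightarrow> real \<Rightarrow> real) \<Rightarrow> (real \<Rightarrow> real \<Rightarrow> real) \<Rightarrow> (real \<Rightarrow> real \<Rightarrow> real) \<Rightarrow>
   real set \<Rightarrow> (real \<Rightarrow> real \<Rightarrow> real) \<Rightarrow> bool" where
  "positive_limit_solution a_plus \<beta> \<mu> f I v \<longleftrightarrow>
     (\<forall>x\<in>I.
        continuous_on {0..a_plus} (\<lambda>a. v a x) \<and>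
        W11 {0<..<a_plus} (\<lambda>a. v a x) \<and>
        (\<forall>a\<in>{0..a_plus}. 0 < v a x) \<and>
        weak_derivative {0<..<a_plus} 1 (\<lambda>a. v a x) (\<lambda>a. - \<mu> a x * v a x) \<and>
        v 0 x = f x (LINT a:{0<..<a_plus}|lebesgue. \<beta> a x * v a x))"

definition Gam ::
  "real \<Rightarrow> (real \<Rightarrow> real \<Rightarrow> real) \<Rightarrow> (real \<Rightarrow> real \<Rightarrow> real) \<Rightarrow> (real \<Rightarrow> real \<Rightarrow> real) \<Rightarrow> real \<Rightarrow> real" where
  "Gam a_c \<beta> \<mu> f x =
     partial_u f x 0 *
     (LINT a:{0<..<a_c}|lebesgue. \<beta> a x * exp (- (LINT s:{0<..<a}|lebesgue. \<mu> s x)))"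

end

theory Submission
  imports Defs
begin

text \<open>
  Fix \<open>x0\<close> in \<open>I\<close>.  For small diffusion the density near \<open>x0\<close> almost follows the pure ageing
  dynamics, so that the trace at age \<open>0\<close> is almost a fixed point of \<open>s \<mapsto> f x0 (K * s)\<close>, where \<open>K\<close> is
  the expected number of offspring of a newborn at \<open>x0\<close>.  This is made precise by sweeping: on a
  small ball around \<open>x0\<close> the equilibrium is compared with the explicit heat solutions
  \<open>\<Theta> * exp (d * k^2 * a) * cosh (k * (x - x0))\<close> and \<open>\<Theta> * exp (- (d * k^2 * a)) * cos (k * (x - x0))\<close>,
  multiplied by the survival probability.  Take the extremal \<open>\<Theta>\<close> for which the comparison holds at
  age \<open>0\<close>; as \<open>f x u / u\<close> is strictly decreasing, the birth law improves it at the point of touching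
  unless \<open>\<Theta>\<close> is already beyond the fixed point.  The upper comparison needs \<open>u \<le> L\<close> on the sides
  of the ball, which is the maximum principle for the Neumann problem.  As only weak derivatives
  are available, the comparisons rest on a maximum principle proved by mollifying in space.
\<close>

section \<open>Smooth test functions\<close>

text \<open>The mortality is only bounded and measurable in age, so \<open>u\<close> has no
  classical age derivative, and it is controlled slice by slice in \<open>x\<close>. Near
  \<open>x0\<close> it is therefore replaced by a function \<open>m\<close> of age alone, up to an
  error \<eta>: \<open>u\<close> satisfies an inequality with mortality \<open>m - \<eta>\<close>,
  and \<open>-u\<close> one with \<open>m + \<eta>\<close>. An integrating factor removes a
  mortality that depends on age alone, and what remains is a heat inequality with explicit separated
  barriers. The profile \<open>cosh\<close> is 1 at the centre and, for large \<open>k\<close>, so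
  large on the sides of the ball that the crude bound \<open>L\<close> suffices there;
  \<open>cos\<close> vanishes on the sides, where positivity suffices. The constants are chosen in
  the order \<eta>, radius \<delta>, \<open>k\<close>, and last \<open>d\<close>: although
  \<open>k\<close> grows as \<delta> shrinks, \<open>d * k^2\<close> falls below \<eta> as
  \<open>d\<close> tends to 0, so the barriers lose only a factor near 1. All that the sweeping
  needs at \<open>x0\<close> is a strict inequality between \<open>f x0 (K * S)\<close> and
  \<open>S\<close>, an open condition that survives these perturbations; monotonicity of
  \<open>f x u / u\<close> gives it for every \<open>S\<close> on either side of the fixed
  point.\<close>

definition flat :: "real poly \<Rightarrow> real \<Rightarrow> real" where
  "flat q t = (if t > 0 then poly q (1 / t) * exp (- (1 / t)) else 0)"

lemma poly_times_exp_minus_tendsto_0: "((\<lambda>s. poly q s * exp (- s)) \<longlongrightarrow> (0::real)) at_top"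
proof -
  have shift: "((\<lambda>s. s ^ n * exp (- s)) \<longlongrightarrow> (0::real)) at_top" for n
    using tendsto_power_div_exp_0[of n] by (simp add: exp_minus field_simps)
  have "((\<lambda>s. \<Sum>i\<le>degree q. coeff q i * (s ^ i * exp (- s))) \<longlongrightarrow>
          (\<Sum>i\<le>degree q. coeff q i * 0)) at_top"
    by (intro tendsto_intros shift)
  then show ?thesis
    by (simp only: poly_altdef sum_distrib_right mult.assoc mult_zero_right sum.neutral_const)
qed

text \<open>With \<open>s = 1 / t\<close> and \<open>ds / dt = - s^2\<close>, differentiating
  \<open>q(s) e^(-s)\<close> gives \<open>s^2 (q(s) - q'(s)) e^(-s)\<close>, which explains the
  polynomial. Carrying an arbitrary \<open>q\<close> makes the family closed under differentiation.
  At 0 the difference quotient is again of this form, with \<open>X q\<close> for \<open>q\<close>,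
  and tends to 0.\<close>

lemma DERIV_flat:
  "(flat q has_real_derivative flat ([:0, 0, 1:] * (q - pderiv q)) t) (at t)"
proof -
  consider "t > 0" | "t < 0" | "t = 0" by linarith
  then show ?thesis
  proof cases
    case 1
    have "((\<lambda>t. poly q (1 / t) * exp (- (1 / t))) has_real_derivative
            flat ([:0, 0, 1:] * (q - pderiv q)) t) (at t)"
      using 1 unfolding flat_def
      by (auto intro!: derivative_eq_intros simp: field_simps power2_eq_square)
    moreover have "eventually (\<lambda>y. flat q y = poly q (1 / y) * exp (- (1 / y))) (nhds t)"
      using 1 eventually_nhds_in_open[of "{0<..}" t]
      by (auto elim!: eventually_mono simp: flat_def)
    ultimately show ?thesis
      using iffD2[OF DERIV_cong_ev[OF refl _ refl], rotated] by fast
  next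
    case 2
    have "eventually (\<lambda>y. flat q y = 0) (nhds t)"
      using 2 eventually_nhds_in_open[of "{..<0}" t]
      by (auto elim!: eventually_mono simp: flat_def)
    then have "(flat q has_real_derivative 0) (at t)"
      using iffD2[OF DERIV_cong_ev[OF refl _ refl] DERIV_const] by blast
    then show ?thesis using 2 by (simp add: flat_def)
  next
    case 3
    have "((\<lambda>h. flat q h / h) \<longlongrightarrow> 0) (at_right 0)"
    proof -
      have "((\<lambda>h. poly ([:0, 1:] * q) (inverse h) * exp (- inverse h)) \<longlongrightarrow> (0::real)) (at_right 0)"
        by (rule filterlim_compose[OF poly_times_exp_minus_tendsto_0 filterlim_inverse_at_top_right])
      then show ?thesis
        by (rule Lim_transform_eventually)
          (auto simp: eventually_at_right_field flat_def field_simps intro!: exI[of _ 1])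
    qed
    moreover have "((\<lambda>h. flat q h / h) \<longlongrightarrow> 0) (at_left 0)"
      by (rule tendsto_eventually) (auto simp: eventually_at_left_field flat_def intro!: exI[of _ "-1"])
    ultimately have "((\<lambda>h. flat q h / h) \<longlongrightarrow> 0) (at 0)"
      by (simp add: filterlim_split_at)
    then show ?thesis
      using 3 by (simp add: DERIV_def flat_def)
  qed
qed

text \<open>An algebra of smooth functions closed under differentiation and rich enough for bump functions
  and smooth steps; it makes smoothness in the sense of iterated directional derivatives a
  one-step induction.\<close>

inductive bump_algebra :: "('a::euclidean_space \<Rightarrow> real) \<Rightarrow> bool" where
  bump_flat: "bump_algebra (\<lambda>p. flat q (c + l \<bullet> p))"
| bump_const: "bump_algebra (\<lambda>p. c)"
| bump_add: "bump_algebra F \<Longrightarrow> bump_algebra G \<Longrightarrow> bump_algebra (\<lambda>p. F p + G p)"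
| bump_mult: "bump_algebra F \<Longrightarrow> bump_algebra G \<Longrightarrow> bump_algebra (\<lambda>p. F p * G p)"
| bump_inverse: "bump_algebra F \<Longrightarrow> (\<And>p. F p \<noteq> 0) \<Longrightarrow> bump_algebra (\<lambda>p. inverse (F p))"

lemma directional_derivative_eq:
  assumes "\<And>p. (F has_derivative F' p) (at p)"
  shows "directional_derivative v F = (\<lambda>p. F' p v)"
  unfolding directional_derivative_def
  by (rule ext) (metis assms frechet_derivative_at)

lemma has_derivative_flat:
  "((\<lambda>p. flat q (c + l \<bullet> p)) has_derivative
     (\<lambda>h. flat ([:0, 0, 1:] * (q - pderiv q)) (c + l \<bullet> p) * (l \<bullet> h))) (at p)"
proof -
  have "((\<lambda>p. c + l \<bullet> p) has_derivative (\<lambda>h. l \<bullet> h)) (at p)"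
    by (auto intro!: derivative_eq_intros)
  from has_derivative_compose[OF this DERIV_flat[of q "c + l \<bullet> p", unfolded has_field_derivative_def]]
  show ?thesis by simp
qed

lemma bump_algebra_derivative:
  assumes "bump_algebra F"
  shows "\<exists>F'. (\<forall>p. (F has_derivative F' p) (at p)) \<and> (\<forall>v. bump_algebra (\<lambda>p. F' p v))"
  using assms
proof induction
  case (bump_flat q c l)
  show ?case
    by (rule exI[of _ "\<lambda>p h. flat ([:0, 0, 1:] * (q - pderiv q)) (c + l \<bullet> p) * (l \<bullet> h)"])
      (auto simp del: mult_pCons_left intro!: has_derivative_flat bump_algebra.intros)
next
  case (bump_const c)
  show ?case
    by (rule exI[of _ "\<lambda>p h. 0"]) (auto intro: bump_algebra.intros)
next
  case (bump_add F G)
  then obtain F' G' where "\<forall>p. (F has_derivative F' p) (at p)" "\<forall>v. bump_algebra (\<lambda>p. F' p v)"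
    "\<forall>p. (G has_derivative G' p) (at p)" "\<forall>v. bump_algebra (\<lambda>p. G' p v)" by blast
  then show ?case
    by (intro exI[of _ "\<lambda>p h. F' p h + G' p h"])
      (auto intro!: bump_algebra.intros has_derivative_add)
next
  case (bump_mult F G)
  then obtain F' G' where "\<forall>p. (F has_derivative F' p) (at p)" "\<forall>v. bump_algebra (\<lambda>p. F' p v)"
    "\<forall>p. (G has_derivative G' p) (at p)" "\<forall>v. bump_algebra (\<lambda>p. G' p v)" by blast
  then show ?case
    using bump_mult.hyps
    by (intro exI[of _ "\<lambda>p h. F p * G' p h + F' p h * G p"])
      (auto intro!: bump_algebra.intros has_derivative_mult)
next
  case (bump_inverse F)
  then obtain F' where F': "\<forall>p. (F has_derivative F' p) (at p)" "\<forall>v. bump_algebra (\<lambda>p. F' p v)"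
    by blast
  show ?case
  proof (intro exI conjI allI)
    show "((\<lambda>p. inverse (F p)) has_derivative (\<lambda>h. (-1) * (inverse (F p) * F' p h * inverse (F p)))) (at p)"
      for p using Deriv.has_derivative_inverse[OF bump_inverse.hyps(2) F'(1)[rule_format]] by simp
    show "bump_algebra (\<lambda>p. (-1) * (inverse (F p) * F' p v * inverse (F p)))" for v
      using F'(2) bump_inverse.hyps
      by (intro bump_algebra.bump_mult bump_algebra.bump_const bump_algebra.bump_inverse) auto
  qed
qed

lemma bump_algebra_differentiable: "bump_algebra F \<Longrightarrow> F differentiable (at p)"
  using bump_algebra_derivative differentiableI by blast

lemma bump_algebra_directional_derivative:
  assumes "bump_algebra F" shows "bump_algebra (directional_derivative v F)"
proof -
  from bump_algebra_derivative[OF assms] obtain F' where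
    "\<forall>p. (F has_derivative F' p) (at p)" "\<forall>v. bump_algebra (\<lambda>p. F' p v)" by blast
  then show ?thesis using directional_derivative_eq[of F F' v] by simp
qed

lemma bump_algebra_smooth:
  assumes "bump_algebra F" shows "smooth_fun F"
proof -
  have "bump_algebra (foldr directional_derivative vs F)" for vs
    by (induction vs) (simp_all add: assms bump_algebra_directional_derivative)
  then show ?thesis
    by (simp add: smooth_fun_def bump_algebra_differentiable)
qed

text \<open>Affine substitutions can be pushed into the leaves \<open>flat\<close>; this supplies
  the rescaled and translated test functions.\<close>

lemma bump_algebra_compose_inner:
  fixes F :: "real \<Rightarrow> real"
  assumes "bump_algebra F" shows "bump_algebra (\<lambda>p. F (c + l \<bullet> p))"
  using assms
proof induction
  case (bump_flat q c' l')
  show ?case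
    using bump_algebra.bump_flat[of q "c' + l' * c" "l' *\<^sub>R l"]
    by (simp add: algebra_simps inner_simps)
qed (auto intro: bump_algebra.intros)

lemma bump_algebra_deriv:
  fixes F :: "real \<Rightarrow> real"
  assumes "bump_algebra F"
  shows "bump_algebra (deriv F)" "(F has_real_derivative deriv F t) (at t)"
    "directional_derivative 1 F = deriv F" "continuous_on S F"
proof -
  have d: "(F has_real_derivative deriv F t) (at t)" for t
    using bump_algebra_differentiable[OF assms]
    by (metis DERIV_deriv_iff_real_differentiable)
  then show "(F has_real_derivative deriv F t) (at t)" .
  show e: "directional_derivative 1 F = deriv F"
    using directional_derivative_eq[of F "\<lambda>p. (*) (deriv F p)" 1] d
    by (simp add: has_field_derivative_def)
  show "bump_algebra (deriv F)"
    using bump_algebra_directional_derivative[OF assms, of 1] e by simp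
  show "continuous_on S F"
    using d by (meson DERIV_isCont continuous_at_imp_continuous_on)
qed

definition bump :: "real \<Rightarrow> real" where
  "bump t = flat 1 (1 + t) * flat 1 (1 - t)"

lemma bump_algebra_flat_affine: "bump_algebra (\<lambda>t::real. flat q (c + l * t))"
  using bump_algebra.bump_flat[of q c l] by simp

lemma bump_algebra_bump: "bump_algebra bump"
  using bump_mult[OF bump_algebra_flat_affine[of 1 1 1] bump_algebra_flat_affine[of 1 1 "-1"]]
  by (simp add: bump_def[abs_def])

lemma bump_nonneg: "0 \<le> bump t" by (simp add: bump_def flat_def)

lemma bump_pos_iff: "0 < bump t \<longleftrightarrow> \<bar>t\<bar> < 1" by (auto simp: bump_def flat_def)

lemma bump_zero: "\<bar>t\<bar> \<ge> 1 \<Longrightarrow> bump t = 0" by (auto simp: bump_def flat_def)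

definition smooth_step :: "real \<Rightarrow> real" where
  "smooth_step t = flat 1 t * inverse (flat 1 t + flat 1 (1 - t))"

text \<open>\<open>t\<close> and \<open>1 - t\<close> are never both nonpositive; hence the
  denominator of \<open>smooth_step\<close> vanishes nowhere, as \<open>bump_inverse\<close>
  demands.\<close>

lemma flat_sum_pos: "0 < flat 1 t + flat 1 (1 - t)"
  by (auto simp: flat_def add_pos_pos)

lemma bump_algebra_smooth_step: "bump_algebra smooth_step"
proof -
  have 1: "bump_algebra (\<lambda>t. flat 1 t)"
    using bump_algebra_flat_affine[of 1 0 1] by simp
  have 2: "bump_algebra (\<lambda>t. flat 1 (1 - t))"
    using bump_algebra_flat_affine[of 1 1 "-1"] by simp
  have 3: "flat 1 t + flat 1 (1 - t) \<noteq> 0" for t using flat_sum_pos[of t] by simp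
  have "bump_algebra (\<lambda>t. flat 1 t * inverse (flat 1 t + flat 1 (1 - t)))"
    by (intro bump_algebra.bump_mult bump_algebra.bump_inverse bump_algebra.bump_add 1 2 3)
  then show ?thesis unfolding smooth_step_def[abs_def] .
qed

lemma smooth_step_range: "0 \<le> smooth_step t" "smooth_step t \<le> 1"
  using flat_sum_pos[of t] by (auto simp: smooth_step_def flat_def divide_simps)

lemma smooth_step_0: "t \<le> 0 \<Longrightarrow> smooth_step t = 0" by (simp add: smooth_step_def flat_def)

lemma smooth_step_1: "t \<ge> 1 \<Longrightarrow> smooth_step t = 1" by (simp add: smooth_step_def flat_def)

lemma mono_flat_1: "s \<le> t \<Longrightarrow> flat 1 s \<le> flat 1 t"
  by (auto simp: flat_def frac_le)

text \<open>After clearing denominators the common product cancels, and monotonicity of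
  \<open>flat 1\<close> in both remaining factors is enough.\<close>

lemma smooth_step_mono: "s \<le> t \<Longrightarrow> smooth_step s \<le> smooth_step t"
proof -
  assume st: "s \<le> t"
  have "flat 1 s * flat 1 (1 - t) \<le> flat 1 t * flat 1 (1 - s)"
    using st by (intro mult_mono mono_flat_1) (auto simp: flat_def)
  then show ?thesis
    using flat_sum_pos[of s] flat_sum_pos[of t]
    by (simp add: smooth_step_def divide_simps algebra_simps)
qed

section \<open>Indefinite integrals of bounded functions\<close>

lemma continuous_on_Icc_abs_bound:
  fixes A :: "real \<Rightarrow> real"
  assumes "continuous_on {a..b} A"
  obtains P where "P > 0" "\<And>r. r \<in> {a..b} \<Longrightarrow> \<bar>A r\<bar> \<le> P"
proof -
  have "bounded (A ` {a..b})"
    by (intro compact_imp_bounded compact_continuous_image assms compact_Icc)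
  then obtain P where "P > 0" "\<forall>y\<in>A ` {a..b}. norm y \<le> P" by (auto simp: bounded_pos)
  then show ?thesis using that by auto
qed

lemmas hk_integral_combine = Henstock_Kurzweil_Integration.integral_combine
  and hk_integral_add = Henstock_Kurzweil_Integration.integral_add
  and hk_integral_diff = Henstock_Kurzweil_Integration.integral_diff

text \<open>A Lipschitz function \<open>A\<close> together with an explicit bounded density \<alpha>
  of its derivative, in effect the class \<open>W^{1,infinity}\<close>. Equations with measurable
  mortality are handled through increments, without differentiating at points.\<close>

definition lip_primitive :: "real \<Rightarrow> real \<Rightarrow> (real \<Rightarrow> real) \<Rightarrow> (real \<Rightarrow> real) \<Rightarrow> bool" where
  "lip_primitive a b A \<alpha> \<longleftrightarrow>
     \<alpha> \<in> borel_measurable (lebesgue_on {a..b}) \<and> (\<exists>M. \<forall>r\<in>{a..b}. \<bar>\<alpha> r\<bar> \<le> M) \<and>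
     (\<forall>s t. a \<le> s \<longrightarrow> s \<le> t \<longrightarrow> t \<le> b \<longrightarrow> A t - A s = integral {s..t} \<alpha>)"

lemma bounded_measurable_absolutely_integrable:
  fixes g :: "real \<Rightarrow> real"
  assumes "g \<in> borel_measurable (lebesgue_on {a..b})" "\<And>r. r \<in> {a..b} \<Longrightarrow> \<bar>g r\<bar> \<le> M"
    "a \<le> s" "t \<le> b"
  shows "g absolutely_integrable_on {s..t}"
proof (rule measurable_bounded_by_integrable_imp_absolutely_integrable[where g="\<lambda>_. M"])
  show "g \<in> borel_measurable (lebesgue_on {s..t})"
    using assms(3,4) by (intro measurable_restrict_mono[OF assms(1)]) auto
qed (use assms in auto)

lemma abs_integral_le:
  fixes g :: "real \<Rightarrow> real"
  assumes "s \<le> t" "g integrable_on {s..t}" "\<And>r. r \<in> {s..t} \<Longrightarrow> \<bar>g r\<bar> \<le> M"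
  shows "\<bar>integral {s..t} g\<bar> \<le> M * (t - s)"
proof -
  have "norm (integral {s..t} g) \<le> integral {s..t} (\<lambda>_. M)"
    using assms by (intro integral_norm_bound_integral) auto
  then show ?thesis using assms(1) by (simp add: mult.commute)
qed

lemma lip_primitive_integrable:
  assumes "lip_primitive a b A \<alpha>" "a \<le> s" "t \<le> b"
  shows "\<alpha> absolutely_integrable_on {s..t}" "\<alpha> integrable_on {s..t}"
proof -
  from assms(1) obtain M where "\<alpha> \<in> borel_measurable (lebesgue_on {a..b})"
    "\<And>r. r \<in> {a..b} \<Longrightarrow> \<bar>\<alpha> r\<bar> \<le> M"
    unfolding lip_primitive_def by blast
  then show "\<alpha> absolutely_integrable_on {s..t}"
    using assms(2,3) by (rule bounded_measurable_absolutely_integrable)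
  then show "\<alpha> integrable_on {s..t}" by (rule set_lebesgue_integral_eq_integral)
qed

lemma lip_primitive_increment:
  "lip_primitive a b A \<alpha> \<Longrightarrow> a \<le> s \<Longrightarrow> s \<le> t \<Longrightarrow> t \<le> b \<Longrightarrow> A t - A s = integral {s..t} \<alpha>"
  by (simp add: lip_primitive_def)

lemma lip_primitive_bound:
  assumes "lip_primitive a b A \<alpha>"
  obtains M where "M > 0" "\<And>r. r \<in> {a..b} \<Longrightarrow> \<bar>\<alpha> r\<bar> \<le> M"
    "\<And>s t. s \<in> {a..b} \<Longrightarrow> t \<in> {a..b} \<Longrightarrow> \<bar>A t - A s\<bar> \<le> M * \<bar>t - s\<bar>"
proof -
  from assms obtain M where M: "\<And>r. r \<in> {a..b} \<Longrightarrow> \<bar>\<alpha> r\<bar> \<le> M"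
    unfolding lip_primitive_def by blast
  define M' where "M' = \<bar>M\<bar> + 1"
  have M': "\<And>r. r \<in> {a..b} \<Longrightarrow> \<bar>\<alpha> r\<bar> \<le> M'" using M unfolding M'_def by force
  have *: "\<bar>A t - A s\<bar> \<le> M' * (t - s)" if "a \<le> s" "s \<le> t" "t \<le> b" for s t
  proof -
    have "A t - A s = integral {s..t} \<alpha>" using assms that unfolding lip_primitive_def by blast
    then show ?thesis
      using abs_integral_le[of s t \<alpha> M'] lip_primitive_integrable[OF assms, of s t] M' that by simp
  qed
  show ?thesis
  proof (rule that[of M'])
    show "M' > 0" by (simp add: M'_def)
    show "\<bar>A t - A s\<bar> \<le> M' * \<bar>t - s\<bar>" if "s \<in> {a..b}" "t \<in> {a..b}" for s t
      using *[of s t] *[of t s] that by (cases "s \<le> t") (auto simp: abs_minus_commute)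
  qed (use M' in auto)
qed

lemma lip_primitive_continuous:
  assumes "lip_primitive a b A \<alpha>" shows "continuous_on {a..b} A"
proof -
  obtain M where "M > 0" "\<And>r. r \<in> {a..b} \<Longrightarrow> \<bar>\<alpha> r\<bar> \<le> M" "\<And>s t. s \<in> {a..b} \<Longrightarrow> t \<in> {a..b} \<Longrightarrow> \<bar>A t - A s\<bar> \<le> M * \<bar>t - s\<bar>"
    by (rule lip_primitive_bound[OF assms], rule that, assumption+)
  then have "M-lipschitz_on {a..b} A"
    by (intro lipschitz_onI) (auto simp: dist_real_def abs_minus_commute)
  then show ?thesis by (rule lipschitz_on_continuous_on)
qed

text \<open>The difference quotients at \<open>t\<close> are at most
  \<open>C * \<bar>s - t\<bar>\<close>, so the derivative is zero everywhere.\<close>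

lemma const_if_quadratic_increments:
  fixes G :: "real \<Rightarrow> real"
  assumes "\<And>s t. a \<le> s \<Longrightarrow> s \<le> t \<Longrightarrow> t \<le> b \<Longrightarrow> \<bar>G t - G s\<bar> \<le> C * (t - s)\<^sup>2"
    and "x \<in> {a..b}" "y \<in> {a..b}"
  shows "G x = G y"
proof -
  have sym: "\<bar>G t - G s\<bar> \<le> C * (t - s)\<^sup>2" if "s \<in> {a..b}" "t \<in> {a..b}" for s t
  proof (cases "s \<le> t")
    case True
    then show ?thesis using assms(1)[of s t] that by simp
  next
    case False
    then have "\<bar>G s - G t\<bar> \<le> C * (s - t)\<^sup>2" using assms(1)[of t s] that by simp
    then show ?thesis by (simp only: abs_minus_commute[of "G s"] power2_commute[of s])
  qed
  have "(G has_derivative (\<lambda>h. 0)) (at t within {a..b})" if t: "t \<in> {a..b}" for t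
  proof -
    have "((\<lambda>s. C * \<bar>s - t\<bar>) \<longlongrightarrow> C * \<bar>t - t\<bar>) (at t within {a..b})"
      by (intro tendsto_intros)
    then have "((\<lambda>s. C * \<bar>s - t\<bar>) \<longlongrightarrow> 0) (at t within {a..b})" by simp
    have "\<forall>\<^sub>F s in at t within {a..b}. norm ((G s - G t) / (s - t)) \<le> C * \<bar>s - t\<bar>"
      unfolding eventually_at_filter
    proof (rule always_eventually, intro allI impI)
      fix s assume "s \<noteq> t" "s \<in> {a..b}"
      then show "norm ((G s - G t) / (s - t)) \<le> C * \<bar>s - t\<bar>"
      proof -
        have pos: "0 < \<bar>s - t\<bar>" using \<open>s \<noteq> t\<close> by simp
        have "\<bar>G s - G t\<bar> \<le> (C * \<bar>s - t\<bar>) * \<bar>s - t\<bar>"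
          using sym[OF t \<open>s \<in> {a..b}\<close>] unfolding mult.assoc abs_mult_self_eq power2_eq_square .
        then show ?thesis
          using pos by (simp only: real_norm_def abs_divide pos_divide_le_eq)
      qed
    qed
    then have "((\<lambda>s. (G s - G t) / (s - t)) \<longlongrightarrow> 0) (at t within {a..b})"
      by (rule Lim_null_comparison) fact
    then have "(G has_real_derivative 0) (at t within {a..b})"
      by (simp add: has_field_derivative_iff)
    then show ?thesis by (simp add: has_field_derivative_def lambda_zero)
  qed
  then show ?thesis
    using has_derivative_zero_unique[of "{a..b}" G x y] assms(2,3) by simp
qed

text \<open>This takes the place of almost everywhere differentiation in the product and chain
  rules: an error quadratic in the length of the interval makes \<open>A\<close> minus the integral
  of \<alpha> constant.\<close>

lemma lip_primitive_if_quadratic_error: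
  assumes meas: "\<alpha> \<in> borel_measurable (lebesgue_on {a..b})"
    and bd: "\<And>r. r \<in> {a..b} \<Longrightarrow> \<bar>\<alpha> r\<bar> \<le> M"
    and err: "\<And>s t. a \<le> s \<Longrightarrow> s \<le> t \<Longrightarrow> t \<le> b \<Longrightarrow> \<bar>A t - A s - integral {s..t} \<alpha>\<bar> \<le> C * (t - s)\<^sup>2"
  shows "lip_primitive a b A \<alpha>"
proof -
  have int: "\<alpha> integrable_on {s..t}" if "a \<le> s" "t \<le> b" for s t
    using bounded_measurable_absolutely_integrable[OF meas bd that]
    by (rule set_lebesgue_integral_eq_integral)
  have split: "integral {a..t} \<alpha> - integral {a..s} \<alpha> = integral {s..t} \<alpha>"
    if "a \<le> s" "s \<le> t" "t \<le> b" for s t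
    using hk_integral_combine[of a s t \<alpha>] that int[of a t] by auto
  define G where "G t = A t - integral {a..t} \<alpha>" for t
  have const: "G s = G t" if "s \<in> {a..b}" "t \<in> {a..b}" for s t
  proof (rule const_if_quadratic_increments[OF _ that])
    show "\<bar>G t - G s\<bar> \<le> C * (t - s)\<^sup>2" if "a \<le> s" "s \<le> t" "t \<le> b" for s t
      using err[OF that] split[OF that] by (simp add: G_def algebra_simps)
  qed
  then have "A t - A s = integral {s..t} \<alpha>" if "a \<le> s" "s \<le> t" "t \<le> b" for s t
  proof -
    have "G s = G t" using const[of s t] that by simp
    then show ?thesis using split[OF that] by (simp add: G_def)
  qed
  then show ?thesis unfolding lip_primitive_def using meas bd by blast
qed

lemma lip_primitive_mult:
  assumes A: "lip_primitive a b A \<alpha>" and B: "lip_primitive a b B \<beta>"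
  shows "lip_primitive a b (\<lambda>t. A t * B t) (\<lambda>r. \<alpha> r * B r + A r * \<beta> r)"
proof -
  obtain M where M: "M > 0" "\<And>r. r \<in> {a..b} \<Longrightarrow> \<bar>\<alpha> r\<bar> \<le> M"
    "\<And>s t. s \<in> {a..b} \<Longrightarrow> t \<in> {a..b} \<Longrightarrow> \<bar>A t - A s\<bar> \<le> M * \<bar>t - s\<bar>"
    by (rule lip_primitive_bound[OF A], rule that, assumption+)
  obtain N where N: "N > 0" "\<And>r. r \<in> {a..b} \<Longrightarrow> \<bar>\<beta> r\<bar> \<le> N"
    "\<And>s t. s \<in> {a..b} \<Longrightarrow> t \<in> {a..b} \<Longrightarrow> \<bar>B t - B s\<bar> \<le> N * \<bar>t - s\<bar>"
    by (rule lip_primitive_bound[OF B], rule that, assumption+)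
  note cA = lip_primitive_continuous[OF A] and cB = lip_primitive_continuous[OF B]
  obtain P where P0: "P > 0" and P: "\<And>r. r \<in> {a..b} \<Longrightarrow> \<bar>A r\<bar> \<le> P"
    using continuous_on_Icc_abs_bound[OF cA] by blast
  obtain Q where Q0: "Q > 0" and Q: "\<And>r. r \<in> {a..b} \<Longrightarrow> \<bar>B r\<bar> \<le> Q"
    using continuous_on_Icc_abs_bound[OF cB] by blast
  have mA: "A \<in> borel_measurable (lebesgue_on {a..b})" and mB: "B \<in> borel_measurable (lebesgue_on {a..b})"
    by (auto intro!: continuous_imp_measurable_on_sets_lebesgue cA cB)
  have m: "\<alpha> \<in> borel_measurable (lebesgue_on {a..b})" "\<beta> \<in> borel_measurable (lebesgue_on {a..b})"
    using A B by (auto simp: lip_primitive_def)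
  let ?g = "\<lambda>r. \<alpha> r * B r + A r * \<beta> r"
  have mg: "?g \<in> borel_measurable (lebesgue_on {a..b})"
    using mA mB m by (intro borel_measurable_add borel_measurable_times)
  have bg: "\<bar>?g r\<bar> \<le> M * Q + P * N" if "r \<in> {a..b}" for r
  proof -
    have "\<bar>\<alpha> r * B r\<bar> \<le> M * Q" "\<bar>A r * \<beta> r\<bar> \<le> P * N"
      unfolding abs_mult using M(2)[OF that] N(2)[OF that] P[OF that] Q[OF that] M(1) N(1) P0 Q0
      by (intro mult_mono; simp)+
    then show ?thesis by linarith
  qed
  show ?thesis
  proof (rule lip_primitive_if_quadratic_error[OF mg bg])
    fix s t assume st: "a \<le> s" "s \<le> t" "t \<le> b"
    have ig: "?g integrable_on {s..t}"
      by (rule set_lebesgue_integral_eq_integral(1)[OF bounded_measurable_absolutely_integrable[OF mg bg st(1,3)]])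
    have ia: "\<alpha> integrable_on {s..t}" and ib: "\<beta> integrable_on {s..t}"
      using lip_primitive_integrable A B st by blast+
    have eqs: "A t - A s = integral {s..t} \<alpha>" "B t - B s = integral {s..t} \<beta>"
      using A B st by (auto simp: lip_primitive_def)
    \<comment> \<open>Freezing \<open>B\<close> at \<open>t\<close> and \<open>A\<close> at
      \<open>s\<close> writes the increment of the product as an exact integral. Unfreezing changes
      the integrand by a multiple of \<open>t - s\<close>, which is a quadratic error after
      integration.\<close>
    let ?h = "\<lambda>r. \<alpha> r * B t + A s * \<beta> r - ?g r"
    have ih: "?h integrable_on {s..t}"
      using ig ia ib by (intro integrable_diff[OF integrable_add] integrable_on_mult_right integrable_on_mult_left)
    have "A t * B t - A s * B s = (A t - A s) * B t + A s * (B t - B s)"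
      by (simp add: algebra_simps)
    also have "\<dots> = integral {s..t} (\<lambda>r. \<alpha> r * B t + A s * \<beta> r)"
      unfolding eqs using ia ib
      by (subst integral_add) (auto intro!: integrable_on_mult_right integrable_on_mult_left)
    finally have "A t * B t - A s * B s - integral {s..t} ?g = integral {s..t} ?h"
      using ig ia ib
      by (subst integral_diff[OF integrable_add]) (auto intro!: integrable_on_mult_right integrable_on_mult_left)
    also have "\<bar>\<dots>\<bar> \<le> (2 * M * N * (t - s)) * (t - s)"
    proof (rule abs_integral_le[OF st(2) ih])
      fix r assume r: "r \<in> {s..t}"
      have "?h r = \<alpha> r * (B t - B r) + (A s - A r) * \<beta> r" by (simp add: algebra_simps)
      also have "\<bar>\<dots>\<bar> \<le> \<bar>\<alpha> r\<bar> * \<bar>B t - B r\<bar> + \<bar>A s - A r\<bar> * \<bar>\<beta> r\<bar>"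
        by (metis abs_mult abs_triangle_ineq)
      also have "\<dots> \<le> M * (N * (t - s)) + (M * (t - s)) * N"
      proof (intro add_mono mult_mono)
        have "\<bar>B t - B r\<bar> \<le> N * \<bar>t - r\<bar>" "\<bar>A s - A r\<bar> \<le> M * \<bar>s - r\<bar>"
          using M(3)[of r s] N(3)[of r t] r st by auto
        moreover have "N * \<bar>t - r\<bar> \<le> N * (t - s)" "M * \<bar>s - r\<bar> \<le> M * (t - s)"
          using r M(1) N(1) by (auto intro!: mult_left_mono)
        ultimately show "\<bar>B t - B r\<bar> \<le> N * (t - s)" "\<bar>A s - A r\<bar> \<le> M * (t - s)" by linarith+
      qed (use M N r st in auto)
      finally show "\<bar>?h r\<bar> \<le> 2 * M * N * (t - s)" by (simp add: algebra_simps)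
    qed
    finally show "\<bar>A t * B t - A s * B s - integral {s..t} ?g\<bar> \<le> (2 * M * N) * (t - s)\<^sup>2"
      by (simp add: power2_eq_square algebra_simps)
  qed
qed

lemma abs_exp_diff_le:
  fixes x y :: real
  assumes "x \<le> R" "y \<le> R" shows "\<bar>exp x - exp y\<bar> \<le> exp R * \<bar>x - y\<bar>"
proof -
  have *: "\<bar>exp x - exp y\<bar> \<le> exp R * \<bar>x - y\<bar>" if "y \<le> x" "x \<le> R" for x y
  proof -
    have "1 + (y - x) \<le> exp (y - x)" by (rule exp_ge_add_one_self)
    then have "exp x - exp y \<le> exp x * (x - y)"
      by (simp add: exp_diff field_simps)
    also have "\<dots> \<le> exp R * (x - y)" using that by (intro mult_right_mono) auto
    finally show ?thesis using that by simp
  qed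
  show ?thesis
    using *[of x y] *[of y x] assms by (cases "x \<le> y") (auto simp: abs_minus_commute)
qed

lemma lip_primitive_exp:
  assumes A: "lip_primitive a b A \<alpha>"
  shows "lip_primitive a b (\<lambda>t. exp (A t)) (\<lambda>r. \<alpha> r * exp (A r))"
proof -
  obtain M where M: "M > 0" "\<And>r. r \<in> {a..b} \<Longrightarrow> \<bar>\<alpha> r\<bar> \<le> M"
    "\<And>s t. s \<in> {a..b} \<Longrightarrow> t \<in> {a..b} \<Longrightarrow> \<bar>A t - A s\<bar> \<le> M * \<bar>t - s\<bar>"
    by (rule lip_primitive_bound[OF A], rule that, assumption+)
  note cA = lip_primitive_continuous[OF A]
  obtain R where R: "\<And>r. r \<in> {a..b} \<Longrightarrow> A r \<le> R"
    by (rule continuous_on_Icc_abs_bound[OF cA], rule that) (rule abs_le_D1, assumption)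
  have cE: "continuous_on {a..b} (\<lambda>t. exp (A t))" by (intro continuous_intros cA)
  have m: "\<alpha> \<in> borel_measurable (lebesgue_on {a..b})"
    using A by (auto simp: lip_primitive_def)
  let ?g = "\<lambda>r. \<alpha> r * exp (A r)"
  have mg: "?g \<in> borel_measurable (lebesgue_on {a..b})"
    using continuous_imp_measurable_on_sets_lebesgue[OF cE] m by (intro borel_measurable_times) auto
  have bg: "\<bar>?g r\<bar> \<le> M * exp R" if "r \<in> {a..b}" for r
    unfolding abs_mult using M R that by (intro mult_mono) auto
  show ?thesis
  proof (rule lip_primitive_if_quadratic_error[OF mg bg])
    fix s t assume st: "a \<le> s" "s \<le> t" "t \<le> b"
    have ig: "?g integrable_on {s..t}"
      by (rule set_lebesgue_integral_eq_integral(1)[OF bounded_measurable_absolutely_integrable[OF mg bg st(1,3)]])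
    have ia: "\<alpha> integrable_on {s..t}"
      using lip_primitive_integrable A st by blast
    have eqA: "A t - A s = integral {s..t} \<alpha>"
      using A st by (auto simp: lip_primitive_def)
    have lip: "\<bar>A t' - A s'\<bar> \<le> M * (t - s)" if "s' \<in> {s..t}" "t' \<in> {s..t}" for s' t'
    proof -
      have "\<bar>A t' - A s'\<bar> \<le> M * \<bar>t' - s'\<bar>" using M(3) that st by auto
      also have "\<dots> \<le> M * (t - s)" using that M(1) by (intro mult_left_mono) auto
      finally show ?thesis .
    qed
    \<comment> \<open>A mean value point freezes the exponential: the increment is exactly
      \<open>exp \<xi>\<close> times the integral of \<alpha>, and \<xi> is within
      \<open>2 * M * (t - s)\<close> of each \<open>A r\<close> on the interval.\<close>
    obtain \<xi> where xi: "\<xi> \<le> R" "exp (A t) - exp (A s) = exp \<xi> * (A t - A s)"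
      "\<bar>\<xi> - A s\<bar> \<le> \<bar>A t - A s\<bar>"
    proof (cases "A s" "A t" rule: linorder_cases)
      case less
      from MVT2[OF this, of exp exp] obtain z where "A s < z" "z < A t" "exp (A t) - exp (A s) = (A t - A s) * exp z"
        by (auto intro: DERIV_exp)
      then show ?thesis using that[of z] R[of t] st by (auto simp: mult.commute)
    next
      case equal
      then show ?thesis using that[of "A s"] R[of s] st by auto
    next
      case greater
      from MVT2[OF this, of exp exp] obtain z where "A t < z" "z < A s" "exp (A s) - exp (A t) = (A s - A t) * exp z"
        by (auto intro: DERIV_exp)
      then show ?thesis using that[of z] R[of s] st by (auto simp: algebra_simps)
    qed
    let ?h = "\<lambda>r. exp \<xi> * \<alpha> r - ?g r"
    have ih: "?h integrable_on {s..t}"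
      using ig ia by (intro integrable_diff integrable_on_mult_right)
    have "exp (A t) - exp (A s) - integral {s..t} ?g = integral {s..t} ?h"
      unfolding xi(2) eqA using ig ia
      by (subst integral_diff) (auto intro!: integrable_on_mult_right)
    also have "\<bar>\<dots>\<bar> \<le> (M * (exp R * (2 * M * (t - s)))) * (t - s)"
    proof (rule abs_integral_le[OF st(2) ih])
      fix r assume r: "r \<in> {s..t}"
      have "?h r = \<alpha> r * (exp \<xi> - exp (A r))" by (simp add: algebra_simps)
      also have "\<bar>\<dots>\<bar> \<le> M * (exp R * \<bar>\<xi> - A r\<bar>)"
        unfolding abs_mult using M r st xi(1) R by (intro mult_mono abs_exp_diff_le) auto
      also have "\<dots> \<le> M * (exp R * (2 * M * (t - s)))"
      proof -
        have "\<bar>\<xi> - A r\<bar> \<le> M * (t - s) + M * (t - s)"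
          using xi(3) lip[of s t] lip[of s r] r st by auto
        then show ?thesis using M(1) by (intro mult_left_mono) auto
      qed
      finally show "\<bar>?h r\<bar> \<le> M * (exp R * (2 * M * (t - s)))" .
    qed
    finally show "\<bar>exp (A t) - exp (A s) - integral {s..t} ?g\<bar> \<le> (2 * M * M * exp R) * (t - s)\<^sup>2"
      by (simp add: power2_eq_square algebra_simps)
  qed
qed

lemma lip_primitive_integral:
  assumes "\<alpha> \<in> borel_measurable (lebesgue_on {a..b})" "\<And>r. r \<in> {a..b} \<Longrightarrow> \<bar>\<alpha> r\<bar> \<le> M"
  shows "lip_primitive a b (\<lambda>t. integral {a..t} \<alpha>) \<alpha>"
  unfolding lip_primitive_def
proof (intro conjI allI impI)
  fix s t assume "a \<le> s" "s \<le> t" "t \<le> b"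
  then show "integral {a..t} \<alpha> - integral {a..s} \<alpha> = integral {s..t} \<alpha>"
    using hk_integral_combine[of a s t \<alpha>]
      set_lebesgue_integral_eq_integral(1)[OF bounded_measurable_absolutely_integrable[OF assms, of a t]]
    by auto
next
  show "\<exists>M. \<forall>r\<in>{a..b}. \<bar>\<alpha> r\<bar> \<le> M" by (intro exI[of _ M] ballI assms(2))
qed (rule assms(1))

lemma lip_primitive_C1:
  assumes "\<And>r. r \<in> {a..b} \<Longrightarrow> (A has_real_derivative A' r) (at r within {a..b})"
    "continuous_on {a..b} A'"
  shows "lip_primitive a b A A'"
  unfolding lip_primitive_def
proof (intro conjI allI impI)
  show "A' \<in> borel_measurable (lebesgue_on {a..b})"
    by (intro continuous_imp_measurable_on_sets_lebesgue assms) auto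
  show "\<exists>M. \<forall>r\<in>{a..b}. \<bar>A' r\<bar> \<le> M"
    by (rule continuous_on_Icc_abs_bound[OF assms(2)]) blast
  fix s t assume "a \<le> s" "s \<le> t" "t \<le> b"
  then have "(A' has_integral (A t - A s)) {s..t}"
    by (intro fundamental_theorem_of_calculus)
      (auto simp: has_real_derivative_iff_has_vector_derivative[symmetric]
        intro!: DERIV_subset[OF assms(1)])
  then show "A t - A s = integral {s..t} A'" by (simp add: integral_unique)
qed

lemma lip_primitive_const_mult:
  assumes "lip_primitive a b A \<alpha>" shows "lip_primitive a b (\<lambda>t. c * A t) (\<lambda>r. c * \<alpha> r)"
proof -
  have "lip_primitive a b (\<lambda>t. c) (\<lambda>r. 0)"
    by (rule lip_primitive_C1) auto
  from lip_primitive_mult[OF this assms] show ?thesis by simp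
qed

lemma lip_primitive_minus:
  "lip_primitive a b A \<alpha> \<Longrightarrow> lip_primitive a b (\<lambda>t. - A t) (\<lambda>r. - \<alpha> r)"
  using lip_primitive_const_mult[of a b A \<alpha> "-1"] by simp

text \<open>The product of \<open>V\<close> with the integrating factor
  \<open>exp (integral {0..t} m)\<close> is a primitive of zero.\<close>

lemma linear_ode_unique:
  assumes V: "lip_primitive 0 b V (\<lambda>r. - m r * V r)" and b: "0 \<le> b"
    and m: "m \<in> borel_measurable (lebesgue_on {0..b})" "\<And>r. r \<in> {0..b} \<Longrightarrow> \<bar>m r\<bar> \<le> M"
    and t: "t \<in> {0..b}"
  shows "V t = V 0 * exp (- integral {0..t} m)"
proof -
  have E: "lip_primitive 0 b (\<lambda>t. exp (integral {0..t} m)) (\<lambda>r. m r * exp (integral {0..r} m))"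
    by (intro lip_primitive_exp lip_primitive_integral[OF m])
  have "V t * exp (integral {0..t} m) - V 0 * exp (integral {0..0} m) =
     integral {0..t} (\<lambda>r. (- m r * V r) * exp (integral {0..r} m) + V r * (m r * exp (integral {0..r} m)))"
    using t by (intro lip_primitive_increment[OF lip_primitive_mult[OF V E]]) auto
  also have "\<dots> = 0" by (simp add: algebra_simps)
  finally show ?thesis by (simp add: exp_minus field_simps)
qed

section \<open>Weak differential inequalities\<close>

text \<open>A smoothed indicator of \<open>{s..t}\<close>. For \<open>n > 0\<close> its two ramps,
  of length \<open>1 / n\<close>, lie inside \<open>{s..t}\<close>, so that it vanishes
  outside.\<close>

definition window :: "real \<Rightarrow> real \<Rightarrow> real \<Rightarrow> real \<Rightarrow> real" where
  "window n s t a = smooth_step (n * (a - s)) * smooth_step (n * (t - a))"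

lemma bump_algebra_window: "bump_algebra (window n s t)"
proof -
  have "bump_algebra (\<lambda>a. smooth_step (- n * s + n \<bullet> a))" "bump_algebra (\<lambda>a. smooth_step (n * t + (- n) \<bullet> a))"
    by (rule bump_algebra_compose_inner[OF bump_algebra_smooth_step])+
  then have "bump_algebra (\<lambda>a. smooth_step (- n * s + n \<bullet> a) * smooth_step (n * t + (- n) \<bullet> a))"
    by (rule bump_algebra.bump_mult)
  then show ?thesis
    by (simp add: window_def[abs_def] algebra_simps)
qed

lemma window_range: "0 \<le> window n s t a" "window n s t a \<le> 1"
  by (auto simp: window_def smooth_step_range mult_le_one)

lemma window_zero:
  assumes "0 < n" "a \<le> s \<or> t \<le> a" shows "window n s t a = 0"
proof -
  have "n * (a - s) \<le> 0 \<or> n * (t - a) \<le> 0"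
    using assms by (auto simp: mult_le_0_iff)
  then show ?thesis by (auto simp: window_def smooth_step_0)
qed

lemma window_one:
  assumes "0 < n" "s + 1 / n \<le> a" "a \<le> t - 1 / n" shows "window n s t a = 1"
  using assms by (simp add: window_def smooth_step_1 field_simps)

lemma deriv_smooth_step_nonneg: "0 \<le> deriv smooth_step y"
  using mono_on_imp_deriv_nonneg[of UNIV smooth_step "deriv smooth_step y" y]
  by (auto simp: mono_on_def smooth_step_mono bump_algebra_deriv(2)[OF bump_algebra_smooth_step])

text \<open>The value 1 is a global maximum, so the derivative vanishes also at
  \<open>y = 1\<close>, where the ramp ends.\<close>

lemma deriv_smooth_step_0: "1 \<le> y \<Longrightarrow> deriv smooth_step y = 0"
  using DERIV_local_max[OF bump_algebra_deriv(2)[OF bump_algebra_smooth_step], of 1 y]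
  by (auto simp: smooth_step_1 smooth_step_range)

lemma deriv_window:
  "deriv (window n s t) a = n * deriv smooth_step (n * (a - s)) * smooth_step (n * (t - a))
     - n * smooth_step (n * (a - s)) * deriv smooth_step (n * (t - a))"
proof (rule DERIV_imp_deriv)
  note d = DERIV_chain2[OF bump_algebra_deriv(2)[OF bump_algebra_smooth_step]]
  show "(window n s t has_real_derivative n * deriv smooth_step (n * (a - s)) * smooth_step (n * (t - a))
     - n * smooth_step (n * (a - s)) * deriv smooth_step (n * (t - a))) (at a)"
    unfolding window_def[abs_def]
    by (auto intro!: derivative_eq_intros d)
qed

text \<open>Serves both the ramps of the windows and the mollifier: each is an average against a
  probability density.\<close>

lemma weighted_mean_estimate:
  fixes U w :: "real \<Rightarrow> real"
  assumes "continuous_on {p..q} U" "continuous_on {p..q} w" "\<And>a. a \<in> {p..q} \<Longrightarrow> 0 \<le> w a"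
    "integral {p..q} w = 1" "\<And>a. a \<in> {p..q} \<Longrightarrow> \<bar>U a - c\<bar> \<le> e"
  shows "\<bar>integral {p..q} (\<lambda>a. U a * w a) - c\<bar> \<le> e"
proof -
  have i: "(\<lambda>a. (U a - c) * w a) integrable_on {p..q}" "w integrable_on {p..q}" "(\<lambda>a. U a * w a) integrable_on {p..q}"
    "(\<lambda>a. e * w a) integrable_on {p..q}"
    using assms(1,2) by (auto intro!: integrable_continuous_real continuous_intros)
  have "integral {p..q} (\<lambda>a. U a * w a) - c = integral {p..q} (\<lambda>a. (U a - c) * w a)"
    using i assms(4) by (simp add: left_diff_distrib integral_diff integrable_on_mult_right)
  also have "norm \<dots> \<le> integral {p..q} (\<lambda>a. e * w a)"
    using i assms(3,5) by (intro integral_norm_bound_integral) (auto simp: abs_mult intro!: mult_right_mono)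
  also have "\<dots> = e" using assms(4) by simp
  finally show ?thesis by simp
qed

text \<open>The inequality is tested with smoothed indicators of \<open>{s..t}\<close>, whose derivatives approximate the
  difference of the point masses at \<open>s\<close> and \<open>t\<close>.\<close>

lemma weak_inequality_integrates:
  fixes U G :: "real \<Rightarrow> real"
  assumes st: "s < t" and U: "continuous_on {s..t} U" and G: "G absolutely_integrable_on {s..t}"
    and hyp: "\<And>\<phi>. bump_algebra \<phi> \<Longrightarrow> (\<forall>a. 0 \<le> \<phi> a) \<Longrightarrow> (\<forall>a. a \<notin> {s..t} \<longrightarrow> \<phi> a = 0) \<Longrightarrow>
       0 \<le> integral {s..t} (\<lambda>a. U a * deriv \<phi> a + G a * \<phi> a)"
  shows "U t - U s \<le> integral {s..t} G"
proof -
  define w where "w k = window (real (Suc k)) s t" for k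
  have cw: "continuous_on S (w k)" and cw': "continuous_on S (deriv (w k))"
    and dw: "(w k has_real_derivative deriv (w k) a) (at a)" for S k a
    unfolding w_def using bump_algebra_deriv[OF bump_algebra_window] bump_algebra_deriv(4)[OF bump_algebra_deriv(1)[OF bump_algebra_window]]
    by blast+
  have intG: "(\<lambda>a. G a * w k a) absolutely_integrable_on {s..t}" for k
    using absolutely_integrable_bounded_measurable_product_real[OF _ _ _ G, of "w k"] window_range
    by (simp add: mult.commute w_def continuous_imp_measurable_on_sets_lebesgue
        bump_algebra_deriv(4)[OF bump_algebra_window] bounded_iff) (metis abs_of_nonneg)
  have intG': "(\<lambda>a. G a * w k a) integrable_on {s..t}" for k
    using intG[of k] by (rule set_lebesgue_integral_eq_integral)
  have intU: "(\<lambda>a. U a * deriv (w k) a) integrable_on {s..t}" for k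
    by (intro integrable_continuous_real continuous_intros U cw')
  have lim1: "(\<lambda>k. integral {s..t} (\<lambda>a. G a * w k a)) \<longlonglongrightarrow> integral {s..t} G"
  proof -
    \<comment> \<open>The windows tend to 1 only at interior ages, so dominated convergence is
      applied on the open interval.\<close>
    have abs: "(\<lambda>a. \<bar>G a\<bar>) integrable_on {s<..<t}"
      using G by (simp add: absolutely_integrable_on_def integrable_on_Icc_iff_Ioo)
    have "(\<lambda>k. integral {s<..<t} (\<lambda>a. G a * w k a)) \<longlonglongrightarrow> integral {s<..<t} G"
    proof (rule dominated_convergence(2)[OF _ abs])
      show "(\<lambda>a. G a * w k a) integrable_on {s<..<t}" for k
        using intG'[of k] by (simp add: integrable_on_Icc_iff_Ioo)
      show "norm (G a * w k a) \<le> \<bar>G a\<bar>" for k a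
        using window_range[of "real (Suc k)" s t a] by (simp add: abs_mult w_def mult_left_le)
      fix a assume a: "a \<in> {s<..<t}"
      have "(\<lambda>k. 1 / real (Suc k)) \<longlonglongrightarrow> 0" by (rule LIMSEQ_Suc[OF lim_1_over_n])
      then have "eventually (\<lambda>k. 1 / real (Suc k) < min (a - s) (t - a)) sequentially"
        using a by (intro order_tendstoD) auto
      then have "eventually (\<lambda>k. w k a = 1) sequentially"
        by eventually_elim (auto simp: w_def intro!: window_one)
      then show "(\<lambda>k. G a * w k a) \<longlonglongrightarrow> G a"
        by (intro tendsto_eventually) (auto elim: eventually_mono)
    qed
    then show ?thesis by (simp add: integral_open_interval_real)
  qed
  have lim2: "(\<lambda>k. integral {s..t} (\<lambda>a. U a * deriv (w k) a)) \<longlonglongrightarrow> U s - U t"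
  proof (rule LIMSEQ_I)
    fix r :: real assume r: "0 < r"
    have "uniformly_continuous_on {s..t} U" by (intro compact_uniformly_continuous U) auto
    then obtain \<delta> where \<delta>: "\<delta> > 0" "\<And>x y. x \<in> {s..t} \<Longrightarrow> y \<in> {s..t} \<Longrightarrow> \<bar>y - x\<bar> < \<delta> \<Longrightarrow> \<bar>U y - U x\<bar> < r / 3"
      unfolding uniformly_continuous_on_def dist_real_def using r by (metis zero_less_divide_iff zero_less_numeral)
    have "(\<lambda>k. 1 / real (Suc k)) \<longlonglongrightarrow> 0" by (rule LIMSEQ_Suc[OF lim_1_over_n])
    then have "eventually (\<lambda>k. 1 / real (Suc k) < min \<delta> ((t - s) / 2)) sequentially"
      using st \<delta>(1) by (intro order_tendstoD) auto
    then obtain N where N: "\<And>k. k \<ge> N \<Longrightarrow> 1 / real (Suc k) < min \<delta> ((t - s) / 2)"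
      by (auto simp: eventually_sequentially)
    show "\<exists>no. \<forall>k\<ge>no. norm (integral {s..t} (\<lambda>a. U a * deriv (w k) a) - (U s - U t)) < r"
    proof (intro exI[of _ N] allI impI)
      fix k assume k: "N \<le> k"
      define n where "n = real (Suc k)"
      define p where "p = s + 1 / n"
      define q where "q = t - 1 / n"
      have n: "n > 0" by (simp add: n_def)
      have n1: "0 < 1 / n" "1 / n < \<delta>" "1 / n < (t - s) / 2" using N[OF k] n by (auto simp: n_def)
      have spqt: "s < p" "p < q" "q < t" using n1 by (auto simp: p_def q_def)
      have d: "deriv (w k) a = n * deriv smooth_step (n * (a - s)) * smooth_step (n * (t - a))
         - n * smooth_step (n * (a - s)) * deriv smooth_step (n * (t - a))" for a
        by (simp add: w_def n_def deriv_window)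
      have np: "n * (t - a) \<ge> 1" if "a \<le> q" for a using that n by (simp add: q_def field_simps)
      have nq: "n * (a - s) \<ge> 1" if "a \<ge> p" for a using that n by (simp add: p_def field_simps)
      have d1: "0 \<le> deriv (w k) a" if "a \<le> q" for a
        using np[OF that] n by (simp add: d deriv_smooth_step_0 deriv_smooth_step_nonneg smooth_step_range)
      have d2: "0 \<le> - deriv (w k) a" if "p \<le> a" for a
        using nq[OF that] n by (simp add: d deriv_smooth_step_0 deriv_smooth_step_nonneg smooth_step_range)
      have ftc: "integral {x..y} (deriv (w k)) = w k y - w k x" if "x \<le> y" for x y
        by (intro integral_unique fundamental_theorem_of_calculus that)
          (auto simp: has_real_derivative_iff_has_vector_derivative[symmetric] intro!: DERIV_subset[OF dw])
      have v: "w k s = 0" "w k t = 0" "w k p = 1" "w k q = 1"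
      proof -
        have "w k = window n s t" by (simp only: w_def n_def)
        then show "w k s = 0" "w k t = 0" "w k p = 1" "w k q = 1"
          using n spqt by (auto simp: window_zero p_def q_def intro!: window_one)
      qed
      \<comment> \<open>On \<open>{s..p}\<close> the derivative of the window is a probability
        density, on \<open>{q..t}\<close> it is the negative of one, and in between it vanishes. The
        two averages differ little from \<open>U s\<close> and \<open>U t\<close> by uniform
        continuity.\<close>
      have "\<bar>integral {s..p} (\<lambda>a. U a * deriv (w k) a) - U s\<bar> \<le> r / 3"
      proof (rule weighted_mean_estimate)
        show "\<bar>U a - U s\<bar> \<le> r / 3" if "a \<in> {s..p}" for a
          using \<delta>(2)[of s a] that spqt n1 by (force simp: p_def)
      qed (use spqt ftc v d1 cw' continuous_on_subset[OF U] in auto)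
      moreover have "\<bar>integral {q..t} (\<lambda>a. U a * (- deriv (w k) a)) - U t\<bar> \<le> r / 3"
      proof (rule weighted_mean_estimate)
        show "\<bar>U a - U t\<bar> \<le> r / 3" if "a \<in> {q..t}" for a
          using \<delta>(2)[of t a] that spqt n1 by (force simp: q_def)
        show "continuous_on {q..t} (\<lambda>a. - deriv (w k) a)" by (intro continuous_intros cw')
        show "continuous_on {q..t} U" using spqt by (intro continuous_on_subset[OF U]) auto
        show "integral {q..t} (\<lambda>a. - deriv (w k) a) = 1" using spqt ftc v by simp
        show "0 \<le> - deriv (w k) a" if "a \<in> {q..t}" for a using that spqt by (intro d2) auto
      qed
      moreover have "integral {p..q} (\<lambda>a. U a * deriv (w k) a) = 0"
      proof -
        have "deriv (w k) a = 0" if "a \<in> {p..q}" for a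
          using d1[of a] d2[of a] that by auto
        then show ?thesis using integral_cong[of "{p..q}" "\<lambda>a. U a * deriv (w k) a" "\<lambda>_. 0"] by simp
      qed
      moreover have "integral {s..t} (\<lambda>a. U a * deriv (w k) a) =
         integral {s..p} (\<lambda>a. U a * deriv (w k) a) + (integral {p..q} (\<lambda>a. U a * deriv (w k) a)
         + integral {q..t} (\<lambda>a. U a * deriv (w k) a))"
      proof -
        have i: "(\<lambda>a. U a * deriv (w k) a) integrable_on {p..t}"
          using integrable_subinterval_real[OF intU[of k], of p t] spqt by auto
        show ?thesis
          using hk_integral_combine[OF _ _ intU[of k], of p]
            hk_integral_combine[OF _ _ i, of q] spqt by auto
      qed
      moreover have "\<bar>I - (us - ut)\<bar> < r"
        if "\<bar>I1 - us\<bar> \<le> r / 3" "\<bar>- I3 - ut\<bar> \<le> r / 3" "I2 = 0" "I = I1 + (I2 + I3)" for I I1 I2 I3 us ut :: real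
        using that r by linarith
      ultimately show "norm (integral {s..t} (\<lambda>a. U a * deriv (w k) a) - (U s - U t)) < r"
        by simp
    qed
  qed
  have "0 \<le> integral {s..t} (\<lambda>a. U a * deriv (w k) a) + integral {s..t} (\<lambda>a. G a * w k a)" for k
  proof -
    have "\<forall>a. a \<notin> {s..t} \<longrightarrow> w k a = 0"
      unfolding w_def by (intro allI impI window_zero) auto
    then have "0 \<le> integral {s..t} (\<lambda>a. U a * deriv (w k) a + G a * w k a)"
      using bump_algebra_window window_range unfolding w_def by (intro hyp) auto
    then show ?thesis
      by (subst (asm) hk_integral_add[OF intU intG'])
  qed
  then have "0 \<le> (U s - U t) + integral {s..t} G"
    by (intro LIMSEQ_le_const[OF tendsto_add[OF lim2 lim1]]) auto
  then show ?thesis by simp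
qed

section \<open>Mollification and the weak maximum principle\<close>

text \<open>The first derivative vanishes at the maximum; a positive \<open>D\<close> would make it
  positive just to the right, where \<open>f\<close> would then exceed \<open>f x0\<close>.\<close>

lemma second_derivative_nonpos_at_max:
  fixes f f' :: "real \<Rightarrow> real"
  assumes r: "0 < r" and f: "\<And>x. (f has_real_derivative f' x) (at x)"
    and f': "(f' has_real_derivative D) (at x0)"
    and max: "\<And>x. \<bar>x - x0\<bar> < r \<Longrightarrow> f x \<le> f x0"
  shows "D \<le> 0"
proof (rule ccontr)
  assume "\<not> D \<le> 0"
  then have D: "D > 0" by simp
  have z: "f' x0 = 0"
    using DERIV_local_max[OF f r] max by (auto simp: abs_minus_commute)
  obtain e where e: "e > 0" "\<And>h. 0 < h \<Longrightarrow> h < e \<Longrightarrow> f' x0 < f' (x0 + h)"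
    using DERIV_pos_inc_right[OF f' D] by auto
  define h where "h = min e r / 2"
  have h: "0 < h" "h < e" "h < r" using e(1) r by (auto simp: h_def)
  obtain \<xi> where xi: "x0 < \<xi>" "\<xi> < x0 + h" "f (x0 + h) - f x0 = (x0 + h - x0) * f' \<xi>"
    using MVT2[of x0 "x0 + h" f f'] f h(1) by auto
  have "f' \<xi> > 0" using e(2)[of "\<xi> - x0"] xi h z by auto
  then have "f (x0 + h) > f x0" using xi(3) mult_pos_pos[OF h(1), of "f' \<xi>"] by simp
  then show False using max[of "x0 + h"] h by auto
qed

text \<open>A one-sided substitute for the derivative of \<open>y * E\<close>, which may fail to
  exist when \<open>m\<close> is merely measurable: up to \<kappa>, increments just to the left of
  \<open>a\<close> are bounded as if this derivative were \<open>E a * (d * h a)\<close>.\<close>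

lemma integrating_factor_estimate:
  fixes y h m :: "real \<Rightarrow> real"
  assumes y: "continuous_on {0..b} y" and h: "continuous_on {0..b} h"
    and m: "m \<in> borel_measurable (lebesgue_on {0..b})" "\<And>r. r \<in> {0..b} \<Longrightarrow> \<bar>m r\<bar> \<le> M"
    and ineq: "\<And>s t. 0 \<le> s \<Longrightarrow> s \<le> t \<Longrightarrow> t \<le> b \<Longrightarrow>
       y t - y s \<le> integral {s..t} (\<lambda>r. d * h r - m r * y r)"
    and a: "0 < a" "a \<le> b" and \<kappa>: "0 < \<kappa>"
  defines "E \<equiv> \<lambda>t. exp (integral {0..t} m)"
  shows "\<exists>\<delta>>0. \<forall>s. 0 \<le> s \<longrightarrow> a - \<delta> < s \<longrightarrow> s \<le> a \<longrightarrow>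
     y a * E a - y s * E s \<le> (E a * (d * h a) + \<kappa>) * (a - s)"
proof -
  have LE: "lip_primitive 0 b E (\<lambda>r. m r * E r)"
    unfolding E_def by (intro lip_primitive_exp lip_primitive_integral[OF m])
  note cE = lip_primitive_continuous[OF LE]
  have fst: "continuous_on ({0..b} \<times> {0..b}) (\<lambda>p. F (fst p))" if "continuous_on {0..b} F" for F :: "real \<Rightarrow> real"
    by (rule continuous_on_compose2[OF that]) (auto intro: continuous_intros)
  have snd: "continuous_on ({0..b} \<times> {0..b}) (\<lambda>p. F (snd p))" if "continuous_on {0..b} F" for F :: "real \<Rightarrow> real"
    by (rule continuous_on_compose2[OF that]) (auto intro: continuous_intros)
  define M' where "M' = \<bar>M\<bar> + 1"
  have M': "M' > 0" "\<And>r. r \<in> {0..b} \<Longrightarrow> \<bar>m r\<bar> \<le> M'"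
    using m(2) by (auto simp: M'_def) (smt (verit) m(2) atLeastAtMost_iff)
  have aa: "(a, a) \<in> {0..b} \<times> {0..b}" using a by auto
  define g1 where "g1 p = E (fst p) * (d * h (snd p))" for p
  define g2 where "g2 p = y a * E (snd p) - E (fst p) * y (snd p)" for p
  have "continuous_on ({0..b} \<times> {0..b}) g1" "continuous_on ({0..b} \<times> {0..b}) g2"
    unfolding g1_def g2_def by (intro continuous_intros fst snd cE y h)+
  then obtain \<delta>1 \<delta>2 where
    \<delta>1: "\<delta>1 > 0" "\<And>p. p \<in> {0..b} \<times> {0..b} \<Longrightarrow> dist p (a, a) < \<delta>1 \<Longrightarrow> dist (g1 p) (g1 (a, a)) < \<kappa> / 2" and
    \<delta>2: "\<delta>2 > 0" "\<And>p. p \<in> {0..b} \<times> {0..b} \<Longrightarrow> dist p (a, a) < \<delta>2 \<Longrightarrow> dist (g2 p) (g2 (a, a)) < \<kappa> / (2 * M')"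
    using aa \<kappa> M'(1) unfolding continuous_on_iff
    by (metis divide_pos_pos mult_pos_pos zero_less_numeral)
  define \<delta> where "\<delta> = min \<delta>1 \<delta>2 / 2"
  have \<delta>: "\<delta> > 0" using \<delta>1(1) \<delta>2(1) by (simp add: \<delta>_def)
  show ?thesis
  proof (intro exI[of _ \<delta>] conjI allI impI \<delta>)
    fix s assume s: "0 \<le> s" "a - \<delta> < s" "s \<le> a"
    have i1: "(\<lambda>r. m r * y r) integrable_on {s..a}"
    proof -
      have "y absolutely_integrable_on {s..a}"
        using s a by (intro absolutely_integrable_continuous_real continuous_on_subset[OF y]) auto
      moreover have "m \<in> borel_measurable (lebesgue_on {s..a})"
        using s a by (intro measurable_restrict_mono[OF m(1)]) auto
      moreover have "bounded (m ` {s..a})"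
        using M'(2) s a by (intro boundedI[of _ M']) auto
      ultimately have "(\<lambda>r. m r * y r) absolutely_integrable_on {s..a}"
        by (intro absolutely_integrable_bounded_measurable_product_real) auto
      then show ?thesis by (rule set_lebesgue_integral_eq_integral)
    qed
    have i2: "(\<lambda>r. d * h r) integrable_on {s..a}"
      using s a by (intro integrable_continuous_real continuous_intros continuous_on_subset[OF h]) auto
    have i3: "(\<lambda>r. m r * E r) integrable_on {s..a}"
      using lip_primitive_integrable(2)[OF LE] s a by auto
    \<comment> \<open>With \<open>E\<close> frozen at \<open>s\<close> and \<open>y\<close> at
      \<open>a\<close>, the mortality terms combine to \<open>m r * (y a * E r - E s * y r)\<close>.
      The bracket is continuous and vanishes at \<open>s = r = a\<close>, and \<open>m\<close> is
      bounded, so this is below \<open>\<kappa> / 2\<close> or equal to it near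
      \<open>a\<close>.\<close>
    have "y a * E a - y s * E s = E s * (y a - y s) + y a * (E a - E s)" by (simp add: algebra_simps)
    also have "\<dots> \<le> E s * integral {s..a} (\<lambda>r. d * h r - m r * y r) + y a * integral {s..a} (\<lambda>r. m r * E r)"
    proof -
      have "E a - E s = integral {s..a} (\<lambda>r. m r * E r)"
        using lip_primitive_increment[OF LE, of s a] s a by simp
      moreover have "E s * (y a - y s) \<le> E s * integral {s..a} (\<lambda>r. d * h r - m r * y r)"
        using ineq[of s a] s a by (intro mult_left_mono) (auto simp: E_def)
      ultimately show ?thesis by simp
    qed
    also have "\<dots> = integral {s..a} (\<lambda>r. E s * (d * h r - m r * y r) + y a * (m r * E r))"
      by (subst integral_add[OF integrable_on_mult_right[OF integrable_diff[OF i2 i1]]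
            integrable_on_mult_right[OF i3]]) simp
    also have "\<dots> \<le> integral {s..a} (\<lambda>r. E a * (d * h a) + \<kappa>)"
    proof (rule integral_le)
      show "(\<lambda>r. E s * (d * h r - m r * y r) + y a * (m r * E r)) integrable_on {s..a}"
        by (rule integrable_add[OF integrable_on_mult_right[OF integrable_diff[OF i2 i1]]
            integrable_on_mult_right[OF i3]])
      fix r assume r: "r \<in> {s..a}"
      have mem: "(s, r) \<in> {0..b} \<times> {0..b}" using s r a by auto
      have "dist (s, r) (a, a) \<le> dist s a + dist r a"
        unfolding dist_prod_def using sqrt_sum_squares_le_sum[of "dist s a" "dist r a"] by simp
      also have "\<dots> < 2 * \<delta>" using r s by (auto simp: dist_real_def)
      finally have dd: "dist (s, r) (a, a) < \<delta>1" "dist (s, r) (a, a) < \<delta>2" by (auto simp: \<delta>_def)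
      have e1: "\<bar>E s * (d * h r) - E a * (d * h a)\<bar> < \<kappa> / 2"
        using \<delta>1(2)[OF mem dd(1)] by (simp add: g1_def dist_real_def)
      have "\<bar>y a * E r - E s * y r\<bar> < \<kappa> / (2 * M')"
        using \<delta>2(2)[OF mem dd(2)] by (simp add: g2_def dist_real_def mult.commute)
      then have "\<bar>m r * (y a * E r - E s * y r)\<bar> \<le> M' * (\<kappa> / (2 * M'))"
        unfolding abs_mult using M' mem by (intro mult_mono) auto
      also have "\<dots> = \<kappa> / 2" using M'(1) by simp
      finally have e2: "\<bar>m r * (y a * E r - E s * y r)\<bar> \<le> \<kappa> / 2" .
      have "E s * (d * h r - m r * y r) + y a * (m r * E r) = E s * (d * h r) + m r * (y a * E r - E s * y r)"
        by (simp add: algebra_simps)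
      then show "E s * (d * h r - m r * y r) + y a * (m r * E r) \<le> E a * (d * h a) + \<kappa>"
        using e1 e2 by linarith
    qed auto
    also have "\<dots> = (E a * (d * h a) + \<kappa>) * (a - s)" using s by simp
    finally show "y a * E a - y s * E s \<le> (E a * (d * h a) + \<kappa>) * (a - s)" .
  qed
qed

section \<open>Mollification in the space variable\<close>

definition mollifier :: "real \<Rightarrow> real \<Rightarrow> real \<Rightarrow> real" where
  "mollifier \<epsilon> x y = bump ((y - x) / \<epsilon>) / integral {-\<epsilon>..\<epsilon>} (\<lambda>z. bump (z / \<epsilon>))"

lemma continuous_on_bump: "continuous_on S bump" "continuous_on S (deriv bump)"
  "continuous_on S (deriv (deriv bump))"
  by (intro bump_algebra_deriv(4) bump_algebra_deriv(1) bump_algebra_bump)+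

lemma continuous_on_bump_compose [continuous_intros]:
  assumes "continuous_on S g"
  shows "continuous_on S (\<lambda>x. bump (g x))" "continuous_on S (\<lambda>x. deriv bump (g x))"
    "continuous_on S (\<lambda>x. deriv (deriv bump) (g x))"
  by (rule continuous_on_compose2[OF _ assms, of UNIV]; simp add: continuous_on_bump)+

lemmas DERIV_bump = bump_algebra_deriv(2)[OF bump_algebra_bump]
  and DERIV_deriv_bump = bump_algebra_deriv(2)[OF bump_algebra_deriv(1)[OF bump_algebra_bump]]

declare DERIV_bump[THEN DERIV_chain2, derivative_intros]
  DERIV_deriv_bump[THEN DERIV_chain2, derivative_intros]

lemma mollifier_mass_pos: "0 < \<epsilon> \<Longrightarrow> 0 < integral {-\<epsilon>..\<epsilon>} (\<lambda>z. bump (z / \<epsilon>))"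
proof -
  assume e: "0 < \<epsilon>"
  have c: "continuous_on {-\<epsilon>..\<epsilon>} (\<lambda>z. bump (z / \<epsilon>))"
    using e by (intro continuous_intros) auto
  have "0 \<le> integral {-\<epsilon>..\<epsilon>} (\<lambda>z. bump (z / \<epsilon>))"
    by (intro Henstock_Kurzweil_Integration.integral_nonneg integrable_continuous_real c) (auto simp: bump_nonneg)
  moreover have "integral {-\<epsilon>..\<epsilon>} (\<lambda>z. bump (z / \<epsilon>)) \<noteq> 0"
  proof
    assume "integral {-\<epsilon>..\<epsilon>} (\<lambda>z. bump (z / \<epsilon>)) = 0"
    then have "\<forall>z\<in>{-\<epsilon>..\<epsilon>}. bump (z / \<epsilon>) = 0"
      using integral_eq_0_iff[OF c] e bump_nonneg by auto
    then have "bump 0 = 0" using e by (auto dest: bspec[of _ _ 0])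
    then show False using bump_pos_iff[of 0] by simp
  qed
  ultimately show ?thesis by simp
qed

lemma mollifier_nonneg: "0 < \<epsilon> \<Longrightarrow> 0 \<le> mollifier \<epsilon> x y"
  using mollifier_mass_pos[of \<epsilon>] by (simp add: mollifier_def bump_nonneg)

lemma mollifier_zero: "0 < \<epsilon> \<Longrightarrow> \<epsilon> \<le> \<bar>y - x\<bar> \<Longrightarrow> mollifier \<epsilon> x y = 0"
  by (simp add: mollifier_def bump_zero)

lemma bump_algebra_mollifier: "bump_algebra (mollifier \<epsilon> x)"
proof -
  have "bump_algebra (\<lambda>y. bump (- x / \<epsilon> + (1 / \<epsilon>) \<bullet> y))"
    by (rule bump_algebra_compose_inner[OF bump_algebra_bump])
  from bump_mult[OF this bump_const[of "1 / integral {-\<epsilon>..\<epsilon>} (\<lambda>z. bump (z / \<epsilon>))"]]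
  show ?thesis by (simp add: mollifier_def[abs_def] diff_divide_distrib)
qed

lemma mollifier_integral:
  assumes "0 < \<epsilon>" shows "integral {x - \<epsilon>..x + \<epsilon>} (mollifier \<epsilon> x) = 1"
proof -
  have "integral {-\<epsilon>..\<epsilon>} (\<lambda>z. bump (z / \<epsilon>)) =
     integral {-\<epsilon> + x..\<epsilon> + x} (\<lambda>y. bump ((y - x) / \<epsilon>))"
    using assms integral_shift[of "-\<epsilon>" x \<epsilon> "\<lambda>y. bump ((y - x) / \<epsilon>)"]
    by (force simp: o_def intro!: continuous_intros)
  then show ?thesis
    using mollifier_mass_pos[OF assms] by (simp add: mollifier_def[abs_def] add.commute)
qed

lemma mollifier_y_derivative:
  assumes "0 < \<epsilon>"
  shows "deriv (deriv (mollifier \<epsilon> x)) y =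
    deriv (deriv bump) ((y - x) / \<epsilon>) / \<epsilon>\<^sup>2 / integral {-\<epsilon>..\<epsilon>} (\<lambda>z. bump (z / \<epsilon>))"
proof -
  define k where "k = integral {-\<epsilon>..\<epsilon>} (\<lambda>z. bump (z / \<epsilon>))"
  have k: "k \<noteq> 0" using mollifier_mass_pos[OF assms] by (simp add: k_def)
  have "deriv (mollifier \<epsilon> x) = (\<lambda>y. deriv bump ((y - x) / \<epsilon>) * (1 / \<epsilon>) / k)"
    unfolding mollifier_def[abs_def] k_def[symmetric] using k assms
    by (intro ext DERIV_imp_deriv) (auto intro!: derivative_eq_intros simp: field_simps)
  moreover have "((\<lambda>y. deriv bump ((y - x) / \<epsilon>) * (1 / \<epsilon>) / k) has_real_derivative
     deriv (deriv bump) ((y - x) / \<epsilon>) / \<epsilon>\<^sup>2 / k) (at y)"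
    using k assms by (auto intro!: derivative_eq_intros simp: field_simps power2_eq_square)
  ultimately show ?thesis by (simp add: DERIV_imp_deriv k_def)
qed

lemma mollify_close:
  fixes w :: "real \<Rightarrow> real"
  assumes e: "0 < \<epsilon>" and w: "continuous_on {\<alpha>..\<beta>} w" and x: "x \<in> {\<alpha> + \<epsilon>..\<beta> - \<epsilon>}"
    and osc: "\<And>y. \<bar>y - x\<bar> \<le> \<epsilon> \<Longrightarrow> \<bar>w y - w x\<bar> \<le> \<eta>"
  shows "\<bar>integral {\<alpha>..\<beta>} (\<lambda>y. w y * mollifier \<epsilon> x y) - w x\<bar> \<le> \<eta>"
proof -
  have cm: "continuous_on S (mollifier \<epsilon> x)" for S
    by (rule bump_algebra_deriv(4)[OF bump_algebra_mollifier])
  have w': "continuous_on {x - \<epsilon>..x + \<epsilon>} w"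
    using x by (intro continuous_on_subset[OF w]) auto
  have "((\<lambda>y. w y * mollifier \<epsilon> x y) has_integral integral {x - \<epsilon>..x + \<epsilon>} (\<lambda>y. w y * mollifier \<epsilon> x y)) {x - \<epsilon>..x + \<epsilon>}"
    by (intro integrable_integral integrable_continuous_real continuous_intros w' cm)
  then have "((\<lambda>y. w y * mollifier \<epsilon> x y) has_integral integral {x - \<epsilon>..x + \<epsilon>} (\<lambda>y. w y * mollifier \<epsilon> x y)) {\<alpha>..\<beta>}"
    using x e by (rule_tac has_integral_on_superset) (auto simp: mollifier_zero abs_if)
  then have "integral {\<alpha>..\<beta>} (\<lambda>y. w y * mollifier \<epsilon> x y) = integral {x - \<epsilon>..x + \<epsilon>} (\<lambda>y. w y * mollifier \<epsilon> x y)"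
    by (rule integral_unique)
  also have "\<bar>\<dots> - w x\<bar> \<le> \<eta>"
    by (rule weighted_mean_estimate[OF w' cm])
      (auto simp: mollifier_nonneg e mollifier_integral intro!: osc)
  finally show ?thesis .
qed

text \<open>The kernel depends on \<open>y - x\<close> only, so its second derivative in
  \<open>x\<close> is its second derivative in \<open>y\<close>. This is the very term produced when
  the kernel is used as test function in \<open>heat_subsolution\<close>.\<close>

lemma mollify_x_derivatives:
  fixes w :: "real \<Rightarrow> real"
  assumes w: "continuous_on {\<alpha>..\<beta>} w" and e: "0 < \<epsilon>"
  obtains g where "\<And>x. ((\<lambda>x. integral {\<alpha>..\<beta>} (\<lambda>y. w y * mollifier \<epsilon> x y)) has_real_derivative g x) (at x)"
    "\<And>x. (g has_real_derivative integral {\<alpha>..\<beta>} (\<lambda>y. w y * deriv (deriv (mollifier \<epsilon> x)) y)) (at x)"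
proof -
  define k where "k = integral {-\<epsilon>..\<epsilon>} (\<lambda>z. bump (z / \<epsilon>))"
  have k: "k \<noteq> 0" using mollifier_mass_pos[OF e] by (simp add: k_def)
  have cw: "continuous_on (UNIV \<times> {\<alpha>..\<beta>}) (\<lambda>p::real \<times> real. w (snd p))"
    by (rule continuous_on_compose2[OF w]) (auto intro: continuous_intros)
  let ?g = "\<lambda>x. integral {\<alpha>..\<beta>} (\<lambda>y. w y * (- deriv bump ((y - x) / \<epsilon>) / \<epsilon> / k))"
  have "((\<lambda>x. integral (cbox \<alpha> \<beta>) (\<lambda>y. w y * mollifier \<epsilon> x y)) has_real_derivative
     integral (cbox \<alpha> \<beta>) (\<lambda>y. w y * (- deriv bump ((y - x) / \<epsilon>) / \<epsilon> / k))) (at x within UNIV)" for x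
  proof (rule leibniz_rule_field_derivative)
    show "((\<lambda>x. w y * mollifier \<epsilon> x y) has_real_derivative w y * (- deriv bump ((y - x) / \<epsilon>) / \<epsilon> / k)) (at x within UNIV)" for x y
      unfolding mollifier_def k_def[symmetric] using k e
      by (auto intro!: derivative_eq_intros simp: field_simps)
    show "(\<lambda>y. w y * mollifier \<epsilon> x y) integrable_on cbox \<alpha> \<beta>" for x
      using w by (intro integrable_continuous continuous_intros bump_algebra_deriv(4)[OF bump_algebra_mollifier]) simp
    show "continuous_on (UNIV \<times> cbox \<alpha> \<beta>) (\<lambda>(x, y). w y * (- deriv bump ((y - x) / \<epsilon>) / \<epsilon> / k))"
      unfolding split_beta using e k cw by (intro continuous_intros) auto
  qed auto
  moreover have "((\<lambda>x. integral (cbox \<alpha> \<beta>) (\<lambda>y. w y * (- deriv bump ((y - x) / \<epsilon>) / \<epsilon> / k))) has_real_derivative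
     integral (cbox \<alpha> \<beta>) (\<lambda>y. w y * deriv (deriv (mollifier \<epsilon> x)) y)) (at x within UNIV)" for x
  proof (rule leibniz_rule_field_derivative)
    show "((\<lambda>x. w y * (- deriv bump ((y - x) / \<epsilon>) / \<epsilon> / k)) has_real_derivative w y * deriv (deriv (mollifier \<epsilon> x)) y) (at x within UNIV)" for x y
      unfolding mollifier_y_derivative[OF e] k_def[symmetric] using k e
      by (auto intro!: derivative_eq_intros simp: field_simps power2_eq_square)
    show "(\<lambda>y. w y * (- deriv bump ((y - x) / \<epsilon>) / \<epsilon> / k)) integrable_on cbox \<alpha> \<beta>" for x
      using e k w by (intro integrable_continuous continuous_intros) auto
    show "continuous_on (UNIV \<times> cbox \<alpha> \<beta>) (\<lambda>(x, y). w y * deriv (deriv (mollifier \<epsilon> x)) y)"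
      unfolding split_beta mollifier_y_derivative[OF e] k_def[symmetric]
      using e k cw by (intro continuous_intros) auto
  qed auto
  ultimately show ?thesis by (intro that[of ?g]) auto
qed

text \<open>The inequality \<open>w_a \<le> d w_xx - m w\<close> on a box, with both space
  derivatives moved to the test function and the age derivative replaced by increments. The
  mortality \<open>m\<close> depends on age alone, so that an integrating factor can remove
  it.\<close>

definition heat_subsolution ::
  "real \<Rightarrow> (real \<Rightarrow> real) \<Rightarrow> real \<Rightarrow> real \<Rightarrow> real \<Rightarrow> (real \<Rightarrow> real \<Rightarrow> real) \<Rightarrow> bool" where
  "heat_subsolution d m b \<alpha> \<beta> w \<longleftrightarrow>
     continuous_on ({0..b} \<times> {\<alpha>..\<beta>}) (case_prod w) \<and>
     (\<forall>\<psi>. bump_algebra \<psi> \<longrightarrow> (\<forall>y. 0 \<le> \<psi> y) \<longrightarrow> (\<forall>y. y \<notin> {\<alpha>..\<beta>} \<longrightarrow> \<psi> y = 0) \<longrightarrow>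
        (\<forall>s t. 0 \<le> s \<longrightarrow> s \<le> t \<longrightarrow> t \<le> b \<longrightarrow>
           integral {\<alpha>..\<beta>} (\<lambda>y. w t y * \<psi> y) - integral {\<alpha>..\<beta>} (\<lambda>y. w s y * \<psi> y) \<le>
           integral {s..t} (\<lambda>a. d * integral {\<alpha>..\<beta>} (\<lambda>y. w a y * deriv (deriv \<psi>) y)
             - m a * integral {\<alpha>..\<beta>} (\<lambda>y. w a y * \<psi> y))))"

lemma continuous_on_slice:
  assumes "continuous_on (A \<times> B) (case_prod w)" "a \<in> A"
  shows "continuous_on B (w a)"
proof -
  have "continuous_on B (\<lambda>y. (a, y))" by (intro continuous_intros)
  from continuous_on_compose2[OF assms(1) this] show ?thesis using assms(2) by auto
qed

lemma continuous_on_slice2: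
  assumes "continuous_on (A \<times> B) (case_prod w)" "y \<in> B"
  shows "continuous_on A (\<lambda>a. w a y)"
proof -
  have "continuous_on A (\<lambda>a. (a, y))" by (intro continuous_intros)
  from continuous_on_compose2[OF assms(1) this] show ?thesis using assms(2) by auto
qed

lemma continuous_on_weighted_integral:
  fixes w :: "real \<Rightarrow> real \<Rightarrow> real"
  assumes "continuous_on (A \<times> {\<alpha>..\<beta>}) (case_prod w)" "continuous_on {\<alpha>..\<beta>} \<psi>"
  shows "continuous_on A (\<lambda>a. integral {\<alpha>..\<beta>} (\<lambda>y. w a y * \<psi> y))"
proof -
  have "continuous_on (A \<times> {\<alpha>..\<beta>}) (\<lambda>p. \<psi> (snd p))"
    by (rule continuous_on_compose2[OF assms(2)]) (auto intro: continuous_intros)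
  then have "continuous_on (A \<times> cbox \<alpha> \<beta>) (\<lambda>(a, y). w a y * \<psi> y)"
    using assms(1) unfolding split_beta by (intro continuous_on_mult) auto
  from integral_continuous_on_param[OF this] show ?thesis by simp
qed

lemma box_modulus:
  fixes v :: "real \<Rightarrow> real \<Rightarrow> real"
  assumes "continuous_on (A \<times> B) (case_prod v)" "compact (A \<times> B)" "0 < e"
  obtains \<delta> where "\<delta> > 0"
    "\<And>a x y. a \<in> A \<Longrightarrow> x \<in> B \<Longrightarrow> y \<in> B \<Longrightarrow> \<bar>y - x\<bar> < \<delta> \<Longrightarrow> \<bar>v a y - v a x\<bar> < e"
proof -
  from compact_uniformly_continuous[OF assms(1,2)] assms(3) obtain \<delta> where \<delta>: "\<delta> > 0"
    "\<forall>p\<in>A \<times> B. \<forall>q\<in>A \<times> B. dist q p < \<delta> \<longrightarrow> dist (case_prod v q) (case_prod v p) < e"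
    unfolding uniformly_continuous_on_def by blast
  show ?thesis
  proof (rule that[OF \<delta>(1)])
    fix a x y assume "a \<in> A" "x \<in> B" "y \<in> B" "\<bar>y - x\<bar> < \<delta>"
    then show "\<bar>v a y - v a x\<bar> < e"
      using bspec[OF bspec[OF \<delta>(2), of "(a, x)"], of "(a, y)"]
      by (simp add: dist_Pair_Pair dist_real_def)
  qed
qed

text \<open>Mollifying in space only, a weak subsolution becomes $C^2$ in
  space and satisfies an integrated differential inequality in age, which suffices to exclude
  an interior maximum.\<close>

lemma heat_maximum_principle:
  fixes w W :: "real \<Rightarrow> real \<Rightarrow> real"
  assumes sub: "heat_subsolution d m b \<alpha> \<beta> w" and d: "0 < d"
    and m: "m \<in> borel_measurable (lebesgue_on {0..b})" "\<And>r. r \<in> {0..b} \<Longrightarrow> \<bar>m r\<bar> \<le> M"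
    and cW: "continuous_on ({0..b} \<times> {\<alpha>..\<beta>}) (case_prod W)"
    and Wx: "\<And>a x. (W a has_real_derivative Wx a x) (at x)"
    and Wxx: "\<And>a x. (Wx a has_real_derivative Wxx a x) (at x)"
    and Wa: "\<And>a x. ((\<lambda>a. W a x) has_real_derivative Wa a x) (at a)"
    and super: "\<And>a x. a \<in> {0..b} \<Longrightarrow> x \<in> {\<alpha>..\<beta>} \<Longrightarrow> d * Wxx a x \<le> Wa a x"
    and init: "\<And>x. x \<in> {\<alpha>..\<beta>} \<Longrightarrow> w 0 x \<le> W 0 x"
    and left: "\<And>a. a \<in> {0..b} \<Longrightarrow> w a \<alpha> * exp (integral {0..a} m) \<le> W a \<alpha>"
    and right: "\<And>a. a \<in> {0..b} \<Longrightarrow> w a \<beta> * exp (integral {0..a} m) \<le> W a \<beta>"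
    and a1: "a1 \<in> {0..b}" and x1: "x1 \<in> {\<alpha>..\<beta>}"
  shows "w a1 x1 * exp (integral {0..a1} m) \<le> W a1 x1"
proof (rule ccontr)
  assume neg: "\<not> ?thesis"
  define E where "E t = exp (integral {0..t} m)" for t
  have LE: "lip_primitive 0 b E (\<lambda>r. m r * E r)"
    unfolding E_def by (intro lip_primitive_exp lip_primitive_integral[OF m])
  note cE = lip_primitive_continuous[OF LE]
  have cw: "continuous_on ({0..b} \<times> {\<alpha>..\<beta>}) (case_prod w)"
    using sub by (simp add: heat_subsolution_def)
  have Epos: "E t > 0" for t by (simp add: E_def)
  have E0: "E 0 = 1" by (simp add: E_def)
  obtain P where P: "P > 0" "\<And>r. r \<in> {0..b} \<Longrightarrow> E r \<le> P"
    using continuous_on_Icc_abs_bound[OF cE] by (metis abs_le_D1)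
  define v where "v a x = w a x * E a - W a x" for a x
  have cEp: "continuous_on ({0..b} \<times> S) (\<lambda>p. E (fst p))" for S :: "real set"
    by (rule continuous_on_compose2[OF cE]) (auto intro: continuous_intros)
  have cv: "continuous_on ({0..b} \<times> {\<alpha>..\<beta>}) (case_prod v)"
    using cw cW cEp unfolding v_def split_beta by (intro continuous_intros) auto
  have v0: "v 0 x \<le> 0" "v a \<alpha> \<le> 0" "v a \<beta> \<le> 0" if "x \<in> {\<alpha>..\<beta>}" "a \<in> {0..b}" for a x
    using init[OF that(1)] left[OF that(2)] right[OF that(2)] by (auto simp: v_def E0 E_def)
  define c where "c = v a1 x1"
  have c: "c > 0" using neg by (simp add: c_def v_def E_def)
  have x1': "\<alpha> < x1" "x1 < \<beta>" using c v0[OF x1 a1] x1 by (auto simp: c_def less_le)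
  have b: "0 \<le> b" using a1 by auto
  \<comment> \<open>Subtracting \<open>\<kappa> * a\<close> makes the differential inequality
    strict; up to age \<open>b\<close> this costs less than a quarter of the supposed violation
    \<open>c\<close>.\<close>
  define \<kappa> where "\<kappa> = c / (4 * (b + 1))"
  have \<kappa>: "\<kappa> > 0" "\<kappa> * b < c / 4" using c b by (auto simp: \<kappa>_def field_simps)
  have comp: "compact ({0..b} \<times> {\<alpha>..\<beta>})" by (intro compact_Times) auto
  obtain \<delta>v where \<delta>v: "\<delta>v > 0"
    "\<And>a x y. a \<in> {0..b} \<Longrightarrow> x \<in> {\<alpha>..\<beta>} \<Longrightarrow> y \<in> {\<alpha>..\<beta>} \<Longrightarrow> \<bar>y - x\<bar> < \<delta>v \<Longrightarrow> \<bar>v a y - v a x\<bar> < c / 4"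
    using box_modulus[OF cv comp, of "c / 4"] c by auto
  obtain \<delta>w where \<delta>w: "\<delta>w > 0"
    "\<And>a x y. a \<in> {0..b} \<Longrightarrow> x \<in> {\<alpha>..\<beta>} \<Longrightarrow> y \<in> {\<alpha>..\<beta>} \<Longrightarrow> \<bar>y - x\<bar> < \<delta>w \<Longrightarrow> \<bar>w a y - w a x\<bar> < c / (4 * P)"
    using box_modulus[OF cw comp, of "c / (4 * P)"] c P(1) by auto
  \<comment> \<open>Mollifying at this scale changes \<open>w * E\<close> by at most
    \<open>c / 4\<close>. On distance \<epsilon> also \<open>v\<close> varies by less than
    \<open>c / 4\<close>, which will keep the maximum off the sides of the shrunken box, and
    \<open>x1\<close> stays inside that box.\<close>
  define \<epsilon> where "\<epsilon> = min (min \<delta>v \<delta>w) (min (x1 - \<alpha>) (\<beta> - x1)) / 2"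
  have \<epsilon>: "\<epsilon> > 0" "\<epsilon> < \<delta>v" "\<epsilon> < \<delta>w" "\<alpha> + \<epsilon> < x1" "x1 < \<beta> - \<epsilon>"
    using \<delta>v(1) \<delta>w(1) x1' by (auto simp: \<epsilon>_def min_def field_simps)
  define y where "y a x = integral {\<alpha>..\<beta>} (\<lambda>z. w a z * mollifier \<epsilon> x z)" for a x
  define h where "h a x = integral {\<alpha>..\<beta>} (\<lambda>z. w a z * deriv (deriv (mollifier \<epsilon> x)) z)" for a x
  have close: "\<bar>y a x - w a x\<bar> \<le> c / (4 * P)" if "a \<in> {0..b}" "x \<in> {\<alpha> + \<epsilon>..\<beta> - \<epsilon>}" for a x
    unfolding y_def
  proof (rule mollify_close[OF \<epsilon>(1) continuous_on_slice[OF cw that(1)] that(2)])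
    show "\<bar>w a z - w a x\<bar> \<le> c / (4 * P)" if "\<bar>z - x\<bar> \<le> \<epsilon>" for z
      using \<delta>w(2)[of a x z] that \<epsilon> \<open>a \<in> {0..b}\<close> \<open>x \<in> {\<alpha> + \<epsilon>..\<beta> - \<epsilon>}\<close>
      by (intro less_imp_le) (auto simp: abs_le_iff)
  qed
  define V where "V a x = y a x * E a - W a x - \<kappa> * a" for a x
  have Vclose: "\<bar>y a x * E a - W a x - v a x\<bar> \<le> c / 4" if "a \<in> {0..b}" "x \<in> {\<alpha> + \<epsilon>..\<beta> - \<epsilon>}" for a x
  proof -
    have "\<bar>y a x * E a - W a x - v a x\<bar> = \<bar>y a x - w a x\<bar> * E a"
      using Epos[of a] by (simp add: v_def abs_mult flip: left_diff_distrib)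
    also have "\<dots> \<le> c / (4 * P) * P"
      using close[OF that] P(2)[OF that(1)] Epos[of a] c P(1) by (intro mult_mono) auto
    also have "\<dots> = c / 4" using P(1) by simp
    finally show ?thesis .
  qed
  define B where "B = {0..b} \<times> {\<alpha> + \<epsilon>..\<beta> - \<epsilon>}"
  have cy: "continuous_on B (case_prod y)"
  proof -
    have "continuous_on (B \<times> {\<alpha>..\<beta>}) (\<lambda>q. case_prod w (fst (fst q), snd q))"
      by (rule continuous_on_compose2[OF cw]) (auto simp: B_def intro!: continuous_intros)
    moreover have "continuous_on (B \<times> {\<alpha>..\<beta>}) (\<lambda>q. mollifier \<epsilon> (snd (fst q)) (snd q))"
      unfolding mollifier_def using \<epsilon>(1) mollifier_mass_pos[OF \<epsilon>(1)] by (intro continuous_intros) auto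
    ultimately have "continuous_on (B \<times> cbox \<alpha> \<beta>) (\<lambda>(p, z). w (fst p) z * mollifier \<epsilon> (snd p) z)"
      unfolding split_beta by (auto intro: continuous_on_mult)
    from integral_continuous_on_param[OF this] show ?thesis
      by (simp add: y_def split_beta)
  qed
  have cV: "continuous_on B (case_prod V)"
  proof -
    have "continuous_on B (case_prod W)"
      using \<epsilon> by (intro continuous_on_subset[OF cW]) (auto simp: B_def)
    then show ?thesis
      using cy cEp[of "{\<alpha> + \<epsilon>..\<beta> - \<epsilon>}"] unfolding V_def split_beta B_def by (intro continuous_intros) auto
  qed
  have "compact B" "B \<noteq> {}" using b \<epsilon> by (auto simp: B_def intro!: compact_Times)
  from continuous_attains_sup[OF this cV] obtain a x where
    ax: "a \<in> {0..b}" "x \<in> {\<alpha> + \<epsilon>..\<beta> - \<epsilon>}" and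
    max: "\<And>s z. s \<in> {0..b} \<Longrightarrow> z \<in> {\<alpha> + \<epsilon>..\<beta> - \<epsilon>} \<Longrightarrow> V s z \<le> V a x"
    by (auto simp: B_def)
  have "c - c / 4 - \<kappa> * b \<le> V a1 x1"
  proof -
    have "\<kappa> * a1 \<le> \<kappa> * b" using \<kappa>(1) a1 by (intro mult_left_mono) auto
    moreover have "\<bar>y a1 x1 * E a1 - W a1 x1 - c\<bar> \<le> c / 4"
      using Vclose[OF a1, of x1] \<epsilon> unfolding c_def by auto
    ultimately show ?thesis unfolding V_def by linarith
  qed
  also have "V a1 x1 \<le> V a x" using \<epsilon> a1 by (intro max) auto
  finally have big: "c / 2 < V a x" using \<kappa>(2) by simp
  have "\<kappa> * a \<ge> 0" using \<kappa>(1) ax by auto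
  then have vbig: "c / 4 < v a x" using Vclose[OF ax] big unfolding V_def by linarith
  have apos: "0 < a" using vbig v0(1)[of x 0] ax \<epsilon>(1) b c by (cases "a = 0") auto
  \<comment> \<open>On the sides of the shrunken box \<open>v\<close> is within \<open>c / 4\<close>
    of its nonpositive values on the true sides, whereas at the maximum it exceeds
    \<open>c / 4\<close>.\<close>
  have xint: "\<alpha> + \<epsilon> < x" "x < \<beta> - \<epsilon>"
  proof -
    have "x \<noteq> \<alpha> + \<epsilon>"
    proof
      assume "x = \<alpha> + \<epsilon>"
      then have "\<bar>v a x - v a \<alpha>\<bar> < c / 4" using \<epsilon> ax x1' by (intro \<delta>v(2)) auto
      then show False using vbig v0(2)[OF x1 ax(1)] by linarith
    qed
    moreover have "x \<noteq> \<beta> - \<epsilon>"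
    proof
      assume "x = \<beta> - \<epsilon>"
      then have "\<bar>v a x - v a \<beta>\<bar> < c / 4" using \<epsilon> ax x1' by (intro \<delta>v(2)) auto
      then show False using vbig v0(3)[OF x1 ax(1)] by linarith
    qed
    ultimately show "\<alpha> + \<epsilon> < x" "x < \<beta> - \<epsilon>" using ax(2) by auto
  qed
  have space: "E a * h a x - Wxx a x \<le> 0"
  proof -
    obtain g where g: "\<And>x. (y a has_real_derivative g x) (at x)"
      "\<And>x. (g has_real_derivative h a x) (at x)"
      using mollify_x_derivatives[OF continuous_on_slice[OF cw ax(1)] \<epsilon>(1)] unfolding y_def[abs_def] h_def by blast
    show ?thesis
    proof (rule second_derivative_nonpos_at_max[where f="V a" and f'="\<lambda>x. g x * E a - Wx a x" and ?x0.0=x])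
      show "0 < min (x - (\<alpha> + \<epsilon>)) (\<beta> - \<epsilon> - x)" using xint by simp
      show "(V a has_real_derivative g z * E a - Wx a z) (at z)" for z
        unfolding V_def[abs_def] by (auto intro!: derivative_eq_intros g Wx)
      show "((\<lambda>x. g x * E a - Wx a x) has_real_derivative E a * h a x - Wxx a x) (at x)"
        by (auto intro!: derivative_eq_intros g Wxx)
      show "V a z \<le> V a x" if "\<bar>z - x\<bar> < min (x - (\<alpha> + \<epsilon>)) (\<beta> - \<epsilon> - x)" for z
        using that ax(1) by (intro max) (auto simp: abs_less_iff)
    qed
  qed
  have cya: "continuous_on {0..b} (\<lambda>a. y a x)" and cha: "continuous_on {0..b} (\<lambda>a. h a x)"
    unfolding y_def h_def
    by (intro continuous_on_weighted_integral[OF cw] bump_algebra_deriv(4) bump_algebra_deriv(1) bump_algebra_mollifier)+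
  \<comment> \<open>Since \<open>x\<close> keeps distance \<epsilon> from the sides, the mollifier
    centred at \<open>x\<close> is supported in the box and may be used as test function.\<close>
  have ineq: "y t x - y s x \<le> integral {s..t} (\<lambda>r. d * h r x - m r * y r x)" if "0 \<le> s" "s \<le> t" "t \<le> b" for s t
  proof -
    have "\<forall>z. z \<notin> {\<alpha>..\<beta>} \<longrightarrow> mollifier \<epsilon> x z = 0"
      using ax(2) by (auto intro!: mollifier_zero \<epsilon>(1))
    then show ?thesis
      using sub that bump_algebra_mollifier[of \<epsilon> x] mollifier_nonneg[OF \<epsilon>(1)]
      unfolding heat_subsolution_def y_def h_def by blast
  qed
  \<comment> \<open>At the maximum, going back in age to a nearby \<open>s\<close> cannot increase
    \<open>V\<close>. Two thirds of the tilt \<kappa> pay for replacing increments of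
    \<open>y * E\<close> and of \<open>W\<close> by derivatives, and the last third gives the
    contradiction.\<close>
  obtain \<delta>1 where \<delta>1: "\<delta>1 > 0" "\<And>s. 0 \<le> s \<Longrightarrow> a - \<delta>1 < s \<Longrightarrow> s \<le> a \<Longrightarrow>
     y a x * E a - y s x * E s \<le> (E a * (d * h a x) + \<kappa> / 3) * (a - s)"
    using integrating_factor_estimate[OF cya cha m ineq apos _ , of "\<kappa> / 3"] ax(1) \<kappa>(1)
    by (auto simp: E_def)
  obtain \<delta>2 where \<delta>2: "\<delta>2 > 0" "\<And>s. s \<noteq> a \<Longrightarrow> \<bar>s - a\<bar> < \<delta>2 \<Longrightarrow>
     \<bar>(W s x - W a x) / (s - a) - Wa a x\<bar> < \<kappa> / 3"
  proof -
    have "((\<lambda>s. (W s x - W a x) / (s - a)) \<longlongrightarrow> Wa a x) (at a)"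
      using Wa[of x a] by (simp add: has_field_derivative_iff)
    then have "eventually (\<lambda>s. dist ((W s x - W a x) / (s - a)) (Wa a x) < \<kappa> / 3) (at a)"
      using \<kappa>(1) by (intro tendstoD) auto
    then show ?thesis using that by (auto simp: eventually_at dist_real_def)
  qed
  define s where "s = max 0 (a - min \<delta>1 \<delta>2 / 2)"
  have s: "0 \<le> s" "a - \<delta>1 < s" "s < a" "\<bar>s - a\<bar> < \<delta>2" "s \<in> {0..b}"
    using apos \<delta>1(1) \<delta>2(1) ax(1) by (auto simp: s_def max_def min_def)
  have "\<bar>(W s x - W a x) / (s - a) - Wa a x\<bar> < \<kappa> / 3" using s by (intro \<delta>2(2)) auto
  then have "(W s x - W a x) / (s - a) - Wa a x > - \<kappa> / 3" by linarith
  then have "(W a x - W s x) / (a - s) > Wa a x - \<kappa> / 3"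
    using minus_divide_divide[of "W a x - W s x" "a - s"] by simp
  then have t2: "W a x - W s x \<ge> (Wa a x - \<kappa> / 3) * (a - s)"
    using s(3) by (simp add: pos_less_divide_eq)
  have t1: "y a x * E a - y s x * E s \<le> (E a * (d * h a x) + \<kappa> / 3) * (a - s)"
    using \<delta>1(2)[of s] s by auto
  have "0 \<le> V a x - V s x" using max[OF s(5) ax(2)] by simp
  also have "\<dots> = (y a x * E a - y s x * E s) - (W a x - W s x) - \<kappa> * (a - s)"
    by (simp add: V_def algebra_simps)
  also have "\<dots> \<le> (E a * (d * h a x) + \<kappa> / 3) * (a - s) - (Wa a x - \<kappa> / 3) * (a - s) - \<kappa> * (a - s)"
    using t1 t2 by simp
  also have "\<dots> = (d * (E a * h a x) - Wa a x - \<kappa> / 3) * (a - s)" by (simp add: field_simps)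
  also have "\<dots> < 0"
  proof -
    have "d * (E a * h a x) \<le> d * Wxx a x" using space d by (intro mult_left_mono) auto
    also have "\<dots> \<le> Wa a x" using ax \<epsilon>(1) by (intro super) auto
    finally show ?thesis using s(3) \<kappa>(1) by (intro mult_neg_pos) auto
  qed
  finally show False by simp
qed

section \<open>From weak derivatives to integrated inequalities\<close>

text \<open>A Lebesgue null set is covered by a Borel null set, to which Fubini applies in either
  order.\<close>

lemma AE_lebesgue_sections:
  fixes P :: "real \<times> real \<Rightarrow> bool"
  assumes "AE p in lebesgue. P p"
  shows "AE y in lebesgue. AE a in lebesgue. P (a, y)"
proof -
  have "AE p in lborel. P p" using assms by (simp add: AE_completion_iff)
  then obtain N where N: "N \<in> null_sets lborel" "{p \<in> space lborel. \<not> P p} \<subseteq> N"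
    unfolding eventually_ae_filter by auto
  have Nb: "N \<in> sets borel" using N(1) by (auto simp: null_sets_def)
  have "AE p in lborel. p \<notin> N" using N(1) by (rule AE_not_in)
  then have ae: "AE p in lborel \<Otimes>\<^sub>M lborel. (fst p, snd p) \<notin> N"
    unfolding lborel_prod prod.collapse .
  have set: "{x \<in> space (lborel \<Otimes>\<^sub>M lborel). (fst x, snd x) \<notin> N} \<in> sets (lborel \<Otimes>\<^sub>M (lborel :: real measure))"
    unfolding lborel_prod using Nb by (simp add: Collect_neg_eq Compl_in_sets_lebesgue)
  have "AE a in lborel. AE y in lborel. (a, y) \<notin> N"
    using lborel_pair.AE_pair_iff[OF set] ae by simp
  then have "AE y in lborel. AE a in lborel. (a, y) \<notin> N"
    using lborel_pair.AE_commute[OF set] by simp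
  then have "AE y in lborel. AE a in lborel. P (a, y)"
    using N(2) by (auto elim!: eventually_mono)
  then show ?thesis by (simp add: AE_completion_iff)
qed

text \<open>Null sections make a set null only through its measurability: Fubini is applied to the
  Borel main part of \<open>N\<close>, and the remainder lies in a null set.\<close>

lemma AE_lebesgue_if_sections:
  fixes N :: "(real \<times> real) set"
  assumes N: "N \<in> sets lebesgue" and sec: "AE y in lebesgue. AE a in lebesgue. (a, y) \<notin> N"
  shows "AE p in lebesgue. p \<notin> N"
proof -
  let ?A = "main_part lborel N"
  have A: "?A \<in> sets borel" using main_part_sets[OF N] by simp
  have sub: "?A \<subseteq> N" using main_part_null_part_Un[OF N] by blast
  have set: "{x \<in> space (lborel \<Otimes>\<^sub>M lborel). (fst x, snd x) \<notin> ?A} \<in> sets (lborel \<Otimes>\<^sub>M (lborel :: real measure))"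
    unfolding lborel_prod using A by (simp add: Collect_neg_eq)
  have "AE y in lborel. AE a in lborel. (a, y) \<notin> N" using sec by (simp add: AE_completion_iff)
  then have "AE y in lborel. AE a in lborel. (a, y) \<notin> ?A"
    using sub by (auto elim!: eventually_mono)
  then have "AE a in lborel. AE y in lborel. (a, y) \<notin> ?A"
    using lborel_pair.AE_commute[OF set] by simp
  then have "AE p in lborel \<Otimes>\<^sub>M lborel. (fst p, snd p) \<notin> ?A"
    using lborel_pair.AE_pair_iff[OF set] by simp
  then have 1: "AE p in lborel. p \<notin> ?A" unfolding lborel_prod prod.collapse .
  obtain N' where "N' \<in> null_sets lborel" "null_part lborel N \<subseteq> N'" using null_part[OF N] by blast
  then have 2: "AE p in lborel. p \<notin> null_part lborel N"
    using AE_not_in[of N' lborel] by (auto elim!: eventually_mono)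
  from 1 2 have "AE p in lborel. p \<notin> N"
  proof eventually_elim
    case (elim p)
    then show ?case using main_part_null_part_Un[OF N] by blast
  qed
  then show ?thesis by (simp add: AE_completion_iff)
qed

text \<open>The zero set is closed, so it contains the end points too. Applied to
  \<open>deriv \<psi>\<close>, this removes the boundary terms of an integration by parts in
  space.\<close>

lemma bump_algebra_boundary_zero:
  assumes F: "bump_algebra F" and z: "\<And>y::real. y \<notin> {\<alpha>..\<beta>} \<Longrightarrow> F y = 0"
  shows "F \<alpha> = 0" "F \<beta> = 0" "y \<notin> {\<alpha>..\<beta>} \<Longrightarrow> deriv F y = 0"
proof -
  have cl: "closed {y. F y = 0}"
    using bump_algebra_deriv(4)[OF F, of UNIV] by (intro closed_Collect_eq) auto
  have "closure {..<\<alpha>} \<subseteq> {y. F y = 0}" "closure {\<beta><..} \<subseteq> {y. F y = 0}"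
    by (intro closure_minimal cl; auto intro!: z)+
  then show "F \<alpha> = 0" "F \<beta> = 0" by auto
  show "deriv F y = 0" if y: "y \<notin> {\<alpha>..\<beta>}"
  proof -
    have "open (- {\<alpha>..\<beta>})" by (simp add: open_Compl)
    then have "eventually (\<lambda>y. F y = 0) (nhds y)"
      using y z by (auto simp: eventually_nhds intro!: exI[of _ "- {\<alpha>..\<beta>}"])
    then have "(F has_real_derivative 0) (at y)"
      using iffD2[OF DERIV_cong_ev[OF refl _ refl] DERIV_const] by blast
    then show ?thesis by (rule DERIV_imp_deriv)
  qed
qed

text \<open>Products of a function of age and a function of space are the test functions put into
  the weak equation of the diffusive problem; they reduce it to iterated one-dimensional
  integrals.\<close>

lemma tensor_test_function:
  fixes \<phi> \<psi> :: "real \<Rightarrow> real"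
  assumes \<phi>: "bump_algebra \<phi>" and \<phi>0: "\<And>a. a \<notin> {s..t} \<Longrightarrow> \<phi> a = 0"
    and \<psi>: "bump_algebra \<psi>" and \<psi>0: "\<And>y. y \<notin> {\<alpha>..\<beta>} \<Longrightarrow> \<psi> y = 0"
    and sub: "{s..t} \<times> {\<alpha>..\<beta>} \<subseteq> \<Omega>"
  shows "test_fun \<Omega> (\<lambda>p. \<phi> (fst p) * \<psi> (snd p))"
    "directional_derivative (1, 0) (\<lambda>p. \<phi> (fst p) * \<psi> (snd p)) = (\<lambda>p. deriv \<phi> (fst p) * \<psi> (snd p))"
    "directional_derivative (0, 1) (\<lambda>p. \<phi> (fst p) * \<psi> (snd p)) = (\<lambda>p. \<phi> (fst p) * deriv \<psi> (snd p))"
proof -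
  have pb: "bump_algebra (\<lambda>p. F (0 + l \<bullet> p))" if "bump_algebra F" for F and l :: "real \<times> real"
    using that
  proof induction
    case (bump_flat q c l')
    show ?case
      using bump_algebra.bump_flat[of q c "l' *\<^sub>R l"] by (simp add: algebra_simps inner_simps)
  qed (auto intro: bump_algebra.intros)
  have "bump_algebra (\<lambda>p::real \<times> real. \<phi> (0 + (1, 0) \<bullet> p) * \<psi> (0 + (0, 1) \<bullet> p))"
    by (intro bump_algebra.bump_mult pb \<phi> \<psi>)
  then have "bump_algebra (\<lambda>p. \<phi> (fst p) * \<psi> (snd p))" by (simp add: inner_prod_def)
  then have sm: "smooth_fun (\<lambda>p. \<phi> (fst p) * \<psi> (snd p))" by (rule bump_algebra_smooth)
  have "closure {p. \<phi> (fst p) * \<psi> (snd p) \<noteq> 0} \<subseteq> {s..t} \<times> {\<alpha>..\<beta>}"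
  proof (intro closure_minimal closed_Times subsetI)
    fix p assume "p \<in> {p. \<phi> (fst p) * \<psi> (snd p) \<noteq> 0}"
    then show "p \<in> {s..t} \<times> {\<alpha>..\<beta>}"
      using \<phi>0[of "fst p"] \<psi>0[of "snd p"] by (cases p) (auto simp del: atLeastAtMost_iff)
  qed auto
  moreover have "compact ({s..t} \<times> {\<alpha>..\<beta>})" by (intro compact_Times) auto
  ultimately show "test_fun \<Omega> (\<lambda>p. \<phi> (fst p) * \<psi> (snd p))"
    unfolding test_fun_def using sm sub
    by (meson closed_closure compact_closure bounded_subset compact_imp_bounded closure_subset subset_trans compact_eq_bounded_closed)
  have "((\<lambda>p. \<phi> (fst p)) has_derivative (\<lambda>h. deriv \<phi> (fst p) * fst h)) (at p)"
    "((\<lambda>p. \<psi> (snd p)) has_derivative (\<lambda>h. deriv \<psi> (snd p) * snd h)) (at p)" for p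
    by (rule has_derivative_compose[OF has_derivative_fst[OF has_derivative_ident]
        bump_algebra_deriv(2)[OF \<phi>, unfolded has_field_derivative_def]],
      rule has_derivative_compose[OF has_derivative_snd[OF has_derivative_ident]
        bump_algebra_deriv(2)[OF \<psi>, unfolded has_field_derivative_def]])
  from has_derivative_mult[OF this]
  have d: "((\<lambda>p. \<phi> (fst p) * \<psi> (snd p)) has_derivative
     (\<lambda>h. \<phi> (fst p) * (deriv \<psi> (snd p) * snd h) + deriv \<phi> (fst p) * fst h * \<psi> (snd p))) (at p)" for p .
  show "directional_derivative (1, 0) (\<lambda>p. \<phi> (fst p) * \<psi> (snd p)) = (\<lambda>p. deriv \<phi> (fst p) * \<psi> (snd p))"
    "directional_derivative (0, 1) (\<lambda>p. \<phi> (fst p) * \<psi> (snd p)) = (\<lambda>p. \<phi> (fst p) * deriv \<psi> (snd p))"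
    by (subst directional_derivative_eq[OF d]; simp)+
qed

lemma set_integral_restrict_support:
  fixes g :: "'a \<Rightarrow> real"
  assumes "R \<subseteq> \<Omega>" "\<And>p. p \<in> \<Omega> \<Longrightarrow> p \<notin> R \<Longrightarrow> g p = 0"
  shows "(LINT p:\<Omega>|M. g p) = (LINT p:R|M. g p)"
  unfolding set_lebesgue_integral_def
  by (intro Bochner_Integration.integral_cong refl) (use assms in \<open>auto simp: indicator_def\<close>)

lemma set_integral_box_continuous:
  fixes g :: "real \<times> real \<Rightarrow> real"
  assumes "continuous_on ({s..t} \<times> {\<alpha>..\<beta>}) g"
  shows "(LINT p:{s..t} \<times> {\<alpha>..\<beta>}|lebesgue. g p) = integral {s..t} (\<lambda>a. integral {\<alpha>..\<beta>} (\<lambda>y. g (a, y)))"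
proof -
  have R: "{s..t} \<times> {\<alpha>..\<beta>} = cbox (s, \<alpha>) (t, \<beta>)" by (simp add: cbox_Pair_eq)
  have c: "continuous_on (cbox (s, \<alpha>) (t, \<beta>)) g" using assms R by simp
  have "set_integrable lebesgue (cbox (s, \<alpha>) (t, \<beta>)) g"
    by (rule absolutely_integrable_continuous[OF c])
  from set_lebesgue_integral_eq_integral(2)[OF this]
  show ?thesis unfolding R by (simp add: integral_prod_continuous[OF c])
qed

text \<open>As \<open>m\<close> is only measurable, the integrand is not continuous and Fubini for
  Bochner integrals is used. Borel measurability of \<open>m\<close> on the line makes
  \<open>m (fst p)\<close> Borel on the plane.\<close>

lemma set_integral_box_bounded_times_continuous:
  fixes g :: "real \<times> real \<Rightarrow> real" and m :: "real \<Rightarrow> real"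
  assumes m: "m \<in> borel_measurable borel" "\<And>r. \<bar>m r\<bar> \<le> M"
    and g: "continuous_on ({s..t} \<times> {\<alpha>..\<beta>}) g"
  shows "set_integrable lebesgue ({s..t} \<times> {\<alpha>..\<beta>}) (\<lambda>p. m (fst p) * g p)" (is ?A)
    "(LINT p:{s..t} \<times> {\<alpha>..\<beta>}|lebesgue. m (fst p) * g p) =
      integral {s..t} (\<lambda>a. m a * integral {\<alpha>..\<beta>} (\<lambda>y. g (a, y)))" (is ?B)
proof -
  let ?R = "{s..t} \<times> {\<alpha>..\<beta>}"
  have R: "?R = cbox (s, \<alpha>) (t, \<beta>)" by (simp add: cbox_Pair_eq)
  have Rb: "?R \<in> sets borel" unfolding R by simp
  have gi: "set_integrable lborel ?R g"
    unfolding set_integrable_def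
    by (rule borel_integrable_compact) (auto intro!: compact_Times g)
  have gm: "(\<lambda>p. indicator ?R p *\<^sub>R g p) \<in> borel_measurable borel"
    using gi by (auto simp: set_integrable_def dest: borel_measurable_integrable)
  have mf: "(\<lambda>p::real \<times> real. m (fst p)) \<in> borel_measurable borel"
    by (rule measurable_compose[OF _ m(1)]) (auto simp: borel_measurable_continuous_onI continuous_on_fst)
  have hm: "(\<lambda>p. m (fst p) * (indicator ?R p *\<^sub>R g p)) \<in> borel_measurable borel"
    by (rule borel_measurable_times[OF mf gm])
  have hi: "integrable lborel (\<lambda>p. m (fst p) * (indicator ?R p *\<^sub>R g p))"
  proof (rule Bochner_Integration.integrable_bound)
    show "integrable lborel (\<lambda>p. M * (indicator ?R p *\<^sub>R g p))"
      using gi unfolding set_integrable_def by (rule integrable_mult_right)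
    show "AE p in lborel. norm (m (fst p) * (indicator ?R p *\<^sub>R g p)) \<le> norm (M * (indicator ?R p *\<^sub>R g p))"
      using m(2) by (intro AE_I2) (auto simp: abs_mult intro!: mult_right_mono order_trans[OF m(2) abs_ge_self])
  qed (use hm in simp)
  have eq: "(\<lambda>p. indicator ?R p *\<^sub>R (m (fst p) * g p)) = (\<lambda>p. m (fst p) * (indicator ?R p *\<^sub>R g p))"
    by (auto simp: fun_eq_iff)
  show ?A unfolding set_integrable_def eq using hi hm by (simp add: integrable_completion)
  have "(LINT p:?R|lebesgue. m (fst p) * g p) = integral\<^sup>L lborel (\<lambda>p. m (fst p) * (indicator ?R p *\<^sub>R g p))"
    unfolding set_lebesgue_integral_def eq using hm by (simp add: integral_completion)
  also have "\<dots> = integral\<^sup>L (lborel \<Otimes>\<^sub>M lborel) (\<lambda>(a, y). m a * (indicator ?R (a, y) *\<^sub>R g (a, y)))"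
    unfolding lborel_prod case_prod_beta prod.collapse ..
  also have "\<dots> = (LINT a|lborel. LINT y|lborel. m a * (indicator ?R (a, y) *\<^sub>R g (a, y)))"
  proof (rule lborel_pair.integral_fst[symmetric])
    have "(\<lambda>(a, y). m a * (indicator ?R (a, y) *\<^sub>R g (a, y))) = (\<lambda>p. m (fst p) * (indicator ?R p *\<^sub>R g p))"
      by (simp add: fun_eq_iff)
    then show "integrable (lborel \<Otimes>\<^sub>M lborel) (\<lambda>(a, y). m a * (indicator ?R (a, y) *\<^sub>R g (a, y)))"
      using hi by (simp only: lborel_prod)
  qed
  also have "\<dots> = (LINT a:{s..t}|lborel. m a * integral {\<alpha>..\<beta>} (\<lambda>y. g (a, y)))"
    unfolding set_lebesgue_integral_def
  proof (intro Bochner_Integration.integral_cong refl)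
    fix a
    show "(LINT y|lborel. m a * (indicator ?R (a, y) *\<^sub>R g (a, y))) =
       indicator {s..t} a *\<^sub>R (m a * integral {\<alpha>..\<beta>} (\<lambda>y. g (a, y)))"
    proof (cases "a \<in> {s..t}")
      case True
      have "continuous_on {\<alpha>..\<beta>} (\<lambda>y. g (a, y))"
        using True by (intro continuous_on_compose2[OF g]) (auto intro!: continuous_intros)
      then have "set_integrable lborel {\<alpha>..\<beta>} (\<lambda>y. g (a, y))"
        unfolding set_integrable_def by (intro borel_integrable_compact) auto
      from set_borel_integral_eq_integral(2)[OF this]
      show ?thesis using True by (simp add: set_lebesgue_integral_def indicator_def)
    next
      case False
      then have "indicator ?R (a, y) = (0::real)" "indicator {s..t} a = (0::real)" for y by (auto simp del: atLeastAtMost_iff)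
      then show ?thesis by simp
    qed
  qed
  also have "\<dots> = integral {s..t} (\<lambda>a. m a * integral {\<alpha>..\<beta>} (\<lambda>y. g (a, y)))"
  proof (rule set_borel_integral_eq_integral(2))
    have cG: "continuous_on {s..t} (\<lambda>a. integral {\<alpha>..\<beta>} (\<lambda>y. g (a, y)))"
      using integral_continuous_on_param[of "{s..t}" \<alpha> \<beta> "\<lambda>a y. g (a, y)"] g by simp
    have gi: "set_integrable lborel {s..t} (\<lambda>a. integral {\<alpha>..\<beta>} (\<lambda>y. g (a, y)))"
      unfolding set_integrable_def by (intro borel_integrable_compact cG) auto
    show "set_integrable lborel {s..t} (\<lambda>a. m a * integral {\<alpha>..\<beta>} (\<lambda>y. g (a, y)))"
      unfolding set_integrable_def
    proof (rule Bochner_Integration.integrable_bound[OF integrable_mult_right[OF gi[unfolded set_integrable_def], of M]])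
      have "(\<lambda>a. m a * (indicator {s..t} a *\<^sub>R integral {\<alpha>..\<beta>} (\<lambda>y. g (a, y)))) \<in> borel_measurable lborel"
        using gi m(1) unfolding set_integrable_def by (intro borel_measurable_times) auto
      then show "(\<lambda>a. indicator {s..t} a *\<^sub>R (m a * integral {\<alpha>..\<beta>} (\<lambda>y. g (a, y)))) \<in> borel_measurable lborel"
        by (simp add: mult.left_commute)
    qed (use m(2) in \<open>auto intro!: AE_I2 mult_right_mono order_trans[OF m(2) abs_ge_self] simp: abs_mult indicator_def\<close>)
  qed
  finally show ?B .
qed

section \<open>The weak equation of an equilibrium as a tested inequality\<close>

lemma ages_I: "0 < a \<Longrightarrow> a \<le> b \<Longrightarrow> ereal b < a_m \<Longrightarrow> a \<in> ages a_m"
  by (simp add: ages_def le_less_trans[of "ereal a" "ereal b"])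

lemma Icc_subset_ages: "ereal b < a_m \<Longrightarrow> {0..b} \<subseteq> insert 0 (ages a_m)"
  using ages_I[of _ b a_m] by (force simp: order.order_iff_strict)

lemma equilibrium_continuous:
  assumes "positive_equilibrium a_m \<beta> \<mu> f d u" "ereal b < a_m"
  shows "continuous_on ({0..b} \<times> {0..1}) (case_prod u)"
proof -
  have "continuous_on (insert 0 (ages a_m) \<times> {0..1}) (case_prod u)"
    using assms(1) unfolding positive_equilibrium_def by blast
  then show ?thesis
    by (rule continuous_on_subset) (intro Sigma_mono Icc_subset_ages assms(2) order_refl)
qed

lemma equilibrium_pos:
  assumes "positive_equilibrium a_m \<beta> \<mu> f d u" "ereal b < a_m" "a \<in> {0..b}" "x \<in> {0..1}"
  shows "0 < u a x"
  using assms(1,4) Icc_subset_ages[OF assms(2)] assms(3) unfolding positive_equilibrium_def by blast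

lemma set_integrable_times_continuous:
  fixes h g :: "real \<times> real \<Rightarrow> real"
  assumes "set_integrable lebesgue R h" "continuous_on R g" "compact R"
  shows "set_integrable lebesgue R (\<lambda>p. h p * g p)"
proof -
  have "R \<in> sets lebesgue" using assms(3) by (simp add: lmeasurable_compact fmeasurableD)
  moreover have "g \<in> borel_measurable (lebesgue_on R)"
    by (rule continuous_imp_measurable_on_sets_lebesgue) fact+
  moreover have "bounded (g ` R)" using assms(2,3) compact_continuous_image compact_imp_bounded by blast
  ultimately have "set_integrable lebesgue R (\<lambda>p. g p * h p)"
    using absolutely_integrable_bounded_measurable_product[OF bilinear_times, of g R h] assms(1) by blast
  then show ?thesis by (simp add: mult.commute)
qed

lemma bounded_times_continuous_integrable:
  fixes m g :: "real \<Rightarrow> real"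
  assumes "m \<in> borel_measurable borel" "\<And>r. \<bar>m r\<bar> \<le> M" "continuous_on {s..t} g"
  shows "(\<lambda>a. m a * g a) absolutely_integrable_on {s..t}"
proof (rule absolutely_integrable_bounded_measurable_product_real)
  show "m \<in> borel_measurable (lebesgue_on {s..t})"
    using assms(1) by (intro measurable_restrict_space1 measurable_completion) simp
  show "bounded (m ` {s..t})" using assms(2) by (intro boundedI[of _ M]) auto
qed (auto intro!: absolutely_integrable_continuous_real assms(3))

lemma weak_derivative_test:
  "weak_derivative \<Omega> v u g \<Longrightarrow> test_fun \<Omega> \<phi> \<Longrightarrow>
    (LINT p:\<Omega>|lebesgue. u p * directional_derivative v \<phi> p) = - (LINT p:\<Omega>|lebesgue. g p * \<phi> p)"
  by (simp add: weak_derivative_def)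

text \<open>The sign \<sigma> treats both comparisons at once. With \<open>\<sigma> = 1\<close>,
  \<open>cmp\<close> says \<open>m \<le> \<mu>\<close> and \<open>u\<close> is a subsolution for
  mortality \<open>m\<close>; with \<open>\<sigma> = -1\<close>, it says
  \<open>\<mu> \<le> m\<close> and \<open>- u\<close> is one. Ages start at \<open>s > 0\<close>
  because the weak equation lives on an open set.\<close>

lemma equilibrium_weak_inequality:
  fixes u :: "real \<Rightarrow> real \<Rightarrow> real"
  assumes eq: "positive_equilibrium a_m \<beta> \<mu> f d u"
    and b: "0 < s" "s \<le> t" "t \<le> b" "ereal b < a_m" and \<alpha>: "0 < \<alpha>" "\<alpha> \<le> \<omega>" "\<omega> < 1"
    and m: "m \<in> borel_measurable borel" "\<And>r. \<bar>m r\<bar> \<le> M"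
    and cmp: "\<And>x. x \<in> {\<alpha>..\<omega>} \<Longrightarrow> AE a in lebesgue. a \<in> {0<..<b} \<longrightarrow> m a * \<sigma> \<le> \<sigma> * \<mu> a x"
    and \<phi>: "bump_algebra \<phi>" "\<And>a. 0 \<le> \<phi> a" "\<And>a. a \<notin> {s..t} \<Longrightarrow> \<phi> a = 0"
    and \<psi>: "bump_algebra \<psi>" "\<And>y. 0 \<le> \<psi> y" "\<And>y. y \<notin> {\<alpha>..\<omega>} \<Longrightarrow> \<psi> y = 0"
  defines "U \<equiv> \<lambda>\<psi> a. integral {\<alpha>..\<omega>} (\<lambda>y. \<sigma> * u a y * \<psi> y)"
  shows "0 \<le> integral {s..t} (\<lambda>a. U \<psi> a * deriv \<phi> a + (d * U (deriv (deriv \<psi>)) a - m a * U \<psi> a) * \<phi> a)"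
proof -
  define \<Omega> where "\<Omega> = ages a_m \<times> {0<..<1::real}"
  define R where "R = {s..t} \<times> {\<alpha>..\<omega>}"
  note ag = ages_I[OF _ _ b(4)]
  have RO: "R \<subseteq> \<Omega>" "R \<subseteq> ages a_m \<times> {0..1}" using ag b \<alpha> by (auto simp: R_def \<Omega>_def)
  have cR: "compact R" by (auto simp: R_def intro!: compact_Times)
  have Rl: "R \<in> sets lebesgue" using cR by (simp add: lmeasurable_compact fmeasurableD)
  from eq obtain ux ua uxx where
    cu: "continuous_on (insert 0 (ages a_m) \<times> {0..1}) (case_prod u)" and
    upos: "\<And>a x. a \<in> insert 0 (ages a_m) \<Longrightarrow> x \<in> {0..1} \<Longrightarrow> 0 < u a x" and
    ux: "\<And>a x. a \<in> ages a_m \<Longrightarrow> x \<in> {0..1} \<Longrightarrow> (u a has_real_derivative ux a x) (at x within {0..1})" and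
    cux: "continuous_on (ages a_m \<times> {0..1}) (case_prod ux)" and
    wa: "weak_derivative \<Omega> (1, 0) (case_prod u) (case_prod ua)" and
    wx: "weak_derivative \<Omega> (0, 1) (case_prod ux) (case_prod uxx)" and
    ae: "AE (a, x) in lebesgue. (a, x) \<in> \<Omega> \<longrightarrow> ua a x = d * uxx a x - \<mu> a x * u a x"
    unfolding positive_equilibrium_def \<Omega>_def by blast
  have cuR: "continuous_on R (case_prod u)" using RO by (intro continuous_on_subset[OF cu]) auto
  have cuxR: "continuous_on R (case_prod ux)" using RO by (intro continuous_on_subset[OF cux]) auto
  have ia: "set_integrable lebesgue R (case_prod ua)" and ix: "set_integrable lebesgue R (case_prod uxx)"
    using wa wx RO cR by (auto simp: weak_derivative_def locally_integrable_on_def)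
  have iu: "set_integrable lebesgue R (case_prod u)"
    using absolutely_integrable_continuous[of "(s, \<alpha>)" "(t, \<omega>)" "case_prod u"] cuR
    by (simp add: R_def cbox_Pair_eq)
  have test: "test_fun \<Omega> (\<lambda>p. \<phi> (fst p) * \<psi> (snd p))"
    "directional_derivative (1, 0) (\<lambda>p. \<phi> (fst p) * \<psi> (snd p)) = (\<lambda>p. deriv \<phi> (fst p) * \<psi> (snd p))"
    "directional_derivative (0, 1) (\<lambda>p. \<phi> (fst p) * \<psi> (snd p)) = (\<lambda>p. \<phi> (fst p) * deriv \<psi> (snd p))"
    using tensor_test_function[OF \<phi>(1,3) \<psi>(1,3) RO(1)[unfolded R_def]] by simp_all
  have \<psi>': "bump_algebra (deriv \<psi>)" "bump_algebra (deriv (deriv \<psi>))" and \<phi>': "bump_algebra (deriv \<phi>)"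
    by (intro bump_algebra_deriv(1) \<psi> \<phi>)+
  have z\<phi>': "deriv \<phi> a = 0" if "a \<notin> {s..t}" for a
    by (rule bump_algebra_boundary_zero(3)[OF \<phi>(1,3) that])
  have z\<psi>': "deriv \<psi> y = 0" if "y \<notin> {\<alpha>..\<omega>}" for y
    by (rule bump_algebra_boundary_zero(3)[OF \<psi>(1,3) that])
  note zb = bump_algebra_boundary_zero(1,2)[OF \<psi>'(1) z\<psi>']
  have cp: "continuous_on S (\<lambda>p::real \<times> real. F (fst p))" "continuous_on S (\<lambda>p::real \<times> real. F (snd p))"
    if "bump_algebra F" for F S
    by (rule continuous_on_compose2[OF bump_algebra_deriv(4)[OF that, of UNIV]]; auto intro: continuous_intros)+
  have off: "a \<notin> {s..t} \<or> y \<notin> {\<alpha>..\<omega>}" if "(a, y) \<notin> R" for a y using that by (auto simp: R_def)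
  define c where "c p = \<phi> (fst p) * \<psi> (snd p)" for p
  have cc: "continuous_on S c" for S unfolding c_def by (intro continuous_intros cp \<phi> \<psi>)
  have cpos: "0 \<le> c p" for p unfolding c_def using \<phi>(2) \<psi>(2) by simp
  have coff: "c p = 0" if "p \<notin> R" for p using off[of "fst p" "snd p"] that \<phi>(3) \<psi>(3) by (auto simp: c_def)

  have E1: "integral {s..t} (\<lambda>a. deriv \<phi> a * U \<psi> a) = - \<sigma> * (LINT p:R|lebesgue. case_prod ua p * c p)"
  proof -
    have "integral {s..t} (\<lambda>a. deriv \<phi> a * U \<psi> a) =
       integral {s..t} (\<lambda>a. \<sigma> * integral {\<alpha>..\<omega>} (\<lambda>y. u a y * (deriv \<phi> a * \<psi> y)))"
      unfolding U_def by (simp add: mult_ac flip: integral_mult_right)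
    also have "\<dots> = \<sigma> * (LINT p:R|lebesgue. case_prod u p * (deriv \<phi> (fst p) * \<psi> (snd p)))"
    proof -
      have "continuous_on R (\<lambda>p. case_prod u p * (deriv \<phi> (fst p) * \<psi> (snd p)))"
        by (intro continuous_intros cuR cp \<phi>' \<psi>)
      from set_integral_box_continuous[OF this[unfolded R_def]] show ?thesis by (simp add: R_def)
    qed
    also have "(LINT p:R|lebesgue. case_prod u p * (deriv \<phi> (fst p) * \<psi> (snd p))) =
       (LINT p:\<Omega>|lebesgue. case_prod u p * (deriv \<phi> (fst p) * \<psi> (snd p)))"
      using off z\<phi>' \<psi>(3) by (intro set_integral_restrict_support[symmetric] RO(1)) force
    also have "\<dots> = - (LINT p:\<Omega>|lebesgue. case_prod ua p * c p)"
      using weak_derivative_test[OF wa test(1)] unfolding test(2) c_def .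
    also have "(LINT p:\<Omega>|lebesgue. case_prod ua p * c p) = (LINT p:R|lebesgue. case_prod ua p * c p)"
      by (intro set_integral_restrict_support RO(1)) (simp add: coff)
    finally show ?thesis by simp
  qed

  have E2: "integral {s..t} (\<lambda>a. \<phi> a * U (deriv (deriv \<psi>)) a) = \<sigma> * (LINT p:R|lebesgue. case_prod uxx p * c p)"
  proof -
    \<comment> \<open>The derivative \<open>ux\<close> is classical, so one space derivative is
      moved by ordinary integration by parts; the other one is moved below through the weak
      derivative \<open>uxx\<close> of \<open>ux\<close>.\<close>
    have parts: "integral {\<alpha>..\<omega>} (\<lambda>y. u a y * deriv (deriv \<psi>) y) = - integral {\<alpha>..\<omega>} (\<lambda>y. ux a y * deriv \<psi> y)"
      if a: "a \<in> {s..t}" for a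
    proof -
      have aa: "a \<in> ages a_m" using a b by (intro ag) auto
      have c1: "continuous_on {\<alpha>..\<omega>} (u a)" "continuous_on {\<alpha>..\<omega>} (ux a)"
        using continuous_on_slice[OF cuR[unfolded R_def] a] continuous_on_slice[OF cuxR[unfolded R_def] a] by auto
      have i1: "(\<lambda>y. u a y * deriv (deriv \<psi>) y) integrable_on {\<alpha>..\<omega>}" "(\<lambda>y. ux a y * deriv \<psi> y) integrable_on {\<alpha>..\<omega>}"
        by (intro integrable_continuous_real continuous_intros c1 bump_algebra_deriv(4) \<psi>')+
      have "((\<lambda>y. u a y * deriv (deriv \<psi>) y + ux a y * deriv \<psi> y) has_integral
         (u a \<omega> * deriv \<psi> \<omega> - u a \<alpha> * deriv \<psi> \<alpha>)) {\<alpha>..\<omega>}"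
      proof (rule fundamental_theorem_of_calculus[OF \<alpha>(2)])
        fix y assume y: "y \<in> {\<alpha>..\<omega>}"
        have "(u a has_real_derivative ux a y) (at y within {\<alpha>..\<omega>})"
          using ux[OF aa, of y] y \<alpha> by (auto intro: DERIV_subset)
        moreover have "(deriv \<psi> has_real_derivative deriv (deriv \<psi>) y) (at y within {\<alpha>..\<omega>})"
          using bump_algebra_deriv(2)[OF \<psi>'(1)] by (auto intro: has_field_derivative_at_within)
        ultimately have "((\<lambda>y. u a y * deriv \<psi> y) has_real_derivative
           u a y * deriv (deriv \<psi>) y + ux a y * deriv \<psi> y) (at y within {\<alpha>..\<omega>})"
          by (rule DERIV_mult[THEN DERIV_cong]) (simp add: mult_ac)
        then show "((\<lambda>y. u a y * deriv \<psi> y) has_vector_derivative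
           u a y * deriv (deriv \<psi>) y + ux a y * deriv \<psi> y) (at y within {\<alpha>..\<omega>})"
          by (simp add: has_real_derivative_iff_has_vector_derivative)
      qed
      then have "integral {\<alpha>..\<omega>} (\<lambda>y. u a y * deriv (deriv \<psi>) y + ux a y * deriv \<psi> y) = 0"
        using zb by (simp add: integral_unique)
      then show ?thesis using i1 by (simp add: hk_integral_add)
    qed
    have "integral {s..t} (\<lambda>a. \<phi> a * U (deriv (deriv \<psi>)) a) =
       integral {s..t} (\<lambda>a. - \<sigma> * integral {\<alpha>..\<omega>} (\<lambda>y. ux a y * (\<phi> a * deriv \<psi> y)))"
    proof (rule Henstock_Kurzweil_Integration.integral_cong)
      fix a assume "a \<in> {s..t}"
      have "\<phi> a * U (deriv (deriv \<psi>)) a = \<sigma> * \<phi> a * integral {\<alpha>..\<omega>} (\<lambda>y. u a y * deriv (deriv \<psi>) y)"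
        unfolding U_def by (simp add: mult_ac flip: integral_mult_right)
      also have "\<dots> = - \<sigma> * integral {\<alpha>..\<omega>} (\<lambda>y. ux a y * (\<phi> a * deriv \<psi> y))"
        unfolding parts[OF \<open>a \<in> {s..t}\<close>] by (simp add: mult_ac flip: integral_mult_right)
      finally show "\<phi> a * U (deriv (deriv \<psi>)) a = - \<sigma> * integral {\<alpha>..\<omega>} (\<lambda>y. ux a y * (\<phi> a * deriv \<psi> y))" .
    qed
    also have "\<dots> = - \<sigma> * (LINT p:R|lebesgue. case_prod ux p * (\<phi> (fst p) * deriv \<psi> (snd p)))"
    proof -
      have "continuous_on R (\<lambda>p. case_prod ux p * (\<phi> (fst p) * deriv \<psi> (snd p)))"
        by (intro continuous_intros cuxR cp \<phi> \<psi>')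
      from set_integral_box_continuous[OF this[unfolded R_def]] show ?thesis by (simp add: R_def)
    qed
    also have "(LINT p:R|lebesgue. case_prod ux p * (\<phi> (fst p) * deriv \<psi> (snd p))) =
       (LINT p:\<Omega>|lebesgue. case_prod ux p * (\<phi> (fst p) * deriv \<psi> (snd p)))"
      using off z\<psi>' \<phi>(3) by (intro set_integral_restrict_support[symmetric] RO(1)) force
    also have "\<dots> = - (LINT p:\<Omega>|lebesgue. case_prod uxx p * c p)"
      using weak_derivative_test[OF wx test(1)] unfolding test(3) c_def .
    also have "(LINT p:\<Omega>|lebesgue. case_prod uxx p * c p) = (LINT p:R|lebesgue. case_prod uxx p * c p)"
      by (intro set_integral_restrict_support RO(1)) (simp add: coff)
    finally show ?thesis by simp
  qed

  have cg: "continuous_on R (\<lambda>p. \<sigma> * case_prod u p * c p)"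
    by (intro continuous_intros cuR cc)
  note box = set_integral_box_bounded_times_continuous[OF m cg[unfolded R_def], folded R_def]
  have E3: "integral {s..t} (\<lambda>a. m a * U \<psi> a * \<phi> a) = (LINT p:R|lebesgue. m (fst p) * (\<sigma> * case_prod u p * c p))"
    by (subst box(2)) (simp add: U_def c_def mult_ac flip: integral_mult_right)

  have AEq: "AE p in lebesgue. p \<in> R \<longrightarrow> m (fst p) * (\<sigma> * case_prod u p) \<le> \<sigma> * (d * case_prod uxx p - case_prod ua p)"
  proof -
    define N where "N = {p \<in> R. \<sigma> * (d * case_prod uxx p - case_prod ua p) < m (fst p) * (\<sigma> * case_prod u p)}"
    define h1 where "h1 p = indicator R p *\<^sub>R case_prod ua p" for p
    define h2 where "h2 p = indicator R p *\<^sub>R case_prod uxx p" for p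
    define h3 where "h3 p = indicator R p *\<^sub>R case_prod u p" for p
    have [measurable]: "h1 \<in> borel_measurable lebesgue" "h2 \<in> borel_measurable lebesgue" "h3 \<in> borel_measurable lebesgue"
      using ia ix iu unfolding set_integrable_def h1_def[abs_def] h2_def[abs_def] h3_def[abs_def]
      by (auto dest: borel_measurable_integrable)
    have "(\<lambda>p::real \<times> real. m (fst p)) \<in> borel_measurable borel"
      by (rule measurable_compose[OF _ m(1)]) (auto simp: borel_measurable_continuous_onI continuous_on_fst)
    then have [measurable]: "(\<lambda>p::real \<times> real. m (fst p)) \<in> borel_measurable lebesgue"
      by (intro measurable_completion) simp
    have "{p \<in> space lebesgue. \<sigma> * (d * h2 p - h1 p) < m (fst p) * (\<sigma> * h3 p)} \<in> sets lebesgue"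
      by measurable
    then have "R \<inter> {p \<in> space lebesgue. \<sigma> * (d * h2 p - h1 p) < m (fst p) * (\<sigma> * h3 p)} \<in> sets lebesgue"
      using Rl by blast
    also have "R \<inter> {p \<in> space lebesgue. \<sigma> * (d * h2 p - h1 p) < m (fst p) * (\<sigma> * h3 p)} = N"
      by (auto simp: N_def h1_def h2_def h3_def)
    finally have N: "N \<in> sets lebesgue" .
    have "AE y in lebesgue. AE a in lebesgue. (a, y) \<in> \<Omega> \<longrightarrow> ua a y = d * uxx a y - \<mu> a y * u a y"
      using AE_lebesgue_sections[OF ae] by simp
    then have "AE y in lebesgue. AE a in lebesgue. (a, y) \<notin> N"
    proof eventually_elim
      case (elim y)
      show ?case
      proof (cases "y \<in> {\<alpha>..\<omega>}")
        case True
        \<comment> \<open>\<open>cmp\<close> concerns the open interval, while \<open>{s..t}\<close>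
          may end at \<open>b\<close>.\<close>
        have "AE a in lebesgue. a \<noteq> b"
          by (rule AE_I'[of "{b}"]) (auto simp: null_sets_completionI)
        with elim cmp[OF True] show ?thesis
        proof eventually_elim
          case (elim a)
          show ?case
          proof
            assume n: "(a, y) \<in> N"
            then have a: "a \<in> {s..t}" "(a, y) \<in> R" by (auto simp: N_def R_def)
            then have "m a * \<sigma> \<le> \<sigma> * \<mu> a y" using elim b by auto
            moreover have "0 < u a y" using a RO by (intro upos) auto
            ultimately have "m a * \<sigma> * u a y \<le> \<sigma> * \<mu> a y * u a y" by (intro mult_right_mono) auto
            moreover have e: "d * uxx a y - ua a y = \<mu> a y * u a y" using elim(1) a RO by auto
            have "\<sigma> * (d * uxx a y - ua a y) < m a * (\<sigma> * u a y)" using n by (simp add: N_def)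
            then have "\<sigma> * \<mu> a y * u a y < m a * \<sigma> * u a y" unfolding e by (simp add: mult_ac)
            ultimately show False by simp
          qed
        qed
      qed (auto simp: N_def R_def)
    qed
    from AE_lebesgue_if_sections[OF N this] show ?thesis
      by eventually_elim (auto simp: N_def not_less)
  qed

  have ica: "set_integrable lebesgue R (\<lambda>p. case_prod ua p * c p)"
    and icx: "set_integrable lebesgue R (\<lambda>p. case_prod uxx p * c p)"
    by (intro set_integrable_times_continuous ia ix cc cR)+
  have i3: "set_integrable lebesgue R (\<lambda>p. \<sigma> * (d * (case_prod uxx p * c p) - case_prod ua p * c p))"
    using ica icx by (intro set_integrable_mult_right set_integral_diff(1)) auto
  have "(LINT p:R|lebesgue. m (fst p) * (\<sigma> * case_prod u p * c p)) \<le>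
     (LINT p:R|lebesgue. \<sigma> * (d * (case_prod uxx p * c p) - case_prod ua p * c p))"
  proof (rule set_integral_mono_AE[OF box(1) i3])
    show "AE p in lebesgue. p \<in> R \<longrightarrow> m (fst p) * (\<sigma> * case_prod u p * c p) \<le>
       \<sigma> * (d * (case_prod uxx p * c p) - case_prod ua p * c p)"
      using AEq
    proof eventually_elim
      case (elim p)
      show ?case
      proof
        assume "p \<in> R"
        from mult_right_mono[OF elim[rule_format, OF this] cpos[of p]]
        show "m (fst p) * (\<sigma> * case_prod u p * c p) \<le> \<sigma> * (d * (case_prod uxx p * c p) - case_prod ua p * c p)"
          by (simp add: algebra_simps)
      qed
    qed
  qed
  also have "\<dots> = \<sigma> * (d * (LINT p:R|lebesgue. case_prod uxx p * c p) - (LINT p:R|lebesgue. case_prod ua p * c p))"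
    using ica icx by (simp add: set_integral_diff(2) set_integrable_mult_right)
  finally have main: "integral {s..t} (\<lambda>a. m a * U \<psi> a * \<phi> a) \<le>
     integral {s..t} (\<lambda>a. deriv \<phi> a * U \<psi> a) + d * integral {s..t} (\<lambda>a. \<phi> a * U (deriv (deriv \<psi>)) a)"
    unfolding E1 E2 E3 by (simp add: algebra_simps)

  have cU: "continuous_on {s..t} (U F)" if "bump_algebra F" for F
  proof -
    have "continuous_on ({s..t} \<times> {\<alpha>..\<omega>}) (case_prod (\<lambda>a y. \<sigma> * u a y))"
      using cuR unfolding R_def split_beta by (intro continuous_intros) auto
    from continuous_on_weighted_integral[OF this bump_algebra_deriv(4)[OF that]] show ?thesis
      unfolding U_def .
  qed
  have j1: "(\<lambda>a. deriv \<phi> a * U \<psi> a) integrable_on {s..t}" "(\<lambda>a. \<phi> a * U (deriv (deriv \<psi>)) a) integrable_on {s..t}"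
    by (intro integrable_continuous_real continuous_intros cU \<psi> \<psi>' bump_algebra_deriv(4) \<phi> \<phi>')+
  have j2: "(\<lambda>a. m a * (U \<psi> a * \<phi> a)) integrable_on {s..t}"
  proof -
    have "(\<lambda>a. m a * (U \<psi> a * \<phi> a)) absolutely_integrable_on {s..t}"
      by (rule bounded_times_continuous_integrable[OF m])
        (intro continuous_intros cU \<psi> bump_algebra_deriv(4) \<phi>)
    then show ?thesis by (rule set_lebesgue_integral_eq_integral)
  qed
  have "integral {s..t} (\<lambda>a. deriv \<phi> a * U \<psi> a + d * (\<phi> a * U (deriv (deriv \<psi>)) a) - m a * (U \<psi> a * \<phi> a)) =
    integral {s..t} (\<lambda>a. deriv \<phi> a * U \<psi> a) + d * integral {s..t} (\<lambda>a. \<phi> a * U (deriv (deriv \<psi>)) a)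
    - integral {s..t} (\<lambda>a. m a * (U \<psi> a * \<phi> a))"
    using j1 j2
    by (simp add: hk_integral_diff hk_integral_add
        integrable_add integrable_on_mult_right)
  also have "\<dots> \<ge> 0" using main by (simp add: mult_ac)
  also have "(\<lambda>a. deriv \<phi> a * U \<psi> a + d * (\<phi> a * U (deriv (deriv \<psi>)) a) - m a * (U \<psi> a * \<phi> a)) =
    (\<lambda>a. U \<psi> a * deriv \<phi> a + (d * U (deriv (deriv \<psi>)) a - m a * U \<psi> a) * \<phi> a)"
    by (simp add: fun_eq_iff algebra_simps)
  finally show ?thesis .
qed

text \<open>The tested inequality yields increments between positive ages. Age 0 is reached by
  letting \<open>s\<close> tend to 0, as \<open>u\<close> is continuous up to the initial age and
  the integral depends continuously on its lower limit.\<close>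

lemma equilibrium_heat_subsolution:
  fixes u :: "real \<Rightarrow> real \<Rightarrow> real"
  assumes eq: "positive_equilibrium a_m \<beta> \<mu> f d u"
    and b: "0 < b" "ereal b < a_m" and \<alpha>: "0 < \<alpha>" "\<alpha> \<le> \<omega>" "\<omega> < 1"
    and m: "m \<in> borel_measurable borel" "\<And>r. \<bar>m r\<bar> \<le> M"
    and cmp: "\<And>x. x \<in> {\<alpha>..\<omega>} \<Longrightarrow> AE a in lebesgue. a \<in> {0<..<b} \<longrightarrow> m a * \<sigma> \<le> \<sigma> * \<mu> a x"
  shows "heat_subsolution d m b \<alpha> \<omega> (\<lambda>a x. \<sigma> * u a x)"
  unfolding heat_subsolution_def
proof (intro conjI allI impI)
  have "continuous_on ({0..b} \<times> {\<alpha>..\<omega>}) (case_prod u)"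
    using \<alpha> by (intro continuous_on_subset[OF equilibrium_continuous[OF eq b(2)]]) auto
  then show cw: "continuous_on ({0..b} \<times> {\<alpha>..\<omega>}) (\<lambda>(a, x). \<sigma> * u a x)"
    unfolding split_beta by (intro continuous_intros) auto
  fix \<psi> :: "real \<Rightarrow> real" and s t :: real
  assume \<psi>: "bump_algebra \<psi>" "\<forall>y. 0 \<le> \<psi> y" "\<forall>y. y \<notin> {\<alpha>..\<omega>} \<longrightarrow> \<psi> y = 0"
    and st: "0 \<le> s" "s \<le> t" "t \<le> b"
  define U where "U F a = integral {\<alpha>..\<omega>} (\<lambda>y. \<sigma> * u a y * F y)" for F a
  have cU: "continuous_on {0..b} (U F)" if "bump_algebra F" for F
    using continuous_on_weighted_integral[OF cw bump_algebra_deriv(4)[OF that]] unfolding U_def .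
  have \<psi>'': "bump_algebra (deriv (deriv \<psi>))" by (intro bump_algebra_deriv(1) \<psi>)
  define G where "G a = d * U (deriv (deriv \<psi>)) a - m a * U \<psi> a" for a
  have intG: "G absolutely_integrable_on {s..t}" if "0 \<le> s" "t \<le> b" for s t
  proof -
    have "{s..t} \<subseteq> {0..b}" using that by auto
    then have "(\<lambda>a. d * U (deriv (deriv \<psi>)) a) absolutely_integrable_on {s..t}"
      "(\<lambda>a. m a * U \<psi> a) absolutely_integrable_on {s..t}"
      by (auto intro!: absolutely_integrable_continuous_real continuous_intros bounded_times_continuous_integrable[OF m]
        intro: continuous_on_subset[OF cU] \<psi> \<psi>'')
    then show ?thesis unfolding G_def by (rule set_integral_diff(1))
  qed
  have pos: "U \<psi> t - U \<psi> s \<le> integral {s..t} G" if st: "0 < s" "s < t" "t \<le> b" for s t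
  proof (rule weak_inequality_integrates[OF st(2)])
    show "continuous_on {s..t} (U \<psi>)" using st by (intro continuous_on_subset[OF cU] \<psi>(1)) auto
    show "G absolutely_integrable_on {s..t}" using st by (intro intG) auto
    fix \<phi> :: "real \<Rightarrow> real"
    assume \<phi>: "bump_algebra \<phi>" "\<forall>a. 0 \<le> \<phi> a" "\<forall>a. a \<notin> {s..t} \<longrightarrow> \<phi> a = 0"
    show "0 \<le> integral {s..t} (\<lambda>a. U \<psi> a * deriv \<phi> a + G a * \<phi> a)"
      unfolding U_def G_def
      using st \<phi> \<psi> by (intro equilibrium_weak_inequality[OF eq _ _ _ b(2) \<alpha> m cmp]) auto
  qed
  have "U \<psi> t - U \<psi> s \<le> integral {s..t} G"
  proof -
    consider "s = t" | "0 < s" "s < t" | "s = 0" "0 < t" using st by linarith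
    then show ?thesis
    proof cases
      case 3
      have int0: "G integrable_on {0..t}"
        using intG[of 0 t] st by (intro set_lebesgue_integral_eq_integral(1)) auto
      have "continuous_on {0..t} (\<lambda>s. U \<psi> t - U \<psi> s - integral {s..t} G)"
        using st by (intro continuous_intros indefinite_integral_continuous_1' int0 continuous_on_subset[OF cU] \<psi>(1)) auto
      then have "((\<lambda>s. U \<psi> t - U \<psi> s - integral {s..t} G) \<longlongrightarrow> U \<psi> t - U \<psi> 0 - integral {0..t} G) (at 0 within {0..t})"
        using 3 by (auto simp: continuous_on_def)
      then have lim: "((\<lambda>s. U \<psi> t - U \<psi> s - integral {s..t} G) \<longlongrightarrow> U \<psi> t - U \<psi> 0 - integral {0..t} G) (at_right 0)"
        using 3 by (simp add: at_within_Icc_at_right)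
      have "U \<psi> t - U \<psi> 0 - integral {0..t} G \<le> 0"
      proof (rule tendsto_upperbound[OF lim])
        show "\<forall>\<^sub>F s in at_right 0. U \<psi> t - U \<psi> s - integral {s..t} G \<le> 0"
          unfolding eventually_at_right_field using 3 st pos by (intro exI[of _ t]) force
      qed simp
      then show ?thesis using 3 by simp
    qed (use pos st in auto)
  qed
  then show "integral {\<alpha>..\<omega>} (\<lambda>y. \<sigma> * u t y * \<psi> y) - integral {\<alpha>..\<omega>} (\<lambda>y. \<sigma> * u s y * \<psi> y)
     \<le> integral {s..t} (\<lambda>a. d * integral {\<alpha>..\<omega>} (\<lambda>y. \<sigma> * u a y * deriv (deriv \<psi>) y)
       - m a * integral {\<alpha>..\<omega>} (\<lambda>y. \<sigma> * u a y * \<psi> y))"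
    unfolding U_def G_def .
qed

section \<open>The Neumann problem\<close>

text \<open>A maximum of \<open>u - W\<close> on a lateral boundary is excluded by the slope \<open>\<kappa>\<close> of \<open>W\<close> there, and
  an interior one by the maximum principle on slightly smaller boxes.\<close>

lemma neumann_comparison:
  fixes u :: "real \<Rightarrow> real \<Rightarrow> real"
  assumes d: "0 < d" and \<kappa>: "0 < \<kappa>" and b: "0 < b"
    and cu: "continuous_on ({0..b} \<times> {0..1}) (case_prod u)"
    and ux: "\<And>a x. a \<in> {0<..b} \<Longrightarrow> x \<in> {0, 1} \<Longrightarrow> (u a has_real_derivative 0) (at x within {0..1})"
    and sub: "\<And>r. 0 < r \<Longrightarrow> r < 1 / 2 \<Longrightarrow> heat_subsolution d (\<lambda>_. 0) b r (1 - r) u"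
    and init: "\<And>x. x \<in> {0..1} \<Longrightarrow> u 0 x \<le> L"
    and ax: "a \<in> {0..b}" "x \<in> {0..1}"
  shows "u a x \<le> L + \<kappa> * ((x - 1 / 2)\<^sup>2 + 2 * d * a)"
proof -
  \<comment> \<open>This \<open>W\<close> solves the heat equation exactly, and its outward slope is
    \<kappa> at both ends. Hence \<open>u - W\<close> increases strictly when moving inwards from a
    lateral boundary point.\<close>
  define W where "W a x = L + \<kappa> * ((x - 1 / 2)\<^sup>2 + 2 * d * a)" for a x
  define v where "v a x = u a x - W a x" for a x
  have cW: "continuous_on S (case_prod W)" for S
    unfolding W_def split_beta by (intro continuous_intros)
  have cv: "continuous_on ({0..b} \<times> {0..1}) (case_prod v)"
    using cu cW[of "{0..b} \<times> {0..1}"] unfolding v_def split_beta by (intro continuous_intros)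
  have comp: "compact ({0..b} \<times> {0..1::real})" by (intro compact_Times) auto
  have v0: "v 0 x \<le> 0" if "x \<in> {0..1}" for x
    using init[OF that] \<kappa> by (simp add: v_def W_def add_increasing2)
  obtain a1 x1 where a1: "a1 \<in> {0..b}" "x1 \<in> {0..1}"
    and max: "\<And>a x. a \<in> {0..b} \<Longrightarrow> x \<in> {0..1} \<Longrightarrow> v a x \<le> v a1 x1"
    using continuous_attains_sup[OF comp _ cv] b by auto
  have "v a1 x1 \<le> 0"
  proof (rule ccontr)
    define c where "c = v a1 x1"
    assume "\<not> ?thesis"
    then have c: "c > 0" by (simp add: c_def)
    have vx: "(v a has_real_derivative - (2 * \<kappa> * (x - 1 / 2))) (at x within {0..1})"
      if "a \<in> {0<..b}" "x \<in> {0, 1}" for a x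
      unfolding v_def[abs_def] W_def using ux[OF that]
      by (auto intro!: derivative_eq_intros simp: power2_eq_square algebra_simps)
    have side: "v a x < c" if a: "a \<in> {0..b}" and x: "x \<in> {0, 1}" for a x
    proof (cases "a = 0")
      case True
      then show ?thesis using v0[of x] x c by auto
    next
      case False
      then have a': "a \<in> {0<..b}" using a by auto
      show ?thesis
      proof (cases "x = 1")
        case True
        from has_real_derivative_neg_dec_left[OF vx[OF a' x]] True \<kappa>
        obtain e where e: "e > 0" "\<And>h. 0 < h \<Longrightarrow> 1 - h \<in> {0..1} \<Longrightarrow> h < e \<Longrightarrow> v a 1 < v a (1 - h)"
          by auto
        have "v a 1 < v a (1 - min (e / 2) (1 / 2))" using e(1) by (intro e(2)) (auto simp: min_def)
        also have "\<dots> \<le> c" unfolding c_def using e(1) by (intro max a) (auto simp: min_def)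
        finally show ?thesis using True by simp
      next
        case False
        then have x0: "x = 0" using x by simp
        from has_real_derivative_pos_inc_right[OF vx[OF a' x]] x0 \<kappa>
        obtain e where e: "e > 0" "\<And>h. 0 < h \<Longrightarrow> 0 + h \<in> {0..1} \<Longrightarrow> h < e \<Longrightarrow> v a 0 < v a (0 + h)"
          by auto
        have "v a 0 < v a (0 + min (e / 2) (1 / 2))" using e(1) by (intro e(2)) (auto simp: min_def)
        also have "\<dots> \<le> c" unfolding c_def using e(1) by (intro max a) (auto simp: min_def)
        finally show ?thesis using x0 by simp
      qed
    qed
    \<comment> \<open>Compactness of the two sides turns the pointwise strict bound
      \<open>side\<close> into a uniform gap.\<close>
    have cS: "compact ({0..b} \<times> {0, 1::real})" and neS: "{0..b} \<times> {0, 1::real} \<noteq> {}"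
      using b by (auto intro!: compact_Times)
    have cvS: "continuous_on ({0..b} \<times> {0, 1}) (case_prod v)"
      by (rule continuous_on_subset[OF cv]) auto
    obtain p where p: "p \<in> {0..b} \<times> {0, 1}"
      and maxp: "\<forall>q\<in>{0..b} \<times> {0, 1}. case_prod v q \<le> case_prod v p"
      by (rule bexE[OF continuous_attains_sup[OF cS neS cvS]])
    obtain a2 x2 where p2: "p = (a2, x2)" by (cases p)
    have a2: "a2 \<in> {0..b}" "x2 \<in> {0, 1}" using p by (auto simp: p2)
    have max2: "v a x \<le> v a2 x2" if "a \<in> {0..b}" "x \<in> {0, 1}" for a x
      using bspec[OF maxp, of "(a, x)"] that by (simp add: p2)
    \<comment> \<open>The cap by \<open>c\<close> keeps \<open>c - e / 2\<close> nonnegative, so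
      that the raised barrier still dominates the initial values.\<close>
    define e where "e = min (c - v a2 x2) c"
    have e: "e > 0" using side[OF a2] c by (simp add: e_def)
    obtain \<delta> where \<delta>: "\<delta> > 0"
      "\<And>a x y. a \<in> {0..b} \<Longrightarrow> x \<in> {0..1} \<Longrightarrow> y \<in> {0..1} \<Longrightarrow> \<bar>y - x\<bar> < \<delta> \<Longrightarrow> \<bar>v a y - v a x\<bar> < e / 2"
      using box_modulus[OF cv comp, of "e / 2"] e by auto
    have x1: "0 < x1" "x1 < 1"
      using side[OF a1(1), of x1] a1(2) by (auto simp: c_def less_le)
    define r where "r = min (\<delta> / 2) (min (1 / 4) (min x1 (1 - x1)))"
    have r: "0 < r" "r < 1 / 2" "r < \<delta>" "r \<le> x1" "x1 \<le> 1 - r"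
      using \<delta>(1) x1 by (auto simp: r_def min_def)
    have near: "v a r \<le> c - e / 2" "v a (1 - r) \<le> c - e / 2" if "a \<in> {0..b}" for a
    proof -
      have "\<bar>v a r - v a 0\<bar> < e / 2" "\<bar>v a (1 - r) - v a 1\<bar> < e / 2"
        using \<delta>(2)[OF that, of 0 r] \<delta>(2)[OF that, of 1 "1 - r"] r by auto
      moreover have "v a 0 \<le> c - e" "v a 1 \<le> c - e" using max2[OF that] by (force simp: e_def)+
      ultimately show "v a r \<le> c - e / 2" "v a (1 - r) \<le> c - e / 2" by linarith+
    qed
    have "u a1 x1 * exp (integral {0..a1} (\<lambda>_. 0)) \<le> W a1 x1 + (c - e / 2)"
    proof (rule heat_maximum_principle[OF sub[OF r(1,2)] d, where W="\<lambda>a x. W a x + (c - e / 2)"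
          and Wx="\<lambda>a x. 2 * \<kappa> * (x - 1 / 2)" and Wxx="\<lambda>a x. 2 * \<kappa>" and Wa="\<lambda>a x. 2 * \<kappa> * d" and M=0])
      show "((\<lambda>x. W a x + (c - e / 2)) has_real_derivative 2 * \<kappa> * (x - 1 / 2)) (at x)" for a x
        unfolding W_def by (auto intro!: derivative_eq_intros simp: power2_eq_square algebra_simps)
      show "((\<lambda>a. W a x + (c - e / 2)) has_real_derivative 2 * \<kappa> * d) (at a)" for a x
        unfolding W_def by (auto intro!: derivative_eq_intros simp: algebra_simps)
      show "((\<lambda>x. 2 * \<kappa> * (x - 1 / 2)) has_real_derivative 2 * \<kappa>) (at x)" for x
        by (auto intro!: derivative_eq_intros)
      show "continuous_on ({0..b} \<times> {r..1 - r}) (\<lambda>(a, x). W a x + (c - e / 2))"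
        using cW unfolding split_beta by (intro continuous_intros)
      show "u 0 x \<le> W 0 x + (c - e / 2)" if "x \<in> {r..1 - r}" for x
      proof -
        have "e \<le> c" by (simp add: e_def)
        then show ?thesis using v0[of x] that r e by (simp add: v_def)
      qed
      show "u a r * exp (integral {0..a} (\<lambda>_. 0)) \<le> W a r + (c - e / 2)" if "a \<in> {0..b}" for a
        using near(1)[OF that] by (simp add: v_def)
      show "u a (1 - r) * exp (integral {0..a} (\<lambda>_. 0)) \<le> W a (1 - r) + (c - e / 2)" if "a \<in> {0..b}" for a
        using near(2)[OF that] by (simp add: v_def)
    qed (use a1 r in auto)
    then have "c \<le> c - e / 2" by (simp add: c_def v_def)
    then show False using e by simp
  qed
  then have "v a x \<le> 0" using max[OF ax] by simp
  then show ?thesis by (simp add: v_def W_def)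
qed

lemma equilibrium_nonneg_birth:
  assumes eq: "positive_equilibrium a_m \<beta> \<mu> f d u"
    and beta_nonneg: "\<forall>a\<in>ages a_m. \<forall>x\<in>{0..1}. 0 \<le> \<beta> a x" and x: "x \<in> {0<..<1}"
  shows "0 \<le> (LINT a:ages a_m|lebesgue. \<beta> a x * u a x)"
  unfolding set_lebesgue_integral_def
proof (rule Bochner_Integration.integral_nonneg)
  fix a
  have "0 < u a x" if "a \<in> ages a_m" using eq that x unfolding positive_equilibrium_def by auto
  then show "0 \<le> indicator (ages a_m) a *\<^sub>R (\<beta> a x * u a x)"
    using beta_nonneg x by (auto simp: indicator_def)
qed

text \<open>The birth law bounds the initial trace by \<open>L\<close>. Dropping the nonnegative
  mortality makes \<open>u\<close> a subsolution of the pure heat equation, so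
  \<open>neumann_comparison\<close> applies with mortality 0, and its slope \<kappa> is then sent to
  0.\<close>

lemma equilibrium_le:
  fixes u :: "real \<Rightarrow> real \<Rightarrow> real"
  assumes eq: "positive_equilibrium a_m \<beta> \<mu> f d u" and d: "0 < d"
    and b: "0 < b" "ereal b < a_m"
    and beta_nonneg: "\<forall>a\<in>ages a_m. \<forall>x\<in>{0..1}. 0 \<le> \<beta> a x"
    and mu_nonneg: "\<forall>a\<in>ages a_m. \<forall>x\<in>{0..1}. 0 \<le> \<mu> a x"
    and f_bdd: "\<And>x u. x \<in> {0..1} \<Longrightarrow> 0 \<le> u \<Longrightarrow> f x u \<le> L"
    and ax: "a \<in> {0..b}" "x \<in> {0..1}"
  shows "u a x \<le> L"
proof -
  note ag = ages_I[OF _ _ b(2)] and cu = equilibrium_continuous[OF eq b(2)]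
  have init1: "u 0 x \<le> L" if "x \<in> {0<..<1}" for x
  proof -
    have "u 0 x = f x (LINT a:ages a_m|lebesgue. \<beta> a x * u a x)"
      using eq that unfolding positive_equilibrium_def by blast
    then show ?thesis using f_bdd[of x] equilibrium_nonneg_birth[OF eq beta_nonneg that] that by auto
  qed
  \<comment> \<open>The birth law is available at interior points; continuity adds the two end
    points.\<close>
  have init: "u 0 x \<le> L" if "x \<in> {0..1}" for x
  proof -
    have c0: "continuous_on {0..1} (u 0)" using continuous_on_slice[OF cu] b by auto
    have "closure {0<..<1::real} = {0..1}" by simp
    then show ?thesis
      using continuous_le_on_closure[of "{0<..<1}" "u 0" x L] c0 init1 that by auto
  qed
  obtain ux where ux: "\<And>a x. a \<in> ages a_m \<Longrightarrow> x \<in> {0..1} \<Longrightarrow> (u a has_real_derivative ux a x) (at x within {0..1})"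
    "\<And>a x. a \<in> ages a_m \<Longrightarrow> x \<in> {0, 1} \<Longrightarrow> ux a x = 0"
    using eq unfolding positive_equilibrium_def by blast
  have ux0: "(u a has_real_derivative 0) (at x within {0..1})" if "a \<in> {0<..b}" "x \<in> {0, 1}" for a x
    using ux(1)[of a x] ux(2)[of a x] ag[of a] that by auto
  have sub: "heat_subsolution d (\<lambda>_. 0) b r (1 - r) u" if "0 < r" "r < 1 / 2" for r
  proof -
    have "heat_subsolution d (\<lambda>_. 0) b r (1 - r) (\<lambda>a x. 1 * u a x)"
      by (rule equilibrium_heat_subsolution[OF eq b, where M=0])
        (use that ag mu_nonneg in \<open>auto intro!: AE_I2\<close>)
    then show ?thesis by simp
  qed
  have "u a x \<le> L + e" if "e > 0" for e
  proof -
    define q where "q = (x - 1 / 2)\<^sup>2 + 2 * d * a"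
    have q: "q \<ge> 0" using d ax by (simp add: q_def)
    \<comment> \<open>The slope \<open>e / (q + 1)\<close> keeps the correction below
      \<open>e\<close>; adding 1 avoids dividing by zero.\<close>
    have "u a x \<le> L + e / (q + 1) * q"
      unfolding q_def by (rule neumann_comparison[OF d _ b(1) cu ux0 sub init ax])
        (use that q in \<open>auto simp: q_def\<close>)
    also have "\<dots> \<le> L + e" using q that by (simp add: field_simps)
    finally show ?thesis .
  qed
  then show ?thesis by (rule field_le_epsilon)
qed

section \<open>Comparison on small balls\<close>

lemma Linf_norm_AE:
  assumes "S \<in> sets lebesgue" "Linf_norm S g \<le> ereal C"
  shows "AE a in lebesgue. a \<in> S \<longrightarrow> \<bar>g a\<bar> \<le> C"
proof -
  have "AE a in lebesgue_on S. ereal \<bar>g a\<bar> \<le> Linf_norm S g"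
    unfolding Linf_norm_def by (rule esssup_AE)
  then have "AE a in lebesgue_on S. \<bar>g a\<bar> \<le> C"
    using assms(2) by (auto elim!: eventually_mono dest: order_trans)
  then show ?thesis using assms(1) by (simp add: AE_restrict_space_iff)
qed

lemma in_Linf_bound:
  assumes "S \<in> sets lebesgue" "in_Linf S g"
  obtains C where "0 < C" "AE a in lebesgue. a \<in> S \<longrightarrow> \<bar>g a\<bar> \<le> C"
proof -
  obtain C where C: "Linf_norm S g \<le> ereal C"
    using assms(2) by (cases "Linf_norm S g") (auto simp: in_Linf_def)
  also have "\<dots> \<le> ereal (\<bar>C\<bar> + 1)" by simp
  finally show ?thesis using Linf_norm_AE[OF assms(1)] by (intro that[of "\<bar>C\<bar> + 1"]) auto
qed

lemma cont_into_Linf_close: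
  assumes "cont_into_Linf S T F" "S \<in> sets lebesgue" "x0 \<in> T" "0 < \<eta>"
  obtains \<delta> where "0 < \<delta>"
    "\<And>x. x \<in> T \<Longrightarrow> \<bar>x - x0\<bar> < \<delta> \<Longrightarrow> AE a in lebesgue. a \<in> S \<longrightarrow> \<bar>F a x - F a x0\<bar> \<le> \<eta>"
proof -
  have "((\<lambda>y. Linf_norm S (\<lambda>a. F a y - F a x0)) \<longlongrightarrow> 0) (at x0 within T)"
    using assms(1,3) by (simp add: cont_into_Linf_def)
  then have "\<forall>\<^sub>F y in at x0 within T. Linf_norm S (\<lambda>a. F a y - F a x0) < ereal \<eta>"
    using assms(4) by (intro order_tendstoD) auto
  then obtain \<delta> where \<delta>: "\<delta> > 0" "\<And>y. y \<in> T \<Longrightarrow> y \<noteq> x0 \<Longrightarrow> \<bar>y - x0\<bar> < \<delta> \<Longrightarrow>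
     Linf_norm S (\<lambda>a. F a y - F a x0) < ereal \<eta>"
    by (auto simp: eventually_at dist_real_def)
  show ?thesis
  proof (rule that[OF \<delta>(1)])
    fix x assume x: "x \<in> T" "\<bar>x - x0\<bar> < \<delta>"
    show "AE a in lebesgue. a \<in> S \<longrightarrow> \<bar>F a x - F a x0\<bar> \<le> \<eta>"
    proof (cases "x = x0")
      case True
      then show ?thesis using assms(4) by simp
    next
      case False
      then show ?thesis using \<delta>(2)[OF x(1) _ x(2)] by (intro Linf_norm_AE[OF assms(2)]) auto
    qed
  qed
qed

text \<open>Truncation to \<open>[0, M]\<close> alters the values only on a null subset of
  \<open>S\<close>, yet gives bounds at every point. Borel measurability is what later allows
  composition with the age coordinate on the plane.\<close>

lemma in_Linf_borel_representative:
  assumes g: "in_Linf S g" and S: "S \<in> sets lebesgue" and nonneg: "\<And>a. a \<in> S \<Longrightarrow> 0 \<le> g a"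
  obtains m M where "m \<in> borel_measurable borel" "\<And>r. 0 \<le> m r" "\<And>r. m r \<le> M"
    "AE a in lebesgue. a \<in> S \<longrightarrow> m a = g a"
proof -
  obtain M where M: "0 < M" "AE a in lebesgue. a \<in> S \<longrightarrow> \<bar>g a\<bar> \<le> M"
    by (rule in_Linf_bound[OF S g])
  have "g \<in> borel_measurable (lebesgue_on S)" using g by (simp add: in_Linf_def)
  then have "(\<lambda>a. if a \<in> S then g a else 0) \<in> borel_measurable lebesgue"
    using S by (simp add: borel_measurable_if_I)
  from completion_ex_borel_measurable_real[OF this] obtain g' where
    g': "g' \<in> borel_measurable lborel" "AE a in lborel. (if a \<in> S then g a else 0) = g' a" by auto
  define m where "m a = max 0 (min M (g' a))" for a
  show ?thesis
  proof (rule that[of m M])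
    show "m \<in> borel_measurable borel" using g'(1) unfolding m_def[abs_def] by (intro borel_measurable_max borel_measurable_min) auto
    show "AE a in lebesgue. a \<in> S \<longrightarrow> m a = g a"
      using g'(2)[folded AE_completion_iff[of _ lborel]] M(2)
    proof eventually_elim
      case (elim a)
      then show ?case using nonneg[of a] by (auto simp: m_def)
    qed
  qed (use M(1) in \<open>auto simp: m_def\<close>)
qed

lemma in_Linf_times_continuous_integrable:
  assumes g: "in_Linf S g" and S: "S \<in> sets lebesgue" "{0<..<c} \<subseteq> S" and h: "continuous_on {0..c} h"
  shows "set_integrable lebesgue {0<..<c} (\<lambda>a. g a * h a :: real)"
proof -
  obtain C where C: "0 < C" "AE a in lebesgue. a \<in> S \<longrightarrow> \<bar>g a\<bar> \<le> C"
    by (rule in_Linf_bound[OF S(1) g])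
  obtain D where D: "0 < D" "\<And>r. r \<in> {0..c} \<Longrightarrow> \<bar>h r\<bar> \<le> D"
    by (rule continuous_on_Icc_abs_bound[OF h], rule that, assumption+)
  have gm: "g \<in> borel_measurable (lebesgue_on {0<..<c})"
    using g S(2) by (intro measurable_restrict_mono[OF _ S(2)]) (simp add: in_Linf_def)
  have hm: "h \<in> borel_measurable (lebesgue_on {0<..<c})"
    by (intro continuous_imp_measurable_on_sets_lebesgue continuous_on_subset[OF h]) auto
  have "integrable (lebesgue_on {0<..<c}) (\<lambda>a. g a * h a)"
  proof (rule Bochner_Integration.integrable_bound)
    show "integrable (lebesgue_on {0<..<c}) (\<lambda>a. C * D)"
      by (rule finite_measure.integrable_const) (simp add: finite_measure_lebesgue_on)
    show "(\<lambda>a. g a * h a) \<in> borel_measurable (lebesgue_on {0<..<c})"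
      by (intro borel_measurable_times gm hm)
    have "AE a in lebesgue. a \<in> {0<..<c} \<longrightarrow> norm (g a * h a) \<le> norm (C * D)"
      using C(2)
    proof eventually_elim
      case (elim a)
      show ?case
      proof
        assume a: "a \<in> {0<..<c}"
        have "\<bar>g a\<bar> * \<bar>h a\<bar> \<le> C * D" using elim D a S(2) C(1) by (intro mult_mono) auto
        then show "norm (g a * h a) \<le> norm (C * D)" using C(1) D(1) by (simp add: abs_mult)
      qed
    qed
    then show "AE a in lebesgue_on {0<..<c}. norm (g a * h a) \<le> norm (C * D)"
      by (simp add: AE_restrict_space_iff)
  qed
  then show ?thesis by (simp add: set_integrable_def integrable_restrict_space)
qed

lemma set_integral_AE_eq_integral:
  fixes m g :: "real \<Rightarrow> real"
  assumes m: "m \<in> borel_measurable borel" "\<And>r. \<bar>m r\<bar> \<le> M"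
    and ae: "AE a in lebesgue. a \<in> {0<..<b} \<longrightarrow> m a = g a" and a: "0 \<le> a" "a \<le> b"
  shows "(LINT s:{0<..<a}|lebesgue. g s) = integral {0..a} m"
proof -
  have m1: "m \<in> borel_measurable lebesgue" using m(1) by (intro measurable_completion) simp
  have "m absolutely_integrable_on {0..a}"
    using bounded_times_continuous_integrable[OF m, of 0 a "\<lambda>_. 1"] by simp
  then have i: "set_integrable lebesgue {0<..<a} m"
    by (rule set_integrable_subset) auto
  have ae': "AE s in lebesgue. indicator {0<..<a} s *\<^sub>R g s = indicator {0<..<a} s *\<^sub>R m s"
    using ae by eventually_elim (use a in \<open>auto simp: indicator_def\<close>)
  have im: "(\<lambda>s. indicator {0<..<a} s *\<^sub>R m s) \<in> borel_measurable lebesgue"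
    using i by (auto simp: set_integrable_def dest: borel_measurable_integrable)
  have ig: "(\<lambda>s. indicator {0<..<a} s *\<^sub>R g s) \<in> borel_measurable lebesgue"
  proof (rule borel_measurable_AE[OF im])
    show "AE s in lebesgue. indicator {0<..<a} s *\<^sub>R m s = indicator {0<..<a} s *\<^sub>R g s"
      using ae' by eventually_elim (rule sym)
  qed
  have "(LINT s:{0<..<a}|lebesgue. g s) = (LINT s:{0<..<a}|lebesgue. m s)"
    unfolding set_lebesgue_integral_def by (rule integral_cong_AE[OF ig im ae'])
  also have "\<dots> = integral {0<..<a} m" by (rule set_lebesgue_integral_eq_integral(2)[OF i])
  finally show ?thesis by (simp add: integral_open_interval_real)
qed

lemma integrating_factor_shift:
  fixes m :: "real \<Rightarrow> real"
  assumes "m \<in> borel_measurable borel" "\<And>r. \<bar>m r\<bar> \<le> M" "0 \<le> a"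
  shows "integral {0..a} (\<lambda>r. m r + c) = integral {0..a} m + c * a"
proof -
  have "m absolutely_integrable_on {0..a}"
    using bounded_times_continuous_integrable[OF assms(1,2), of 0 a "\<lambda>_. 1"] by simp
  then have "m integrable_on {0..a}" by (rule set_lebesgue_integral_eq_integral)
  from hk_integral_add[OF this integrable_const_ivl[of c]]
  show ?thesis using assms(3) by (simp add: mult.commute)
qed

lemma integral_nonneg_bounded:
  fixes m :: "real \<Rightarrow> real"
  assumes "m \<in> borel_measurable borel" "\<And>r. 0 \<le> m r" "\<And>r. m r \<le> M" "0 \<le> a" "a \<le> b"
  shows "0 \<le> integral {0..a} m" "integral {0..a} m \<le> M * b"
proof -
  have M: "\<And>r. \<bar>m r\<bar> \<le> M" using assms(2,3) by simp
  have "m absolutely_integrable_on {0..a}"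
    using bounded_times_continuous_integrable[OF assms(1) M, of 0 a "\<lambda>_. 1"] by simp
  then have i: "m integrable_on {0..a}" by (rule set_lebesgue_integral_eq_integral)
  show "0 \<le> integral {0..a} m"
    by (rule Henstock_Kurzweil_Integration.integral_nonneg[OF i assms(2)])
  have "0 \<le> M" using assms(2,3) order_trans by blast
  have "integral {0..a} m \<le> integral {0..a} (\<lambda>_. M)"
    by (rule integral_le[OF i]) (auto simp: assms)
  also have "\<dots> \<le> M * b" using assms(4,5) \<open>0 \<le> M\<close> by (simp add: mult.commute mult_left_mono)
  finally show "integral {0..a} m \<le> M * b" .
qed

text \<open>The barrier \<open>\<Theta> * exp (d * k^2 * a) * cosh (k * (x - x0))\<close> solves the
  heat equation, and the mortality is lowered to \<open>m - \<eta>\<close>; \<open>q\<close> absorbs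
  the growth of the barrier and the factor \<open>exp (\<eta> * a)\<close>. On the sides
  \<open>lat\<close> lets the barrier beat the crude bound \<open>L\<close>, even after
  multiplication by the integrating factor.\<close>

lemma equilibrium_upper_comparison:
  fixes u :: "real \<Rightarrow> real \<Rightarrow> real"
  assumes eq: "positive_equilibrium a_m \<beta> \<mu> f d u" and d: "0 < d"
    and b: "0 < b" "ereal b < a_m"
    and B: "0 < x0 - \<delta>" "0 < \<delta>" "x0 + \<delta> < 1"
    and m: "m \<in> borel_measurable borel" "\<And>r. 0 \<le> m r" "\<And>r. m r \<le> M"
    and \<eta>: "0 \<le> \<eta>"
    and cmp: "\<And>x. x \<in> {x0 - \<delta>..x0 + \<delta>} \<Longrightarrow> AE a in lebesgue. a \<in> {0<..<b} \<longrightarrow> m a - \<eta> \<le> \<mu> a x"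
    and L: "\<And>a x. a \<in> {0..b} \<Longrightarrow> x \<in> {0..1} \<Longrightarrow> u a x \<le> L" "0 \<le> L"
    and lat: "L * exp (M * b) \<le> \<Theta> * cosh (k * \<delta>)"
    and q: "exp (d * k\<^sup>2 * b + \<eta> * b) \<le> q"
    and init: "\<And>x. x \<in> {x0 - \<delta>..x0 + \<delta>} \<Longrightarrow> u 0 x \<le> \<Theta> * cosh (k * (x - x0))"
    and \<Theta>: "0 \<le> \<Theta>" and a: "a \<in> {0..b}" and x: "x \<in> {x0 - \<delta>..x0 + \<delta>}"
  shows "u a x \<le> \<Theta> * q * cosh (k * (x - x0)) * exp (- integral {0..a} m)"
proof -
  have M: "\<bar>m r\<bar> \<le> M" for r using m(2,3)[of r] by auto
  define m' where "m' r = m r + (- \<eta>)" for r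
  have mb: "m' \<in> borel_measurable borel" "\<bar>m' r\<bar> \<le> M + \<eta>" for r
    using m(1) M[of r] \<eta> unfolding m'_def[abs_def] by (simp, linarith)
  have E: "integral {0..a} m' = integral {0..a} m - \<eta> * a" if "0 \<le> a" for a
    using integrating_factor_shift[OF m(1) M that, of "- \<eta>"] by (simp add: m'_def[abs_def])
  define W where "W a x = \<Theta> * exp (d * k\<^sup>2 * a) * cosh (k * (x - x0))" for a x
  have sub: "heat_subsolution d m' b (x0 - \<delta>) (x0 + \<delta>) (\<lambda>a x. 1 * u a x)"
    by (rule equilibrium_heat_subsolution[OF eq b _ _ _ mb]) (use B cmp in \<open>auto simp: m'_def\<close>)
  have lateral: "u a y * exp (integral {0..a} m') \<le> W a y"
    if a: "a \<in> {0..b}" and y: "y = x0 - \<delta> \<or> y = x0 + \<delta>" for a y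
  proof -
    have "integral {0..a} m' \<le> M * b"
    proof -
      have "0 \<le> \<eta> * a" using a \<eta> by simp
      then show ?thesis using a E[of a] integral_nonneg_bounded(2)[OF m, of a b] by auto
    qed
    then have "u a y * exp (integral {0..a} m') \<le> L * exp (M * b)"
      using a y B L by (intro mult_mono) auto
    also have "\<dots> \<le> \<Theta> * cosh (k * \<delta>)" by (rule lat)
    also have "\<dots> \<le> W a y"
    proof -
      have c: "cosh (k * (y - x0)) = cosh (k * \<delta>)" using y by auto
      have "1 \<le> exp (d * k\<^sup>2 * a)" using d a by simp
      from mult_left_mono[OF this \<Theta>] have "\<Theta> * cosh (k * \<delta>) \<le> \<Theta> * exp (d * k\<^sup>2 * a) * cosh (k * \<delta>)"
        by (intro mult_right_mono) auto
      then show ?thesis unfolding W_def c .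
    qed
    finally show ?thesis .
  qed
  have "1 * u a x * exp (integral {0..a} m') \<le> W a x"
  proof (rule heat_maximum_principle[OF sub d, where M="M + \<eta>" and W=W
        and Wx="\<lambda>a x. \<Theta> * exp (d * k\<^sup>2 * a) * (k * sinh (k * (x - x0)))"
        and Wxx="\<lambda>a x. \<Theta> * exp (d * k\<^sup>2 * a) * (k\<^sup>2 * cosh (k * (x - x0)))"
        and Wa="\<lambda>a x. d * k\<^sup>2 * W a x"])
    show "m' \<in> borel_measurable (lebesgue_on {0..b})"
      using mb(1) by (intro measurable_restrict_space1 measurable_completion) simp
    show "(W a has_real_derivative \<Theta> * exp (d * k\<^sup>2 * a) * (k * sinh (k * (x - x0)))) (at x)" for a x
      unfolding W_def[abs_def] by (auto intro!: derivative_eq_intros)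
    show "((\<lambda>x. \<Theta> * exp (d * k\<^sup>2 * a) * (k * sinh (k * (x - x0)))) has_real_derivative
       \<Theta> * exp (d * k\<^sup>2 * a) * (k\<^sup>2 * cosh (k * (x - x0)))) (at x)" for a x
      by (auto intro!: derivative_eq_intros simp: power2_eq_square)
    show "((\<lambda>a. W a x) has_real_derivative d * k\<^sup>2 * W a x) (at a)" for a x
      unfolding W_def by (auto intro!: derivative_eq_intros)
    show "continuous_on ({0..b} \<times> {x0 - \<delta>..x0 + \<delta>}) (case_prod W)"
      unfolding W_def split_beta by (intro continuous_intros)
    show "1 * u 0 x \<le> W 0 x" if "x \<in> {x0 - \<delta>..x0 + \<delta>}" for x using init[OF that] by (simp add: W_def)
    show "d * (\<Theta> * exp (d * k\<^sup>2 * a) * (k\<^sup>2 * cosh (k * (x - x0)))) \<le> d * k\<^sup>2 * W a x" for a x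
      by (simp add: W_def mult_ac)
  qed (use lateral mb(2) a x in auto)
  then have "u a x * (exp (integral {0..a} m) * exp (- \<eta> * a)) \<le> \<Theta> * exp (d * k\<^sup>2 * a) * cosh (k * (x - x0))"
    using a by (simp add: E W_def flip: exp_add)
  then have "u a x \<le> \<Theta> * exp (d * k\<^sup>2 * a) * cosh (k * (x - x0)) * (exp (- integral {0..a} m) * exp (\<eta> * a))"
    by (simp add: exp_minus field_simps)
  also have "\<dots> = \<Theta> * exp (d * k\<^sup>2 * a + \<eta> * a) * cosh (k * (x - x0)) * exp (- integral {0..a} m)"
    by (simp add: exp_add mult_ac)
  also have "\<dots> \<le> \<Theta> * q * cosh (k * (x - x0)) * exp (- integral {0..a} m)"
  proof -
    have "exp (d * k\<^sup>2 * a + \<eta> * a) \<le> exp (d * k\<^sup>2 * b + \<eta> * b)"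
      using a d \<eta> by (auto intro!: add_mono mult_left_mono)
    then have "exp (d * k\<^sup>2 * a + \<eta> * a) \<le> q" using q by (rule order_trans)
    then show ?thesis using \<Theta> by (intro mult_right_mono mult_left_mono) auto
  qed
  finally show ?thesis .
qed

text \<open>The maximum principle is applied to \<open>- u\<close> with the raised mortality
  \<open>m + \<eta>\<close>. Since \<open>k * \<delta> = pi / 2\<close>, the barrier vanishes on the
  sides, where positivity of \<open>u\<close> is all that is required, and is nonnegative between
  them.\<close>

lemma equilibrium_lower_comparison:
  fixes u :: "real \<Rightarrow> real \<Rightarrow> real"
  assumes eq: "positive_equilibrium a_m \<beta> \<mu> f d u" and d: "0 < d"
    and b: "0 < b" "ereal b < a_m"
    and B: "0 < x0 - \<delta>" "0 < \<delta>" "x0 + \<delta> < 1"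
    and m: "m \<in> borel_measurable borel" "\<And>r. 0 \<le> m r" "\<And>r. m r \<le> M"
    and \<eta>: "0 \<le> \<eta>"
    and cmp: "\<And>x. x \<in> {x0 - \<delta>..x0 + \<delta>} \<Longrightarrow> AE a in lebesgue. a \<in> {0<..<b} \<longrightarrow> \<mu> a x \<le> m a + \<eta>"
    and k: "k * \<delta> = pi / 2"
    and q: "exp (d * k\<^sup>2 * b + \<eta> * b) \<le> q"
    and init: "\<And>x. x \<in> {x0 - \<delta>..x0 + \<delta>} \<Longrightarrow> \<Theta> * cos (k * (x - x0)) \<le> u 0 x"
    and \<Theta>: "0 \<le> \<Theta>" and a: "a \<in> {0..b}" and x: "x \<in> {x0 - \<delta>..x0 + \<delta>}"
  shows "\<Theta> / q * cos (k * (x - x0)) * exp (- integral {0..a} m) \<le> u a x"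
proof -
  have M: "\<bar>m r\<bar> \<le> M" for r using m(2,3)[of r] by auto
  define m' where "m' r = m r + \<eta>" for r
  have mb: "m' \<in> borel_measurable borel" "\<bar>m' r\<bar> \<le> M + \<eta>" for r
    using m(1) M[of r] \<eta> unfolding m'_def[abs_def] by (simp, linarith)
  have E: "integral {0..a} m' = integral {0..a} m + \<eta> * a" if "0 \<le> a" for a
    using integrating_factor_shift[OF m(1) M that, of "\<eta>"] by (simp add: m'_def[abs_def])
  note upos = equilibrium_pos[OF eq b(2)]
  have cosnn: "0 \<le> cos (k * (x - x0))" if "x \<in> {x0 - \<delta>..x0 + \<delta>}" for x
  proof -
    have "k > 0" using k B(2) pi_gt_zero by (metis divide_pos_pos zero_less_mult_pos2 zero_less_numeral)
    then have "\<bar>k * (x - x0)\<bar> \<le> k * \<delta>" using that by (auto simp: abs_mult intro!: mult_left_mono)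
    then show ?thesis unfolding k by (intro cos_ge_zero) (auto simp: abs_le_iff)
  qed
  define W where "W a x = - (\<Theta> * exp (- (d * k\<^sup>2 * a)) * cos (k * (x - x0)))" for a x
  have cmp': "AE a in lebesgue. a \<in> {0<..<b} \<longrightarrow> m' a * (-1) \<le> (-1) * \<mu> a x" if "x \<in> {x0 - \<delta>..x0 + \<delta>}" for x
    using cmp[OF that] by eventually_elim (auto simp: m'_def)
  have sub: "heat_subsolution d m' b (x0 - \<delta>) (x0 + \<delta>) (\<lambda>a x. (-1) * u a x)"
    using B by (intro equilibrium_heat_subsolution[OF eq b _ _ _ mb cmp']) auto
  have lateral: "(-1) * u a y * exp (integral {0..a} m') \<le> W a y"
    if a: "a \<in> {0..b}" and y: "y = x0 - \<delta> \<or> y = x0 + \<delta>" for a y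
  proof -
    have "cos (k * (y - x0)) = 0" 
    proof -
      have "k * (y - x0) = - (pi / 2) \<or> k * (y - x0) = pi / 2"
        using y k by (auto simp: algebra_simps)
      then show ?thesis by (auto simp only: cos_minus cos_pi_half)
    qed
    moreover have "0 < u a y" using a y B by (intro upos) auto
    ultimately show ?thesis by (simp add: W_def)
  qed
  have "(-1) * u a x * exp (integral {0..a} m') \<le> W a x"
  proof (rule heat_maximum_principle[OF sub d, where M="M + \<eta>" and W=W
        and Wx="\<lambda>a x. \<Theta> * exp (- (d * k\<^sup>2 * a)) * (k * sin (k * (x - x0)))"
        and Wxx="\<lambda>a x. \<Theta> * exp (- (d * k\<^sup>2 * a)) * (k\<^sup>2 * cos (k * (x - x0)))"
        and Wa="\<lambda>a x. - (d * k\<^sup>2) * W a x"])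
    show "m' \<in> borel_measurable (lebesgue_on {0..b})"
      using mb(1) by (intro measurable_restrict_space1 measurable_completion) simp
    show "(W a has_real_derivative \<Theta> * exp (- (d * k\<^sup>2 * a)) * (k * sin (k * (x - x0)))) (at x)" for a x
      unfolding W_def[abs_def] by (auto intro!: derivative_eq_intros)
    show "((\<lambda>x. \<Theta> * exp (- (d * k\<^sup>2 * a)) * (k * sin (k * (x - x0)))) has_real_derivative
       \<Theta> * exp (- (d * k\<^sup>2 * a)) * (k\<^sup>2 * cos (k * (x - x0)))) (at x)" for a x
      by (auto intro!: derivative_eq_intros simp: power2_eq_square)
    show "((\<lambda>a. W a x) has_real_derivative - (d * k\<^sup>2) * W a x) (at a)" for a x
      unfolding W_def by (auto intro!: derivative_eq_intros)
    show "continuous_on ({0..b} \<times> {x0 - \<delta>..x0 + \<delta>}) (case_prod W)"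
      unfolding W_def split_beta by (intro continuous_intros)
    show "(-1) * u 0 x \<le> W 0 x" if "x \<in> {x0 - \<delta>..x0 + \<delta>}" for x using init[OF that] by (simp add: W_def)
    show "d * (\<Theta> * exp (- (d * k\<^sup>2 * a)) * (k\<^sup>2 * cos (k * (x - x0)))) \<le> - (d * k\<^sup>2) * W a x" for a x
      by (simp add: W_def mult_ac)
  qed (use lateral mb(2) a x in auto)
  then have "\<Theta> * exp (- (d * k\<^sup>2 * a)) * cos (k * (x - x0)) \<le> u a x * (exp (integral {0..a} m) * exp (\<eta> * a))"
    using a by (simp add: E W_def exp_add)
  then have *: "\<Theta> * exp (- (d * k\<^sup>2 * a)) * cos (k * (x - x0)) * exp (- integral {0..a} m) * exp (- (\<eta> * a)) \<le> u a x"
    by (simp add: exp_minus field_simps)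
  have "\<Theta> / q * cos (k * (x - x0)) * exp (- integral {0..a} m) \<le>
     \<Theta> * exp (- (d * k\<^sup>2 * a + \<eta> * a)) * cos (k * (x - x0)) * exp (- integral {0..a} m)"
  proof -
    have "exp (d * k\<^sup>2 * a + \<eta> * a) \<le> exp (d * k\<^sup>2 * b + \<eta> * b)"
      using a d \<eta> by (auto intro!: add_mono mult_left_mono)
    then have "exp (d * k\<^sup>2 * a + \<eta> * a) \<le> q" using q by (rule order_trans)
    then have "1 / q \<le> exp (- (d * k\<^sup>2 * a + \<eta> * a))"
      unfolding exp_minus inverse_eq_divide by (intro frac_le) auto
    from mult_left_mono[OF this \<Theta>]
    show ?thesis using cosnn[OF x] by (intro mult_right_mono) auto
  qed
  also have "\<dots> = \<Theta> * exp (- (d * k\<^sup>2 * a)) * cos (k * (x - x0)) * exp (- integral {0..a} m) * exp (- (\<eta> * a))"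
    by (simp add: exp_add exp_diff exp_minus field_simps)
  finally show ?thesis using * by linarith
qed

section \<open>Birth integrals and sublinearity of the birth law\<close>

lemma ages_measurable: "ages a_m \<in> sets lebesgue"
proof -
  have "ages a_m = {0<..} \<inter> ereal -` {..<a_m}" by (auto simp: ages_def)
  moreover have "open ({0<..} \<inter> ereal -` {..<a_m})"
    by (intro open_Int open_ereal_vimage) auto
  ultimately show ?thesis by (simp add: borel_open sets_completionI_sets)
qed

lemma ages_Ioo_subset: "ereal b < a_m \<Longrightarrow> {0<..<b} \<subseteq> ages a_m"
  by (auto simp: ages_def intro: less_trans[of "ereal _" "ereal b"])

lemma set_integral_Ioo_const: "0 \<le> c \<Longrightarrow> (LINT a:{0<..<c}|lebesgue. (C::real)) = C * c"
  "set_integrable lebesgue {0<..<c} (\<lambda>a. C::real)"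
proof -
  show i: "set_integrable lebesgue {0<..<c} (\<lambda>a. C::real)"
    by (rule set_integrable_subset[OF absolutely_integrable_continuous_real[of 0 c "\<lambda>a. C"]]) auto
  assume "0 \<le> c"
  then show "(LINT a:{0<..<c}|lebesgue. (C::real)) = C * c"
    using set_lebesgue_integral_eq_integral(2)[OF i] integral_open_interval_real[of 0 c "\<lambda>_. C"]
    by (simp add: mult.commute)
qed

text \<open>Exchanging \<open>\<beta> a x\<close> for \<open>\<beta> a x0\<close> costs at most
  \<open>C * \<eta>\<close> at each age, because \<open>h \<le> 1\<close>, and only ages below
  \<open>a_c\<close> contribute.\<close>

lemma birth_integral_bounds:
  fixes \<beta> :: "real \<Rightarrow> real \<Rightarrow> real" and w h :: "real \<Rightarrow> real"
  assumes g: "in_Linf (ages a_m) (\<lambda>a. \<beta> a x)" "in_Linf (ages a_m) (\<lambda>a. \<beta> a x0)"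
    and pos: "\<And>a. a \<in> ages a_m \<Longrightarrow> 0 \<le> \<beta> a x"
    and zero: "\<And>a. a_c \<le> a \<Longrightarrow> ereal a < a_m \<Longrightarrow> \<beta> a x = 0"
    and a_c: "0 < a_c" "ereal a_c < a_m"
    and close: "AE a in lebesgue. a \<in> ages a_m \<longrightarrow> \<bar>\<beta> a x - \<beta> a x0\<bar> \<le> \<eta>"
    and cont: "continuous_on {0..a_c} w" "continuous_on {0..a_c} h"
    and h: "\<And>a. a \<in> {0..a_c} \<Longrightarrow> 0 \<le> h a" "\<And>a. a \<in> {0..a_c} \<Longrightarrow> h a \<le> 1"
    and C: "0 \<le> C" and \<eta>: "0 \<le> \<eta>"
  defines "K \<equiv> (LINT a:{0<..<a_c}|lebesgue. \<beta> a x0 * h a)"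
    and "J \<equiv> (LINT a:ages a_m|lebesgue. \<beta> a x * w a)"
  shows "(\<And>a. a \<in> {0..a_c} \<Longrightarrow> w a \<le> C * h a) \<Longrightarrow> J \<le> C * (K + \<eta> * a_c)"
    "(\<And>a. a \<in> {0..a_c} \<Longrightarrow> C * h a \<le> w a) \<Longrightarrow> C * (K - \<eta> * a_c) \<le> J"
proof -
  note sub = ages_Ioo_subset[OF a_c(2)]
  have J: "J = (LINT a:{0<..<a_c}|lebesgue. \<beta> a x * w a)"
    unfolding J_def using sub zero
    by (intro set_integral_restrict_support) (auto simp: ages_def not_less)
  have iJ: "set_integrable lebesgue {0<..<a_c} (\<lambda>a. \<beta> a x * w a)"
    by (rule in_Linf_times_continuous_integrable[OF g(1) ages_measurable sub cont(1)])
  have iK: "set_integrable lebesgue {0<..<a_c} (\<lambda>a. \<beta> a x0 * h a)"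
    by (rule in_Linf_times_continuous_integrable[OF g(2) ages_measurable sub cont(2)])
  note ic = set_integral_Ioo_const[of a_c "C * \<eta>"]
  have iCK: "set_integrable lebesgue {0<..<a_c} (\<lambda>a. C * (\<beta> a x0 * h a))"
    using iK by simp
  show "J \<le> C * (K + \<eta> * a_c)" if w: "\<And>a. a \<in> {0..a_c} \<Longrightarrow> w a \<le> C * h a"
  proof -
    have "J \<le> (LINT a:{0<..<a_c}|lebesgue. C * (\<beta> a x0 * h a) + C * \<eta>)"
      unfolding J
    proof (rule set_integral_mono_AE[OF iJ set_integral_add(1)[OF iCK ic(2)]])
      show "AE a in lebesgue. a \<in> {0<..<a_c} \<longrightarrow> \<beta> a x * w a \<le> C * (\<beta> a x0 * h a) + C * \<eta>"
        using close
      proof eventually_elim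
        case (elim a)
        show ?case
        proof
          assume a: "a \<in> {0<..<a_c}"
          then have am: "a \<in> ages a_m" using sub by auto
          have "\<beta> a x * w a \<le> \<beta> a x * (C * h a)" using a by (intro mult_left_mono w pos am) auto
          also have "\<dots> \<le> (\<beta> a x0 + \<eta>) * (C * h a)"
            using elim am C h(1)[of a] a by (intro mult_right_mono) (auto simp: abs_le_iff)
          also have "\<dots> = C * (\<beta> a x0 * h a) + (C * \<eta>) * h a" by (simp add: algebra_simps)
          also have "(C * \<eta>) * h a \<le> C * \<eta>" using h(2)[of a] a C \<eta> by (intro mult_left_le) auto
          finally show "\<beta> a x * w a \<le> C * (\<beta> a x0 * h a) + C * \<eta>" by simp
        qed
      qed
    qed
    also have "\<dots> = C * K + C * \<eta> * a_c"
      unfolding set_integral_add(2)[OF iCK ic(2)] using a_c by (subst ic(1)) (auto simp: K_def)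
    also have "\<dots> = C * (K + \<eta> * a_c)" by (simp add: algebra_simps)
    finally show ?thesis .
  qed
  show "C * (K - \<eta> * a_c) \<le> J" if w: "\<And>a. a \<in> {0..a_c} \<Longrightarrow> C * h a \<le> w a"
  proof -
    have "C * (K - \<eta> * a_c) = C * K - C * \<eta> * a_c" by (simp add: algebra_simps)
    also have "\<dots> = (LINT a:{0<..<a_c}|lebesgue. C * (\<beta> a x0 * h a) - C * \<eta>)"
      unfolding set_integral_diff(2)[OF iCK ic(2)] using a_c by (subst ic(1)) (auto simp: K_def)
    also have "\<dots> \<le> J"
      unfolding J
    proof (rule set_integral_mono_AE[OF set_integral_diff(1)[OF iCK ic(2)] iJ])
      show "AE a in lebesgue. a \<in> {0<..<a_c} \<longrightarrow> C * (\<beta> a x0 * h a) - C * \<eta> \<le> \<beta> a x * w a"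
        using close
      proof eventually_elim
        case (elim a)
        show ?case
        proof
          assume a: "a \<in> {0<..<a_c}"
          then have am: "a \<in> ages a_m" using sub by auto
          have "(C * \<eta>) * h a \<le> C * \<eta>" using h(2)[of a] a C \<eta> by (intro mult_left_le) auto
          then have "C * (\<beta> a x0 * h a) - C * \<eta> \<le> (\<beta> a x0 - \<eta>) * (C * h a)" by (simp add: algebra_simps)
          also have "\<dots> \<le> \<beta> a x * (C * h a)"
            using elim am C h(1)[of a] a by (intro mult_right_mono) (auto simp: abs_le_iff)
          also have "\<dots> \<le> \<beta> a x * w a" using a by (intro mult_left_mono w pos am) auto
          finally show "C * (\<beta> a x0 * h a) - C * \<eta> \<le> \<beta> a x * w a" .
        qed
      qed
    qed
    finally show ?thesis .
  qed
qed

text \<open>For \<open>\<kappa> > 0\<close>, \<open>g (\<kappa> * s) < s\<close> means that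
  \<open>g u / u\<close> is below \<open>1 / \<kappa>\<close> at \<open>u = \<kappa> * s\<close>.
  The quotient decreases, so this passes to larger arguments and the reverse inequality to smaller
  ones. In the case \<open>\<kappa> = 0\<close> the value \<open>g 0 = 0\<close> decides.\<close>

lemma sublinear_scaling:
  fixes g :: "real \<Rightarrow> real"
  assumes g0: "g 0 = 0" and anti: "strict_antimono_on {0<..} (\<lambda>u. g u / u)" and \<kappa>: "0 \<le> \<kappa>"
    and sS: "0 < s" "s \<le> S"
  shows "g (\<kappa> * s) < s \<Longrightarrow> g (\<kappa> * S) < S" "S < g (\<kappa> * S) \<Longrightarrow> s < g (\<kappa> * s)"
proof -
  have S: "0 < S" using sS by simp
  have q: "g (\<kappa> * S) / (\<kappa> * S) \<le> g (\<kappa> * s) / (\<kappa> * s)" if "\<kappa> > 0"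
  proof (cases "s = S")
    case False
    then have "\<kappa> * s < \<kappa> * S" using sS that by simp
    then show ?thesis using monotone_onD[OF anti, of "\<kappa> * s" "\<kappa> * S"] sS S that by simp
  qed simp
  show "g (\<kappa> * S) < S" if "g (\<kappa> * s) < s"
  proof (cases "\<kappa> = 0")
    case False
    then have k: "\<kappa> > 0" using \<kappa> by simp
    have "g (\<kappa> * s) / (\<kappa> * s) < 1 / \<kappa>" using that sS k by (simp add: divide_simps)
    then have "g (\<kappa> * S) / (\<kappa> * S) < 1 / \<kappa>" using q[OF k] by simp
    then show ?thesis using S k by (simp add: divide_simps)
  qed (use g0 S in simp)
  show "s < g (\<kappa> * s)" if "S < g (\<kappa> * S)"
  proof (cases "\<kappa> = 0")
    case False
    then have k: "\<kappa> > 0" using \<kappa> by simp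
    have "1 / \<kappa> < g (\<kappa> * S) / (\<kappa> * S)" using that S k by (simp add: divide_simps)
    then have "1 / \<kappa> < g (\<kappa> * s) / (\<kappa> * s)" using q[OF k] by simp
    then show ?thesis using sS k by (simp add: divide_simps)
  qed (use that g0 S in simp)
qed

section \<open>The problem at one point \<open>x0\<close>, with a Borel representative
  \<open>m\<close> of the mortality there\<close>

locale local_problem =
  fixes a_m :: ereal and a_c b :: real and \<beta> \<mu> f :: "real \<Rightarrow> real \<Rightarrow> real"
    and x0 M L :: real and m :: "real \<Rightarrow> real"
  assumes a_c: "0 < a_c" "a_c \<le> b" and b: "ereal b < a_m"
    and beta_nonneg: "\<forall>a\<in>ages a_m. \<forall>x\<in>{0..1}. 0 \<le> \<beta> a x"
    and beta_cont: "cont_into_Linf (ages a_m) {0..1} \<beta>"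
    and beta_zero: "\<forall>a x. a_c \<le> a \<and> ereal a < a_m \<and> x \<in> {0..1} \<longrightarrow> \<beta> a x = 0"
    and mu_nonneg: "\<forall>a\<in>ages a_m. \<forall>x\<in>{0..1}. 0 \<le> \<mu> a x"
    and mu_cont: "cont_into_Linf {0<..<b} {0..1} \<mu>"
    and f_cont: "continuous_on ({0..1} \<times> {0..}) (case_prod f)"
    and f_mono: "\<And>x u v. x \<in> {0..1} \<Longrightarrow> 0 \<le> u \<Longrightarrow> u \<le> v \<Longrightarrow> f x u \<le> f x v"
    and f_zero: "\<And>x. x \<in> {0..1} \<Longrightarrow> f x 0 = 0"
    and f_quot: "\<And>x. x \<in> {0..1} \<Longrightarrow> strict_antimono_on {0<..} (\<lambda>u. f x u / u)"
    and f_bdd: "\<And>x u. x \<in> {0..1} \<Longrightarrow> 0 \<le> u \<Longrightarrow> f x u \<le> L" and L: "0 < L"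
    and x0: "x0 \<in> {0<..<1}"
    and m: "m \<in> borel_measurable borel" "\<And>r. 0 \<le> m r" "\<And>r. m r \<le> M"
    and m_mu: "AE a in lebesgue. a \<in> {0<..<b} \<longrightarrow> m a = \<mu> a x0"
begin

definition survival :: "real \<Rightarrow> real" where
  "survival a = exp (- integral {0..a} m)"

text \<open>The constant \<open>K\<close> of the overview; the threshold \<open>Gam\<close> at
  \<open>x0\<close> is \<open>partial_u f x0 0\<close> times this number.\<close>

definition offspring :: real where
  "offspring = (LINT a:{0<..<a_c}|lebesgue. \<beta> a x0 * survival a)"

lemma b_pos: "0 < b" using a_c by simp

lemma a_c_lt: "ereal a_c < a_m" using a_c(2) b by (meson ereal_less_eq(3) le_less_trans)

lemma m_abs: "\<bar>m r\<bar> \<le> M" using m(2,3)[of r] by auto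

lemma m_lebesgue_on: "m \<in> borel_measurable (lebesgue_on S)"
  using m(1) by (intro measurable_restrict_space1 measurable_completion) simp

lemma survival_lip_primitive: "lip_primitive 0 c survival (\<lambda>r. - m r * survival r)"
  unfolding survival_def using m_abs
  by (intro lip_primitive_exp lip_primitive_minus lip_primitive_integral m_lebesgue_on) auto

lemma survival_continuous: "continuous_on {0..c} survival"
  by (rule lip_primitive_continuous[OF survival_lip_primitive])

lemma survival_bounds: "0 < survival a" "0 \<le> a \<Longrightarrow> survival a \<le> 1" "survival 0 = 1"
  using integral_nonneg_bounded(1)[OF m, of a a] by (auto simp: survival_def)

lemma beta_slice: "x \<in> {0..1} \<Longrightarrow> in_Linf (ages a_m) (\<lambda>a. \<beta> a x)"
  using beta_cont by (auto simp: cont_into_Linf_def)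

lemma offspring_nonneg: "0 \<le> offspring"
  unfolding offspring_def set_lebesgue_integral_def
proof (rule Bochner_Integration.integral_nonneg)
  fix a
  have "0 \<le> \<beta> a x0" if "a \<in> {0<..<a_c}"
    using that ages_Ioo_subset[OF a_c_lt] beta_nonneg x0 by auto
  then show "0 \<le> indicator {0<..<a_c} a *\<^sub>R (\<beta> a x0 * survival a)"
    using survival_bounds(1)[of a] by (auto simp: indicator_def)
qed

lemma equilibrium_facts:
  assumes eq: "positive_equilibrium a_m \<beta> \<mu> f d u" and d: "0 < d"
  shows "continuous_on ({0..b} \<times> {0..1}) (case_prod u)"
    "\<And>a x. a \<in> {0..b} \<Longrightarrow> x \<in> {0..1} \<Longrightarrow> 0 < u a x"
    "\<And>a x. a \<in> {0..b} \<Longrightarrow> x \<in> {0..1} \<Longrightarrow> u a x \<le> L"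
    "\<And>x. x \<in> {0<..<1} \<Longrightarrow> u 0 x = f x (LINT a:ages a_m|lebesgue. \<beta> a x * u a x)"
    "\<And>x. x \<in> {0<..<1} \<Longrightarrow> 0 \<le> (LINT a:ages a_m|lebesgue. \<beta> a x * u a x)"
proof -
  show "continuous_on ({0..b} \<times> {0..1}) (case_prod u)" by (rule equilibrium_continuous[OF eq b])
  show "0 < u a x" if "a \<in> {0..b}" "x \<in> {0..1}" for a x by (rule equilibrium_pos[OF eq b that])
  show "u a x \<le> L" if "a \<in> {0..b}" "x \<in> {0..1}" for a x
    by (rule equilibrium_le[OF eq d b_pos b beta_nonneg mu_nonneg f_bdd that])
  show "u 0 x = f x (LINT a:ages a_m|lebesgue. \<beta> a x * u a x)" if "x \<in> {0<..<1}" for x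
    using eq that unfolding positive_equilibrium_def by blast
  show "0 \<le> (LINT a:ages a_m|lebesgue. \<beta> a x * u a x)" if "x \<in> {0<..<1}" for x
    by (rule equilibrium_nonneg_birth[OF eq beta_nonneg that])
qed

lemma births_bounds:
  assumes eq: "positive_equilibrium a_m \<beta> \<mu> f d u" and d: "0 < d" and x: "x \<in> {0<..<1}"
    and close: "AE a in lebesgue. a \<in> ages a_m \<longrightarrow> \<bar>\<beta> a x - \<beta> a x0\<bar> \<le> \<eta>"
    and C: "0 \<le> C" and \<eta>: "0 \<le> \<eta>"
  shows "(\<And>a. a \<in> {0..b} \<Longrightarrow> u a x \<le> C * survival a) \<Longrightarrow>
      (LINT a:ages a_m|lebesgue. \<beta> a x * u a x) \<le> C * (offspring + \<eta> * a_c)"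
    "(\<And>a. a \<in> {0..b} \<Longrightarrow> C * survival a \<le> u a x) \<Longrightarrow>
      C * (offspring - \<eta> * a_c) \<le> (LINT a:ages a_m|lebesgue. \<beta> a x * u a x)"
proof -
  have "continuous_on {0..b} (\<lambda>a. u a x)"
    using continuous_on_slice2[OF equilibrium_facts(1)[OF eq d]] x by auto
  then have cu: "continuous_on {0..a_c} (\<lambda>a. u a x)"
    using a_c by (elim continuous_on_subset) auto
  have x': "x \<in> {0..1}" "x0 \<in> {0..1}" using x x0 by auto
  have pos: "0 \<le> \<beta> a x" if "a \<in> ages a_m" for a using beta_nonneg that x' by blast
  have zero: "\<beta> a x = 0" if "a_c \<le> a" "ereal a < a_m" for a using beta_zero that x' by blast
  note * = birth_integral_bounds[where \<beta>=\<beta>, OF beta_slice[OF x'(1)] beta_slice[OF x'(2)] pos zero a_c(1) a_c_lt close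
      cu survival_continuous[of a_c] less_imp_le[OF survival_bounds(1)] survival_bounds(2) C \<eta>, folded offspring_def]
  show "(LINT a:ages a_m|lebesgue. \<beta> a x * u a x) \<le> C * (offspring + \<eta> * a_c)"
    if "\<And>a. a \<in> {0..b} \<Longrightarrow> u a x \<le> C * survival a"
    using a_c by (intro *(1) that) auto
  show "C * (offspring - \<eta> * a_c) \<le> (LINT a:ages a_m|lebesgue. \<beta> a x * u a x)"
    if "\<And>a. a \<in> {0..b} \<Longrightarrow> C * survival a \<le> u a x"
    using a_c by (intro *(2) that) auto
qed

text \<open>Sweeping with the supersolutions \<open>\<Theta> * cosh (k * (x - x0))\<close>: at the smallest
  \<open>\<Theta> \<ge> S\<close> that dominates the initial trace, touching contradicts \<open>f x (\<kappa> * s) < s\<close>.\<close>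

lemma sweep_upper:
  assumes eq: "positive_equilibrium a_m \<beta> \<mu> f d u" and d: "0 < d"
    and B: "0 < x0 - \<delta>" "0 < \<delta>" "x0 + \<delta> < 1" and \<eta>: "0 \<le> \<eta>"
    and close\<beta>: "\<And>x. x \<in> {x0 - \<delta>..x0 + \<delta>} \<Longrightarrow> AE a in lebesgue. a \<in> ages a_m \<longrightarrow> \<bar>\<beta> a x - \<beta> a x0\<bar> \<le> \<eta>"
    and close\<mu>: "\<And>x. x \<in> {x0 - \<delta>..x0 + \<delta>} \<Longrightarrow> AE a in lebesgue. a \<in> {0<..<b} \<longrightarrow> \<bar>\<mu> a x - \<mu> a x0\<bar> \<le> \<eta>"
    and q: "exp (d * k\<^sup>2 * b + \<eta> * b) \<le> q" and S: "0 < S"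
    and lat: "L * exp (M * b) \<le> S * cosh (k * \<delta>)"
    and fc: "\<And>x. x \<in> {x0 - \<delta>..x0 + \<delta>} \<Longrightarrow> f x (q * (offspring + \<eta> * a_c) * S) < S"
    and a: "a \<in> {0..b}"
  shows "u a x0 \<le> S * q * survival a"
proof -
  define B where "B = {x0 - \<delta>..x0 + \<delta>}"
  note facts = equilibrium_facts[OF eq d]
  have B01: "x \<in> {0<..<1}" "x \<in> {0..1}" if "x \<in> B" for x using that B by (auto simp: B_def)
  have qpos: "0 < q" using q exp_gt_zero order.strict_trans2 by blast
  define c where "c x = cosh (k * (x - x0))" for x
  have c1: "1 \<le> c x" for x by (simp add: c_def cosh_real_ge_1)
  have cmp: "AE a in lebesgue. a \<in> {0<..<b} \<longrightarrow> m a - \<eta> \<le> \<mu> a x" if "x \<in> {x0 - \<delta>..x0 + \<delta>}" for x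
    using close\<mu>[OF that] m_mu by eventually_elim (auto simp: abs_le_iff)
  have comparison: "u a x \<le> \<Theta> * q * c x * survival a"
    if "S \<le> \<Theta>" and init: "\<And>x. x \<in> B \<Longrightarrow> u 0 x \<le> \<Theta> * c x" and "a \<in> {0..b}" "x \<in> B" for \<Theta> a x
  proof -
    have "S * cosh (k * \<delta>) \<le> \<Theta> * cosh (k * \<delta>)" using that(1) by (intro mult_right_mono) auto
    with lat have lat': "L * exp (M * b) \<le> \<Theta> * cosh (k * \<delta>)" by (rule order_trans)
    show ?thesis
      unfolding c_def survival_def
      by (rule equilibrium_upper_comparison[OF eq d b_pos b B m \<eta> cmp facts(3) _ lat' q _ _ that(3)])
        (use that S L init in \<open>auto simp: B_def c_def\<close>)
  qed
  have init: "u 0 x \<le> S * c x" if "x \<in> B" for x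
  proof -
    \<comment> \<open>The maximum of this ratio, times \<open>S\<close>, is the smallest factor with
      which the \<open>cosh\<close> profile dominates the trace at age 0.\<close>
    define g where "g x = u 0 x / (S * c x)" for x
    have "continuous_on {0..1} (u 0)" using continuous_on_slice[OF facts(1)] b_pos by auto
    then have "continuous_on B (u 0)" using B01 by (elim continuous_on_subset) auto
    then have cg: "continuous_on B g"
      unfolding g_def c_def using S cosh_real_pos by (intro continuous_intros) (auto simp: less_imp_neq[symmetric])
    have cB: "compact B" "B \<noteq> {}" using B by (auto simp: B_def)
    obtain x1 where x1: "x1 \<in> B" and max: "\<forall>x\<in>B. g x \<le> g x1"
      by (rule bexE[OF continuous_attains_sup[OF cB cg]])
    have "g x1 \<le> 1"
    proof (rule ccontr)
      assume "\<not> g x1 \<le> 1"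
      then have g1: "1 < g x1" by simp
      define \<Theta> where "\<Theta> = g x1 * S"
      have \<Theta>: "S \<le> \<Theta>" using g1 S by (simp add: \<Theta>_def)
      have i: "u 0 x \<le> \<Theta> * c x" if "x \<in> B" for x
      proof -
        have "u 0 x / (S * c x) \<le> g x1" using max that by (simp only: g_def)
        moreover have "0 < S * c x" using S c1[of x] by simp
        ultimately show ?thesis by (simp add: pos_divide_le_eq \<Theta>_def mult_ac)
      qed
      define s where "s = \<Theta> * c x1"
      \<comment> \<open>As \<open>cosh\<close> is at least 1, the barrier at the touching point is
        at least \<open>S\<close>; this is the direction in which the strict inequality
        \<open>fc\<close> propagates.\<close>
      have s: "S \<le> s" using \<Theta> c1[of x1] S mult_mono[of S \<Theta> 1 "c x1"] by (simp add: s_def)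
      have touch: "u 0 x1 = s" using S c1[of x1] by (simp add: s_def \<Theta>_def g_def)
      \<comment> \<open>The comparison carries the barrier to all ages at \<open>x1\<close>, so the
        births there, and through \<open>f\<close> the trace itself, are controlled by
        \<open>s\<close> alone.\<close>
      have births: "(LINT a:ages a_m|lebesgue. \<beta> a x1 * u a x1) \<le> s * q * (offspring + \<eta> * a_c)"
      proof (rule births_bounds(1)[OF eq d B01(1)[OF x1] close\<beta> _ \<eta>])
        show "u a x1 \<le> s * q * survival a" if "a \<in> {0..b}" for a
          using comparison[OF \<Theta> i that x1] by (simp add: s_def mult_ac)
      qed (use x1 s S qpos in \<open>auto simp: B_def\<close>)
      have "u 0 x1 \<le> f x1 (q * (offspring + \<eta> * a_c) * s)"
        unfolding facts(4)[OF B01(1)[OF x1]]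
        using births by (intro f_mono B01(2)[OF x1] facts(5)[OF B01(1)[OF x1]]) (simp add: mult_ac)
      also have "\<dots> < s"
        using qpos offspring_nonneg \<eta> a_c S s x1
        by (intro sublinear_scaling(1)[OF f_zero[OF B01(2)[OF x1]] f_quot[OF B01(2)[OF x1]] _ S s] fc) (auto simp: B_def)
      finally show False using touch by simp
    qed
    then have "g x \<le> 1" using max that by force
    then show ?thesis using S c1[of x] by (simp add: g_def divide_simps mult_ac split: if_splits)
  qed
  have "u a x0 \<le> S * q * c x0 * survival a"
    using B by (intro comparison init a) (auto simp: B_def)
  then show ?thesis by (simp add: c_def)
qed

text \<open>Mirror image with the largest \<Theta> for which the \<open>cos\<close> profile stays
  below the trace; it is positive because the trace is positive on the compact ball. As
  \<open>cos\<close> is at most 1, the touching value \<open>s\<close> lies below \<open>S\<close>,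
  the direction in which \<open>S < f x (\<kappa> * S)\<close> propagates.\<close>

lemma sweep_lower:
  assumes eq: "positive_equilibrium a_m \<beta> \<mu> f d u" and d: "0 < d"
    and B: "0 < x0 - \<delta>" "0 < \<delta>" "x0 + \<delta> < 1" and \<eta>: "0 \<le> \<eta>"
    and close\<beta>: "\<And>x. x \<in> {x0 - \<delta>..x0 + \<delta>} \<Longrightarrow> AE a in lebesgue. a \<in> ages a_m \<longrightarrow> \<bar>\<beta> a x - \<beta> a x0\<bar> \<le> \<eta>"
    and close\<mu>: "\<And>x. x \<in> {x0 - \<delta>..x0 + \<delta>} \<Longrightarrow> AE a in lebesgue. a \<in> {0<..<b} \<longrightarrow> \<bar>\<mu> a x - \<mu> a x0\<bar> \<le> \<eta>"
    and k: "k = pi / (2 * \<delta>)"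
    and q: "exp (d * k\<^sup>2 * b + \<eta> * b) \<le> q" and S: "0 < S"
    and K: "0 \<le> offspring - \<eta> * a_c"
    and fc: "\<And>x. x \<in> {x0 - \<delta>..x0 + \<delta>} \<Longrightarrow> S < f x ((offspring - \<eta> * a_c) / q * S)"
    and a: "a \<in> {0..b}"
  shows "S / q * survival a \<le> u a x0"
proof -
  define B where "B = {x0 - \<delta>..x0 + \<delta>}"
  note facts = equilibrium_facts[OF eq d]
  have B01: "x \<in> {0<..<1}" "x \<in> {0..1}" if "x \<in> B" for x using that B by (auto simp: B_def)
  have qpos: "0 < q" using q exp_gt_zero order.strict_trans2 by blast
  define c where "c x = cos (k * (x - x0))" for x
  have k\<delta>: "k * \<delta> = pi / 2" using B by (simp add: k)
  have cmp: "AE a in lebesgue. a \<in> {0<..<b} \<longrightarrow> \<mu> a x \<le> m a + \<eta>" if "x \<in> {x0 - \<delta>..x0 + \<delta>}" for x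
    using close\<mu>[OF that] m_mu by eventually_elim (auto simp: abs_le_iff)
  have comparison: "\<Theta> / q * c x * survival a \<le> u a x"
    if "0 \<le> \<Theta>" and init: "\<And>x. x \<in> B \<Longrightarrow> \<Theta> * c x \<le> u 0 x" and "a \<in> {0..b}" "x \<in> B" for \<Theta> a x
    unfolding c_def survival_def
    by (rule equilibrium_lower_comparison[OF eq d b_pos b B m \<eta> cmp k\<delta> q _ _ that(3)])
      (use that init in \<open>auto simp: B_def c_def\<close>)
  have u0: "0 < u 0 x" if "x \<in> B" for x using b_pos that by (intro facts(2) B01) auto
  have init: "S * c x \<le> u 0 x" if "x \<in> B" for x
  proof -
    define g where "g x = S * c x / u 0 x" for x
    have "continuous_on {0..1} (u 0)" using continuous_on_slice[OF facts(1)] b_pos by auto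
    then have "continuous_on B (u 0)" using B01 by (elim continuous_on_subset) auto
    then have cg: "continuous_on B g"
      unfolding g_def c_def using u0 by (intro continuous_intros) (auto simp: less_imp_neq[symmetric])
    have cB: "compact B" "B \<noteq> {}" using B by (auto simp: B_def)
    obtain x1 where x1: "x1 \<in> B" and max: "\<forall>x\<in>B. g x \<le> g x1"
      by (rule bexE[OF continuous_attains_sup[OF cB cg]])
    have "g x1 \<le> 1"
    proof (rule ccontr)
      assume "\<not> g x1 \<le> 1"
      then have g1: "1 < g x1" by simp
      define \<Theta> where "\<Theta> = S / g x1"
      have \<Theta>: "0 < \<Theta>" "\<Theta> \<le> S" using g1 S by (auto simp: \<Theta>_def divide_simps)
      have i: "\<Theta> * c x \<le> u 0 x" if "x \<in> B" for x
      proof -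
        have "S * c x / u 0 x \<le> g x1" using max that by (simp only: g_def)
        then show ?thesis using u0[OF that] g1 by (simp add: \<Theta>_def divide_simps mult_ac)
      qed
      define s where "s = \<Theta> * c x1"
      have touch: "u 0 x1 = s"
      proof -
        \<comment> \<open>Touching cannot occur on the sides, where the cosine and hence
          \<open>g\<close> vanish.\<close>
        have "c x1 \<noteq> 0" using g1 by (auto simp: g_def)
        then show ?thesis using S u0[OF x1] by (simp add: s_def \<Theta>_def g_def)
      qed
      then have s0: "0 < s" using u0[OF x1] by simp
      have "c x1 \<le> 1" by (simp add: c_def)
      then have "s \<le> \<Theta>" using \<Theta>(1) by (simp add: s_def mult_left_le)
      then have s: "s \<le> S" using \<Theta>(2) by simp
      have births: "s / q * (offspring - \<eta> * a_c) \<le> (LINT a:ages a_m|lebesgue. \<beta> a x1 * u a x1)"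
      proof (rule births_bounds(2)[OF eq d B01(1)[OF x1] close\<beta> _ \<eta>])
        show "s / q * survival a \<le> u a x1" if "a \<in> {0..b}" for a
          using comparison[OF less_imp_le[OF \<Theta>(1)] i that x1] by (simp add: s_def mult_ac)
      qed (use x1 s0 qpos in \<open>auto simp: B_def\<close>)
      have "s < f x1 ((offspring - \<eta> * a_c) / q * s)"
        using qpos K x1
        by (intro sublinear_scaling(2)[OF f_zero[OF B01(2)[OF x1]] f_quot[OF B01(2)[OF x1]] _ s0 s] fc) (auto simp: B_def)
      also have "\<dots> \<le> f x1 (LINT a:ages a_m|lebesgue. \<beta> a x1 * u a x1)"
        using births K qpos s0 by (intro f_mono B01(2)[OF x1]) (auto simp: mult_ac)
      also have "\<dots> = u 0 x1" by (rule facts(4)[OF B01(1)[OF x1], symmetric])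
      finally show False using touch by simp
    qed
    then have "g x \<le> 1" using max that by force
    then show ?thesis using u0[OF that] by (simp add: g_def divide_simps)
  qed
  have "S / q * c x0 * survival a \<le> u a x0"
    using B S by (intro comparison init a) (auto simp: B_def)
  then show ?thesis by (simp add: c_def)
qed

end

section \<open>The limit of vanishing diffusion\<close>

context local_problem begin

lemma f_cont_at:
  assumes "0 \<le> y" "0 < e"
  obtains \<epsilon> where "0 < \<epsilon>"
    "\<And>x z. x \<in> {0..1} \<Longrightarrow> 0 \<le> z \<Longrightarrow> \<bar>x - x0\<bar> < \<epsilon> \<Longrightarrow> \<bar>z - y\<bar> < \<epsilon> \<Longrightarrow> \<bar>f x z - f x0 y\<bar> < e"
proof -
  have "(x0, y) \<in> {0..1} \<times> {0..}" using x0 assms(1) by auto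
  then obtain \<delta> where \<delta>: "0 < \<delta>"
    "\<forall>p\<in>{0..1} \<times> {0..}. dist p (x0, y) < \<delta> \<longrightarrow> dist (case_prod f p) (case_prod f (x0, y)) < e"
    using f_cont assms(2) unfolding continuous_on_iff by blast
  show ?thesis
  proof (rule that[of "\<delta> / 2"])
    fix x z assume *: "x \<in> {0..1}" "0 \<le> z" "\<bar>x - x0\<bar> < \<delta> / 2" "\<bar>z - y\<bar> < \<delta> / 2"
    have "dist (x, z) (x0, y) \<le> dist x x0 + dist z y"
      unfolding dist_prod_def using sqrt_sum_squares_le_sum[of "dist x x0" "dist z y"] by simp
    also have "\<dots> < \<delta>" using * by (simp add: dist_real_def)
    finally show "\<bar>f x z - f x0 y\<bar> < e"
      using bspec[OF \<delta>(2), of "(x, z)"] * by (simp add: dist_real_def)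
  qed (use \<delta> in simp)
qed

lemma neighbourhood:
  assumes "0 < \<eta>" "0 < \<epsilon>"
  obtains \<delta> where "0 < x0 - \<delta>" "0 < \<delta>" "x0 + \<delta> < 1" "\<delta> < \<epsilon>"
    "\<And>x. x \<in> {x0 - \<delta>..x0 + \<delta>} \<Longrightarrow> AE a in lebesgue. a \<in> ages a_m \<longrightarrow> \<bar>\<beta> a x - \<beta> a x0\<bar> \<le> \<eta>"
    "\<And>x. x \<in> {x0 - \<delta>..x0 + \<delta>} \<Longrightarrow> AE a in lebesgue. a \<in> {0<..<b} \<longrightarrow> \<bar>\<mu> a x - \<mu> a x0\<bar> \<le> \<eta>"
proof -
  have x01: "x0 \<in> {0..1}" using x0 by auto
  obtain \<delta>1 where \<delta>1: "0 < \<delta>1" "\<And>x. x \<in> {0..1} \<Longrightarrow> \<bar>x - x0\<bar> < \<delta>1 \<Longrightarrow> AE a in lebesgue. a \<in> ages a_m \<longrightarrow> \<bar>\<beta> a x - \<beta> a x0\<bar> \<le> \<eta>"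
    by (rule cont_into_Linf_close[OF beta_cont ages_measurable x01 assms(1)], rule that, assumption+)
  have bl: "{0<..<b} \<in> sets lebesgue" by simp
  obtain \<delta>2 where \<delta>2: "0 < \<delta>2" "\<And>x. x \<in> {0..1} \<Longrightarrow> \<bar>x - x0\<bar> < \<delta>2 \<Longrightarrow> AE a in lebesgue. a \<in> {0<..<b} \<longrightarrow> \<bar>\<mu> a x - \<mu> a x0\<bar> \<le> \<eta>"
    by (rule cont_into_Linf_close[OF mu_cont bl x01 assms(1)], rule that, assumption+)
  define \<delta> where "\<delta> = min (min \<delta>1 \<delta>2) (min \<epsilon> (min x0 (1 - x0))) / 2"
  have \<delta>: "0 < \<delta>" "\<delta> < \<delta>1" "\<delta> < \<delta>2" "\<delta> < \<epsilon>" "\<delta> < x0" "\<delta> < 1 - x0"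
    using \<delta>1(1) \<delta>2(1) assms(2) x0 by (auto simp: \<delta>_def min_def)
  show ?thesis
  proof (rule that[of \<delta>])
    fix x assume x: "x \<in> {x0 - \<delta>..x0 + \<delta>}"
    then have "x \<in> {0..1}" "\<bar>x - x0\<bar> < \<delta>1" "\<bar>x - x0\<bar> < \<delta>2" using \<delta> by (auto simp: abs_less_iff)
    then show "AE a in lebesgue. a \<in> ages a_m \<longrightarrow> \<bar>\<beta> a x - \<beta> a x0\<bar> \<le> \<eta>"
      "AE a in lebesgue. a \<in> {0<..<b} \<longrightarrow> \<bar>\<mu> a x - \<mu> a x0\<bar> \<le> \<eta>"
      using \<delta>1(2) \<delta>2(2) by blast+
  qed (use \<delta> in auto)
qed

text \<open>\<open>k\<close> is fixed before \<open>d\<close>. The bound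
  \<open>d < \<eta> / (k^2 + 1)\<close>, in which the 1 covers \<open>k = 0\<close>, makes the loss
  \<open>d * k^2\<close> at most \<eta>.\<close>

lemma eventually_small_diffusion:
  assumes "0 < \<eta>"
  shows "\<forall>\<^sub>F d in at 0 within admissible_diffusion a_m \<beta> \<mu> f.
    d \<in> admissible_diffusion a_m \<beta> \<mu> f \<and> 0 < d \<and> exp (d * k\<^sup>2 * b + \<eta> * b) \<le> exp (2 * \<eta> * b)"
  unfolding eventually_at
proof (intro exI[of _ "\<eta> / (k\<^sup>2 + 1)"] conjI ballI impI)
  have k: "0 < k\<^sup>2 + 1" by (simp add: add_nonneg_pos)
  show "0 < \<eta> / (k\<^sup>2 + 1)" using assms k by simp
  fix d assume d: "d \<in> admissible_diffusion a_m \<beta> \<mu> f" "d \<noteq> 0 \<and> dist d 0 < \<eta> / (k\<^sup>2 + 1)"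
  then show d0: "0 < d" by (simp add: admissible_diffusion_def)
  have "d * (k\<^sup>2 + 1) < \<eta>" using d d0 k by (simp add: pos_less_divide_eq)
  then have "d * k\<^sup>2 \<le> \<eta>" using d0 by (simp add: distrib_left)
  then have "d * k\<^sup>2 * b \<le> \<eta> * b" using b_pos by (intro mult_right_mono) auto
  then show "exp (d * k\<^sup>2 * b + \<eta> * b) \<le> exp (2 * \<eta> * b)" by simp
qed auto

context
  fixes ustar :: "real \<Rightarrow> real \<Rightarrow> real \<Rightarrow> real"
  assumes ustar: "\<forall>d\<in>admissible_diffusion a_m \<beta> \<mu> f. positive_equilibrium a_m \<beta> \<mu> f d (ustar d)"
begin

text \<open>The strict inequality persists for \<open>x\<close> near \<open>x0\<close> and for
  \<open>offspring * S\<close> replaced by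
  \<open>exp (2 * \<eta> * b) * (offspring + \<eta> * a_c) * S\<close> with small \<eta>, the form
  that \<open>sweep_upper\<close> asks for. The factor \<open>r\<close> leaves room for
  \<open>exp (2 * \<eta> * b)\<close>.\<close>

lemma eventually_upper_bound:
  assumes S: "0 < S" and fS: "f x0 (offspring * S) < S" and r: "1 < r" and a: "a \<in> {0..b}"
  shows "\<forall>\<^sub>F d in at 0 within admissible_diffusion a_m \<beta> \<mu> f. ustar d a x0 \<le> S * r * survival a"
proof -
  have KS: "0 \<le> offspring * S" using S offspring_nonneg by simp
  have e: "0 < S - f x0 (offspring * S)" using fS by simp
  obtain \<epsilon> where \<epsilon>: "0 < \<epsilon>" "\<And>x z. x \<in> {0..1} \<Longrightarrow> 0 \<le> z \<Longrightarrow> \<bar>x - x0\<bar> < \<epsilon> \<Longrightarrow> \<bar>z - offspring * S\<bar> < \<epsilon> \<Longrightarrow>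
      \<bar>f x z - f x0 (offspring * S)\<bar> < S - f x0 (offspring * S)"
    by (rule f_cont_at[OF KS e], rule that, assumption+)
  have "((\<lambda>\<eta>. exp (2 * \<eta> * b) * (offspring + \<eta> * a_c) * S) \<longlongrightarrow> exp (2 * 0 * b) * (offspring + 0 * a_c) * S) (at_right 0)"
    "((\<lambda>\<eta>. exp (2 * \<eta> * b)) \<longlongrightarrow> exp (2 * 0 * b)) (at_right 0)"
    by (intro tendsto_intros)+
  then have "\<forall>\<^sub>F \<eta> in at_right 0. dist (exp (2 * \<eta> * b) * (offspring + \<eta> * a_c) * S) (offspring * S) < \<epsilon>"
    "\<forall>\<^sub>F \<eta> in at_right 0. exp (2 * \<eta> * b) < r"
    using \<epsilon>(1) r by (auto dest!: tendstoD order_tendstoD(2)[of _ 1])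
  moreover have "\<forall>\<^sub>F \<eta> in at_right (0::real). 0 < \<eta>" by (rule eventually_at_right_less)
  ultimately have "\<forall>\<^sub>F \<eta> in at_right 0. 0 < \<eta> \<and> exp (2 * \<eta> * b) < r \<and>
     dist (exp (2 * \<eta> * b) * (offspring + \<eta> * a_c) * S) (offspring * S) < \<epsilon>"
    by eventually_elim auto
  then obtain \<eta> where \<eta>: "0 < \<eta>" "exp (2 * \<eta> * b) < r"
    "\<bar>exp (2 * \<eta> * b) * (offspring + \<eta> * a_c) * S - offspring * S\<bar> < \<epsilon>"
    using eventually_happens[of _ "at_right (0::real)"] by (auto simp: dist_real_def)
  obtain \<delta> where \<delta>: "0 < x0 - \<delta>" "0 < \<delta>" "x0 + \<delta> < 1" "\<delta> < \<epsilon>"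
    and close: "\<And>x. x \<in> {x0 - \<delta>..x0 + \<delta>} \<Longrightarrow> AE a in lebesgue. a \<in> ages a_m \<longrightarrow> \<bar>\<beta> a x - \<beta> a x0\<bar> \<le> \<eta>"
    "\<And>x. x \<in> {x0 - \<delta>..x0 + \<delta>} \<Longrightarrow> AE a in lebesgue. a \<in> {0<..<b} \<longrightarrow> \<bar>\<mu> a x - \<mu> a x0\<bar> \<le> \<eta>"
    by (rule neighbourhood[OF \<eta>(1) \<epsilon>(1)], rule that, assumption+)
  \<comment> \<open>Based on \<open>cosh y \<ge> y / 2\<close>: this \<open>k\<close> gives
    \<open>S * (k * \<delta> / 2) = L * exp (M * b)\<close>, so the barrier reaches the crude bound
    on the sides.\<close>
  define k where "k = 2 * L * exp (M * b) / (S * \<delta>)"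
  have lat: "L * exp (M * b) \<le> S * cosh (k * \<delta>)"
  proof -
    have "L * exp (M * b) = S * (k * \<delta> / 2)" using S \<delta> by (simp add: k_def)
    also have "k * \<delta> / 2 \<le> cosh (k * \<delta>)"
    proof -
      have "k * \<delta> \<le> exp (k * \<delta>) + exp (- (k * \<delta>))"
        using exp_ge_add_one_self[of "k * \<delta>"] exp_gt_zero[of "- (k * \<delta>)"] by linarith
      then show ?thesis by (simp add: cosh_def)
    qed
    finally show ?thesis using S by simp
  qed
  show ?thesis
    using eventually_small_diffusion[OF \<eta>(1), of k]
  proof eventually_elim
    case (elim d)
    then have eq: "positive_equilibrium a_m \<beta> \<mu> f d (ustar d)" using ustar by blast
    have "ustar d a x0 \<le> S * exp (2 * \<eta> * b) * survival a"
    proof (rule sweep_upper[OF eq _ \<delta>(1-3) _ close _ S lat _ a])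
      show "f x (exp (2 * \<eta> * b) * (offspring + \<eta> * a_c) * S) < S" if "x \<in> {x0 - \<delta>..x0 + \<delta>}" for x
      proof -
        have "0 \<le> exp (2 * \<eta> * b) * (offspring + \<eta> * a_c) * S"
          using \<eta>(1) S offspring_nonneg a_c(1) by simp
        then have "\<bar>f x (exp (2 * \<eta> * b) * (offspring + \<eta> * a_c) * S) - f x0 (offspring * S)\<bar> < S - f x0 (offspring * S)"
          using that \<delta> \<eta>(3) by (intro \<epsilon>(2)) auto
        then show ?thesis by linarith
      qed
    qed (use elim \<eta>(1) in auto)
    also have "\<dots> \<le> S * r * survival a"
      using \<eta>(2) S survival_bounds(1)[of a] by (intro mult_right_mono mult_left_mono) auto
    finally show ?case .
  qed
qed

text \<open>Here \<eta> must also keep \<open>offspring - \<eta> * a_c\<close> positive. This is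
  possible because \<open>f x0 0 = 0\<close> and \<open>S < f x0 (offspring * S)\<close> force
  \<open>offspring > 0\<close>.\<close>

lemma eventually_lower_bound:
  assumes S: "0 < S" and fS: "S < f x0 (offspring * S)" and r: "1 < r" and a: "a \<in> {0..b}"
  shows "\<forall>\<^sub>F d in at 0 within admissible_diffusion a_m \<beta> \<mu> f. S / r * survival a \<le> ustar d a x0"
proof -
  have x01: "x0 \<in> {0..1}" using x0 by auto
  have "offspring \<noteq> 0" using fS S f_zero[OF x01] by auto
  then have K: "0 < offspring" using offspring_nonneg by simp
  have KS: "0 \<le> offspring * S" using S K by simp
  have e: "0 < f x0 (offspring * S) - S" using fS by simp
  obtain \<epsilon> where \<epsilon>: "0 < \<epsilon>" "\<And>x z. x \<in> {0..1} \<Longrightarrow> 0 \<le> z \<Longrightarrow> \<bar>x - x0\<bar> < \<epsilon> \<Longrightarrow> \<bar>z - offspring * S\<bar> < \<epsilon> \<Longrightarrow>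
      \<bar>f x z - f x0 (offspring * S)\<bar> < f x0 (offspring * S) - S"
    by (rule f_cont_at[OF KS e], rule that, assumption+)
  have "((\<lambda>\<eta>. (offspring - \<eta> * a_c) / exp (2 * \<eta> * b) * S) \<longlongrightarrow> (offspring - 0 * a_c) / exp (2 * 0 * b) * S) (at_right 0)"
    "((\<lambda>\<eta>. exp (2 * \<eta> * b)) \<longlongrightarrow> exp (2 * 0 * b)) (at_right 0)"
    and l3: "((\<lambda>\<eta>. offspring - \<eta> * a_c) \<longlongrightarrow> offspring - 0 * a_c) (at_right 0)"
    by (intro tendsto_intros; simp)+
  from this(1,2) have "\<forall>\<^sub>F \<eta> in at_right 0. dist ((offspring - \<eta> * a_c) / exp (2 * \<eta> * b) * S) (offspring * S) < \<epsilon>"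
    "\<forall>\<^sub>F \<eta> in at_right 0. exp (2 * \<eta> * b) < r"
    using \<epsilon>(1) r by (auto dest!: tendstoD order_tendstoD(2)[of _ 1])
  moreover have "\<forall>\<^sub>F \<eta> in at_right 0. 0 < offspring - \<eta> * a_c"
    using K by (intro order_tendstoD(1)[OF l3]) simp
  moreover have "\<forall>\<^sub>F \<eta> in at_right (0::real). 0 < \<eta>" by (rule eventually_at_right_less)
  ultimately have "\<forall>\<^sub>F \<eta> in at_right 0. 0 < \<eta> \<and> exp (2 * \<eta> * b) < r \<and> 0 < offspring - \<eta> * a_c \<and>
     dist ((offspring - \<eta> * a_c) / exp (2 * \<eta> * b) * S) (offspring * S) < \<epsilon>"
    by eventually_elim auto
  then obtain \<eta> where \<eta>: "0 < \<eta>" "exp (2 * \<eta> * b) < r" "0 < offspring - \<eta> * a_c"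
    "\<bar>(offspring - \<eta> * a_c) / exp (2 * \<eta> * b) * S - offspring * S\<bar> < \<epsilon>"
    using eventually_happens[of _ "at_right (0::real)"] by (auto simp: dist_real_def)
  obtain \<delta> where \<delta>: "0 < x0 - \<delta>" "0 < \<delta>" "x0 + \<delta> < 1" "\<delta> < \<epsilon>"
    and close: "\<And>x. x \<in> {x0 - \<delta>..x0 + \<delta>} \<Longrightarrow> AE a in lebesgue. a \<in> ages a_m \<longrightarrow> \<bar>\<beta> a x - \<beta> a x0\<bar> \<le> \<eta>"
    "\<And>x. x \<in> {x0 - \<delta>..x0 + \<delta>} \<Longrightarrow> AE a in lebesgue. a \<in> {0<..<b} \<longrightarrow> \<bar>\<mu> a x - \<mu> a x0\<bar> \<le> \<eta>"
    by (rule neighbourhood[OF \<eta>(1) \<epsilon>(1)], rule that, assumption+)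
  show ?thesis
    using eventually_small_diffusion[OF \<eta>(1), of "pi / (2 * \<delta>)"]
  proof eventually_elim
    case (elim d)
    then have eq: "positive_equilibrium a_m \<beta> \<mu> f d (ustar d)" using ustar by blast
    have "S / r * survival a \<le> S / exp (2 * \<eta> * b) * survival a"
      using \<eta>(2) S survival_bounds(1)[of a] r by (intro mult_right_mono divide_left_mono) auto
    also have "\<dots> \<le> ustar d a x0"
    proof (rule sweep_lower[OF eq _ \<delta>(1-3) _ close refl _ S _ _ a])
      show "S < f x ((offspring - \<eta> * a_c) / exp (2 * \<eta> * b) * S)" if "x \<in> {x0 - \<delta>..x0 + \<delta>}" for x
      proof -
        have "0 \<le> (offspring - \<eta> * a_c) / exp (2 * \<eta> * b) * S"
          using \<eta>(3) S by simp
        then have "\<bar>f x ((offspring - \<eta> * a_c) / exp (2 * \<eta> * b) * S) - f x0 (offspring * S)\<bar> < f x0 (offspring * S) - S"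
          using that \<delta> \<eta>(4) by (intro \<epsilon>(2)) auto
        then show ?thesis by linarith
      qed
    qed (use elim \<eta>(1,3) in auto)
    finally show ?case .
  qed
qed

text \<open>The bounds \<open>S * r * survival a\<close> and \<open>S / r * survival a\<close> are
  available for every \<open>S\<close> above, respectively below, the threshold \<open>s\<close> and
  every \<open>r > 1\<close>, so they squeeze the limit. The case \<open>s = 0\<close> is
  extinction, where positivity of the equilibrium is the lower bound.\<close>

lemma equilibrium_limit:
  assumes s: "0 \<le> s" and above: "\<And>S. s < S \<Longrightarrow> f x0 (offspring * S) < S"
    and below: "\<And>S. 0 < S \<Longrightarrow> S < s \<Longrightarrow> S < f x0 (offspring * S)" and a: "a \<in> {0..b}"
  shows "((\<lambda>d. ustar d a x0) \<longlongrightarrow> s * survival a) (at 0 within admissible_diffusion a_m \<beta> \<mu> f)"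
proof (rule order_tendstoI)
  note sv = survival_bounds(1)[of a]
  fix y assume y: "s * survival a < y"
  define z where "z = y / survival a"
  have z: "s < z" "y = z * survival a" using y sv by (auto simp: z_def pos_less_divide_eq)
  define S where "S = (s + z) / 2"
  have S: "s < S" "0 < S" "S < z" using z s by (auto simp: S_def)
  \<comment> \<open>This puts \<open>S * r\<close> midway between \<open>S\<close> and
    \<open>z\<close>.\<close>
  define r where "r = (S + z) / (2 * S)"
  have r: "1 < r" "S * r < z" using S by (auto simp: r_def field_simps)
  have "S * r * survival a < y" unfolding z(2) using r(2) sv by (rule mult_strict_right_mono)
  then show "\<forall>\<^sub>F d in at 0 within admissible_diffusion a_m \<beta> \<mu> f. ustar d a x0 < y"
    using eventually_upper_bound[OF S(2) above[OF S(1)] r(1) a] by (auto elim!: eventually_mono)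
next
  note sv = survival_bounds(1)[of a]
  fix y assume y: "y < s * survival a"
  show "\<forall>\<^sub>F d in at 0 within admissible_diffusion a_m \<beta> \<mu> f. y < ustar d a x0"
  proof (cases "s = 0")
    case True
    show ?thesis
      using eventually_small_diffusion[OF zero_less_one, of 0]
    proof eventually_elim
      case (elim d)
      then have "0 < ustar d a x0" using ustar x0 a by (intro equilibrium_facts(2)) auto
      then show ?case using y True by simp
    qed
  next
    case False
    define z where "z = y / survival a"
    \<comment> \<open>The target \<open>y\<close> may be negative, while the lower bound is stated
      for positive \<open>S\<close>.\<close>
    define z0 where "z0 = max z 0"
    have z: "z < s" "y = z * survival a" using y sv by (auto simp: z_def pos_divide_less_eq)
    have z0: "0 \<le> z0" "z0 < s" "z \<le> z0" using z s False by (auto simp: z0_def)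
    define S where "S = (s + z0) / 2"
    have S: "z0 < S" "0 < S" "S < s" using z0 by (auto simp: S_def)
    define r where "r = 2 * S / (S + z0)"
    have r: "1 < r" "z0 < S / r" using S z0 by (auto simp: r_def field_simps)
    have "y < S / r * survival a" unfolding z(2) using r(2) z0(3) sv by (intro mult_strict_right_mono) auto
    then show ?thesis
      using eventually_lower_bound[OF S(2) below[OF S(2,3)] r(1) a] by (auto elim!: eventually_mono)
  qed
qed

end

text \<open>For positive \<open>offspring\<close>, the question is where \<open>f x0 u / u\<close>,
  at \<open>u = offspring * s\<close>, lies relative to \<open>1 / offspring\<close>. This quotient
  decreases strictly from its limit \<open>D\<close> at 0. If \<open>D * offspring > 1\<close>, it
  starts above the level and, \<open>f\<close> being bounded, crosses it exactly once; otherwise it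
  stays below.\<close>

lemma fixed_point:
  assumes D: "((\<lambda>u. f x0 u / u) \<longlongrightarrow> D) (at_right 0)"
  shows "1 < D * offspring \<Longrightarrow> \<exists>s>0. f x0 (offspring * s) = s \<and>
      (\<forall>S>s. f x0 (offspring * S) < S) \<and> (\<forall>S>0. S < s \<longrightarrow> S < f x0 (offspring * S))"
    "D * offspring \<le> 1 \<Longrightarrow> 0 < S \<Longrightarrow> f x0 (offspring * S) < S"
proof -
  have x01: "x0 \<in> {0..1}" using x0 by auto
  note anti = monotone_onD[OF f_quot[OF x01]]
  show "f x0 (offspring * S) < S" if "D * offspring \<le> 1" "0 < S"
  proof (cases "offspring = 0")
    case True
    then show ?thesis using f_zero[OF x01] that by simp
  next
    case False
    then have K: "0 < offspring" using offspring_nonneg by simp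
    define u where "u = offspring * S"
    have u: "0 < u" using K that by (simp add: u_def)
    \<comment> \<open>The passage to the limit gives only a weak inequality with \<open>D\<close>;
      the intermediate point \<open>u / 2\<close> restores strictness at \<open>u\<close>.\<close>
    have "f x0 (u / 2) / (u / 2) \<le> D"
    proof (rule tendsto_lowerbound[OF D])
      show "\<forall>\<^sub>F v in at_right 0. f x0 (u / 2) / (u / 2) \<le> f x0 v / v"
        unfolding eventually_at_right_field
        using anti[of _ "u / 2"] u by (intro exI[of _ "u / 2"]) (auto intro!: less_imp_le)
    qed simp
    moreover have "f x0 u / u < f x0 (u / 2) / (u / 2)" using anti[of "u / 2" u] u by simp
    ultimately have "f x0 u / u < D" by simp
    then have "f x0 u < D * u" using u by (simp add: pos_divide_less_eq)
    also have "\<dots> = D * offspring * S" by (simp add: u_def)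
    also have "\<dots> \<le> S" using that mult_right_mono[of "D * offspring" 1 S] by simp
    finally show ?thesis by (simp add: u_def)
  qed
  assume G: "1 < D * offspring"
  then have "offspring \<noteq> 0" by auto
  then have K: "0 < offspring" using offspring_nonneg by simp
  have "1 / offspring < D" using G K by (simp add: pos_divide_less_eq)
  then have "\<forall>\<^sub>F u in at_right 0. 1 / offspring < f x0 u / u" using D by (intro order_tendstoD)
  then obtain c where c: "0 < c" "\<And>u. 0 < u \<Longrightarrow> u < c \<Longrightarrow> 1 / offspring < f x0 u / u"
    unfolding eventually_at_right_field by auto
  \<comment> \<open>Small enough for the quotient to exceed \<open>1 / offspring\<close>, and at
    most \<open>L\<close>, so that it lies to the left of \<open>L + 1\<close>, where the bound on
    \<open>f\<close> gives the opposite inequality.\<close>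
  define s0 where "s0 = min (c / (2 * offspring)) L"
  have s0: "0 < s0" "offspring * s0 < c" "s0 \<le> L"
  proof -
    have "offspring * s0 \<le> offspring * (c / (2 * offspring))" using K by (intro mult_left_mono) (auto simp: s0_def)
    also have "\<dots> < c" using K c by simp
    finally show "offspring * s0 < c" .
  qed (use K c L in \<open>auto simp: s0_def\<close>)
  have lo: "s0 < f x0 (offspring * s0)" using c(2)[of "offspring * s0"] s0 K by (simp add: divide_simps)
  have hi: "f x0 (offspring * (L + 1)) \<le> L + 1"
    using f_bdd[OF x01, of "offspring * (L + 1)"] K L by simp
  have "continuous_on {0..} (f x0)" using continuous_on_slice[OF f_cont x01] .
  then have "continuous_on {s0..L + 1} (\<lambda>s. f x0 (offspring * s))"
  proof (rule continuous_on_compose2)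
    have "0 \<le> offspring * s" if "s0 \<le> s" for s using that K s0(1) by simp
    then show "(\<lambda>s. offspring * s) ` {s0..L + 1} \<subseteq> {0..}" by auto
  qed (intro continuous_intros)
  then have "continuous_on {s0..L + 1} (\<lambda>s. f x0 (offspring * s) - s)" by (intro continuous_intros)
  then obtain s where s: "s0 \<le> s" "s \<le> L + 1" "f x0 (offspring * s) - s = 0"
    using IVT2'[of "\<lambda>s. f x0 (offspring * s) - s" "L + 1" 0 s0] lo hi s0 by auto
  have spos: "0 < s" using s s0 by simp
  have q: "f x0 (offspring * s) / (offspring * s) = 1 / offspring" using s(3) spos by simp
  have "f x0 (offspring * S) < S" if "s < S" for S
    using anti[of "offspring * s" "offspring * S"] that spos K unfolding q by (simp add: divide_simps)
  moreover have "S < f x0 (offspring * S)" if "0 < S" "S < s" for S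
    using anti[of "offspring * S" "offspring * s"] that spos K unfolding q by (simp add: divide_simps)
  ultimately show "\<exists>s>0. f x0 (offspring * s) = s \<and>
      (\<forall>S>s. f x0 (offspring * S) < S) \<and> (\<forall>S>0. S < s \<longrightarrow> S < f x0 (offspring * S))"
    using spos s(3) by (intro exI[of _ s]) auto
qed

end

section \<open>The problem without diffusion: existence and uniqueness\<close>

lemma integral_superset_support:
  fixes F :: "real \<Rightarrow> real"
  assumes "F integrable_on {s..t}" "\<And>a. a \<notin> {s..t} \<Longrightarrow> F a = 0" "{s..t} \<subseteq> T"
  shows "integral T F = integral {s..t} F"
  by (rule integral_unique) (rule has_integral_on_superset[OF integrable_integral[OF assms(1)] assms(2,3)])

text \<open>To show that a function solves the limit problem, the weak equation has to be tested
  with arbitrary test functions and not only with members of \<open>bump_algebra\<close>.\<close>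

lemma test_fun_1d:
  assumes "test_fun \<Omega> (\<phi> :: real \<Rightarrow> real)"
  shows "directional_derivative 1 \<phi> = deriv \<phi>" "\<And>x. (\<phi> has_real_derivative deriv \<phi> x) (at x)"
    "continuous_on S \<phi>" "continuous_on S (deriv \<phi>)" "\<And>x. x \<notin> \<Omega> \<Longrightarrow> \<phi> x = 0"
proof -
  have sm: "\<And>vs p. foldr directional_derivative vs \<phi> differentiable (at p)"
    using assms by (auto simp: test_fun_def smooth_fun_def)
  have diff: "\<phi> differentiable (at p)" for p using sm[of "[]" p] by simp
  show d: "(\<phi> has_real_derivative deriv \<phi> x) (at x)" for x
    using diff[of x] by (metis DERIV_deriv_iff_real_differentiable)
  show e: "directional_derivative 1 \<phi> = deriv \<phi>"
    using directional_derivative_eq[of \<phi> "\<lambda>p. (*) (deriv \<phi> p)" 1] d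
    by (simp add: has_field_derivative_def)
  show "continuous_on S \<phi>" using d by (meson DERIV_isCont continuous_at_imp_continuous_on)
  have "deriv \<phi> differentiable (at p)" for p using sm[of "[1]" p] by (simp add: e)
  then show "continuous_on S (deriv \<phi>)"
    using differentiable_imp_continuous_within continuous_at_imp_continuous_on by blast
  show "\<phi> x = 0" if "x \<notin> \<Omega>" for x
    using assms closure_subset[of "{p. \<phi> p \<noteq> 0}"] that by (auto simp: test_fun_def)
qed

text \<open>The limit problem relates no two points of \<open>I\<close>, so existence and uniqueness
  can be settled one point at a time.\<close>

lemma positive_limit_solution_pointwise:
  "positive_limit_solution b \<beta> \<mu> f I v \<longleftrightarrow> (\<forall>x\<in>I. positive_limit_solution b \<beta> \<mu> f {x} v)"
  by (simp add: positive_limit_solution_def)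

context local_problem begin

lemma mu_slice: "in_Linf {0<..<b} (\<lambda>a. \<mu> a x0)"
  using mu_cont x0 by (auto simp: cont_into_Linf_def)

lemma mu_times_continuous:
  assumes "continuous_on {0..b} h"
  shows "set_integrable lebesgue {0<..<b} (\<lambda>a. \<mu> a x0 * h a)"
    "(LINT a:{0<..<b}|lebesgue. \<mu> a x0 * h a) = integral {0..b} (\<lambda>a. m a * h a)"
proof -
  show i1: "set_integrable lebesgue {0<..<b} (\<lambda>a. \<mu> a x0 * h a)"
    by (rule in_Linf_times_continuous_integrable[OF mu_slice _ order_refl assms]) simp
  have i2: "set_integrable lebesgue {0<..<b} (\<lambda>a. m a * h a)"
    by (rule set_integrable_subset[OF bounded_times_continuous_integrable[OF m(1) m_abs assms]]) auto
  have "(LINT a:{0<..<b}|lebesgue. \<mu> a x0 * h a) = (LINT a:{0<..<b}|lebesgue. m a * h a)"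
    unfolding set_lebesgue_integral_def
  proof (rule integral_cong_AE)
    show "AE a in lebesgue. indicator {0<..<b} a *\<^sub>R (\<mu> a x0 * h a) = indicator {0<..<b} a *\<^sub>R (m a * h a)"
      using m_mu by eventually_elim (auto simp: indicator_def)
  qed (use i1 i2 in \<open>auto simp: set_integrable_def dest: borel_measurable_integrable\<close>)
  also have "\<dots> = integral {0..b} (\<lambda>a. m a * h a)"
    using set_lebesgue_integral_eq_integral(2)[OF i2] by (simp add: integral_open_interval_real)
  finally show "(LINT a:{0<..<b}|lebesgue. \<mu> a x0 * h a) = integral {0..b} (\<lambda>a. m a * h a)" .
qed

lemma continuous_set_integral_Ioo:
  assumes "continuous_on {0..c} h"
  shows "set_integrable lebesgue {0<..<c} h" "(LINT a:{0<..<c}|lebesgue. h a) = integral {0..c} (h :: real \<Rightarrow> real)"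
proof -
  show i: "set_integrable lebesgue {0<..<c} h"
    by (rule set_integrable_subset[OF absolutely_integrable_continuous_real[OF assms]]) auto
  show "(LINT a:{0<..<c}|lebesgue. h a) = integral {0..c} h"
    using set_lebesgue_integral_eq_integral(2)[OF i] by (simp add: integral_open_interval_real)
qed

text \<open>The fertility vanishes beyond \<open>a_c\<close>, so the age \<open>b\<close> at which
  the limit problem is cut off does not influence the births.\<close>

lemma births_of_survivors:
  assumes "\<And>a. a \<in> {0..b} \<Longrightarrow> w a = c * survival a"
  shows "(LINT a:{0<..<b}|lebesgue. \<beta> a x0 * w a) = offspring * c"
proof -
  have "(LINT a:{0<..<b}|lebesgue. \<beta> a x0 * w a) = (LINT a:{0<..<a_c}|lebesgue. \<beta> a x0 * w a)"
  proof (rule set_integral_restrict_support)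
    fix a assume a: "a \<in> {0<..<b}" "a \<notin> {0<..<a_c}"
    then have "ereal a < a_m" using ages_Ioo_subset[OF b] by (auto simp: ages_def)
    then show "\<beta> a x0 * w a = 0" using a beta_zero x0 by auto
  qed (use a_c in auto)
  also have "\<dots> = (LINT a:{0<..<a_c}|lebesgue. (\<beta> a x0 * survival a) * c)"
    by (rule set_lebesgue_integral_cong) (use assms a_c in \<open>auto simp: mult_ac\<close>)
  also have "\<dots> = offspring * c" by (simp add: offspring_def)
  finally show ?thesis .
qed

text \<open>\<open>survival\<close> has the derivative density \<open>- m r * survival r\<close>.
  Integrating the product rule for it and a test function, which vanishes at both ends, yields the
  weak equation.\<close>

lemma survivors_solve:
  assumes s: "0 < s" "f x0 (offspring * s) = s" and v: "\<And>a. v a x0 = s * survival a"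
  shows "positive_limit_solution b \<beta> \<mu> f {x0} v"
proof -
  have cv: "continuous_on {0..b} (\<lambda>a. v a x0)"
    unfolding v by (intro continuous_intros survival_continuous)
  have iv: "set_integrable lebesgue {0<..<b} (\<lambda>a. v a x0)"
    by (rule continuous_set_integral_Ioo(1)[OF cv])
  have img: "set_integrable lebesgue {0<..<b} (\<lambda>a. - \<mu> a x0 * v a x0)"
    using set_integrable_mult_right[of "-1", OF mu_times_continuous(1)[OF cv]] by (simp add: mult.assoc)
  have wd: "weak_derivative {0<..<b} 1 (\<lambda>a. v a x0) (\<lambda>a. - \<mu> a x0 * v a x0)"
    unfolding weak_derivative_def
  proof (intro conjI allI impI)
    show "locally_integrable_on (\<lambda>a. v a x0) {0<..<b}" "locally_integrable_on (\<lambda>a. - \<mu> a x0 * v a x0) {0<..<b}"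
      unfolding locally_integrable_on_def
      using set_integrable_subset[OF iv] set_integrable_subset[OF img]
      by (auto simp: lmeasurable_compact fmeasurableD)
    fix \<phi> :: "real \<Rightarrow> real" assume \<phi>: "test_fun {0<..<b} \<phi>"
    note T = test_fun_1d[OF \<phi>]
    have "lip_primitive 0 b \<phi> (deriv \<phi>)"
      by (rule lip_primitive_C1) (auto intro: T(2,4) has_field_derivative_at_within)
    from lip_primitive_mult[OF lip_primitive_const_mult[OF survival_lip_primitive, of b s] this]
    have "lip_primitive 0 b (\<lambda>a. v a x0 * \<phi> a) (\<lambda>a. - (m a * (v a x0 * \<phi> a)) + v a x0 * deriv \<phi> a)"
      unfolding v by (simp add: mult_ac)
    from lip_primitive_increment[OF this, of 0 b] b_pos
    have z: "integral {0..b} (\<lambda>a. - (m a * (v a x0 * \<phi> a)) + v a x0 * deriv \<phi> a) = 0"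
      by (simp add: T(5))
    have cf: "continuous_on {0..b} (\<lambda>a. v a x0 * \<phi> a)" by (intro continuous_intros cv T(3))
    have "(\<lambda>a. m a * (v a x0 * \<phi> a)) absolutely_integrable_on {0..b}"
      by (rule bounded_times_continuous_integrable[OF m(1) m_abs cf])
    then have i1: "(\<lambda>a. m a * (v a x0 * \<phi> a)) integrable_on {0..b}" by (rule set_lebesgue_integral_eq_integral)
    have cd: "continuous_on {0..b} (\<lambda>a. v a x0 * deriv \<phi> a)" by (intro continuous_intros cv T(4))
    have "integral {0..b} (\<lambda>a. v a x0 * deriv \<phi> a) = integral {0..b} (\<lambda>a. m a * (v a x0 * \<phi> a))"
      using z i1 integrable_continuous_real[OF cd]
      by (subst (asm) hk_integral_add) (auto intro: integrable_neg)
    then have "(LINT a:{0<..<b}|lebesgue. v a x0 * deriv \<phi> a) = (LINT a:{0<..<b}|lebesgue. \<mu> a x0 * (v a x0 * \<phi> a))"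
      by (simp only: mu_times_continuous(2)[OF cf] continuous_set_integral_Ioo(2)[OF cd])
    also have "\<dots> = - (LINT a:{0<..<b}|lebesgue. - \<mu> a x0 * v a x0 * \<phi> a)"
      using set_integral_mult_right[of lebesgue "{0<..<b}" "-1" "\<lambda>a. \<mu> a x0 * (v a x0 * \<phi> a)"] by (simp add: mult_ac)
    finally show "(LINT a:{0<..<b}|lebesgue. v a x0 * directional_derivative 1 \<phi> a) =
       - (LINT a:{0<..<b}|lebesgue. - \<mu> a x0 * v a x0 * \<phi> a)"
      unfolding T(1) .
  qed
  have "v 0 x0 = f x0 (LINT a:{0<..<b}|lebesgue. \<beta> a x0 * v a x0)"
    using births_of_survivors[of "\<lambda>a. v a x0" s] s(2) by (simp add: v survival_bounds(3))
  then show ?thesis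
    unfolding positive_limit_solution_def W11_def
    using cv iv img wd s(1) survival_bounds(1) by (auto simp: v)
qed

text \<open>Testing at inner ages recovers the integrated equation, continuity of the chosen
  representative carries it to the closed interval, and the integrating factor leaves only the
  constant \<open>w 0 x0\<close> free. The birth law makes this constant a fixed point.\<close>

lemma solution_is_survivors:
  assumes w: "positive_limit_solution b \<beta> \<mu> f {x0} w"
  shows "\<And>a. a \<in> {0..b} \<Longrightarrow> w a x0 = w 0 x0 * survival a" "0 < w 0 x0" "f x0 (offspring * w 0 x0) = w 0 x0"
proof -
  define y where "y a = w a x0" for a
  have cy: "continuous_on {0..b} y" and ypos: "\<And>a. a \<in> {0..b} \<Longrightarrow> 0 < y a"
    and wd: "weak_derivative {0<..<b} 1 y (\<lambda>a. - \<mu> a x0 * y a)"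
    and init: "y 0 = f x0 (LINT a:{0<..<b}|lebesgue. \<beta> a x0 * y a)"
    using w by (auto simp: positive_limit_solution_def y_def[abs_def])
  have myi: "(\<lambda>a. m a * y a) absolutely_integrable_on {s..t}" if "0 \<le> s" "t \<le> b" for s t
    using that by (intro bounded_times_continuous_integrable[OF m(1) m_abs] continuous_on_subset[OF cy]) auto
  have weak: "integral {s..t} (\<lambda>a. y a * deriv \<phi> a - m a * y a * \<phi> a) = 0"
    if st: "0 < s" "s < t" "t < b" and \<phi>: "bump_algebra \<phi>" "\<forall>a. a \<notin> {s..t} \<longrightarrow> \<phi> a = 0" for s t \<phi>
  proof -
    have st': "{s..t} \<subseteq> {0..b}" using st by auto
    have "closure {p. \<phi> p \<noteq> 0} \<subseteq> {s..t}" using \<phi>(2) by (intro closure_minimal) auto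
    moreover have "compact (closure {p. \<phi> p \<noteq> 0})"
      using calculation by (meson bounded_closed_interval bounded_subset closed_closure compact_eq_bounded_closed)
    ultimately have T: "test_fun {0<..<b} \<phi>"
      using bump_algebra_smooth[OF \<phi>(1)] st unfolding test_fun_def by auto
    note c\<phi> = bump_algebra_deriv(4)[OF \<phi>(1)] bump_algebra_deriv(4)[OF bump_algebra_deriv(1)[OF \<phi>(1)]]
    have z': "deriv \<phi> a = 0" if "a \<notin> {s..t}" for a
      using bump_algebra_boundary_zero(3)[OF \<phi>(1) _ that] \<phi>(2) by blast
    have cf: "continuous_on {0..b} (\<lambda>a. y a * \<phi> a)" and cd: "continuous_on {0..b} (\<lambda>a. y a * deriv \<phi> a)"
      by (intro continuous_intros cy c\<phi>)+
    have i1: "(\<lambda>a. m a * (y a * \<phi> a)) integrable_on {s..t}"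
      by (rule set_lebesgue_integral_eq_integral(1)[OF bounded_times_continuous_integrable[OF m(1) m_abs
            continuous_on_subset[OF cf st']]])
    have i2: "(\<lambda>a. y a * deriv \<phi> a) integrable_on {s..t}"
      by (rule integrable_continuous_real[OF continuous_on_subset[OF cd st']])
    have "(LINT a:{0<..<b}|lebesgue. y a * deriv \<phi> a) = - (LINT a:{0<..<b}|lebesgue. - \<mu> a x0 * y a * \<phi> a)"
      using weak_derivative_test[OF wd T] unfolding test_fun_1d(1)[OF T] .
    also have "\<dots> = (LINT a:{0<..<b}|lebesgue. \<mu> a x0 * (y a * \<phi> a))"
      using set_integral_mult_right[of lebesgue "{0<..<b}" "-1" "\<lambda>a. \<mu> a x0 * (y a * \<phi> a)"] by (simp add: mult_ac)
    finally have "integral {0..b} (\<lambda>a. y a * deriv \<phi> a) = integral {0..b} (\<lambda>a. m a * (y a * \<phi> a))"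
      by (simp only: mu_times_continuous(2)[OF cf] continuous_set_integral_Ioo(2)[OF cd])
    moreover have "integral {0..b} (\<lambda>a. y a * deriv \<phi> a) = integral {s..t} (\<lambda>a. y a * deriv \<phi> a)"
      using z' by (intro integral_superset_support[OF i2 _ st']) simp
    moreover have "integral {0..b} (\<lambda>a. m a * (y a * \<phi> a)) = integral {s..t} (\<lambda>a. m a * (y a * \<phi> a))"
      using \<phi>(2) by (intro integral_superset_support[OF i1 _ st']) simp
    ultimately show ?thesis
      using hk_integral_diff[OF i2 i1] by (simp add: mult.assoc)
  qed
  \<comment> \<open>Equality is obtained from two inequalities, one for \<open>y\<close> and one for
    \<open>- y\<close>.\<close>
  have inner: "y t - y s = integral {s..t} (\<lambda>a. - m a * y a)" if st: "0 < s" "s < t" "t < b" for s t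
  proof -
    have cst: "continuous_on {s..t} y" using st by (intro continuous_on_subset[OF cy]) auto
    have i: "(\<lambda>a. m a * y a) absolutely_integrable_on {s..t}" using st by (intro myi) auto
    then have i': "(\<lambda>a. - m a * y a) absolutely_integrable_on {s..t}"
      using set_integrable_mult_right[of "-1", OF i] by (simp add: mult.assoc)
    have "y t - y s \<le> integral {s..t} (\<lambda>a. - m a * y a)"
      using weak[OF st] by (intro weak_inequality_integrates[OF st(2) cst i']) (simp add: mult.assoc)
    moreover have "(- y t) - (- y s) \<le> integral {s..t} (\<lambda>a. m a * y a)"
    proof (rule weak_inequality_integrates[OF st(2) continuous_on_minus[OF cst] i])
      fix \<phi> :: "real \<Rightarrow> real" assume \<phi>: "bump_algebra \<phi>" "\<forall>a. a \<notin> {s..t} \<longrightarrow> \<phi> a = 0"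
      have "integral {s..t} (\<lambda>a. - y a * deriv \<phi> a + m a * y a * \<phi> a) =
         integral {s..t} (\<lambda>a. - (y a * deriv \<phi> a - m a * y a * \<phi> a))"
        by (rule Henstock_Kurzweil_Integration.integral_cong) simp
      also have "\<dots> = 0" using weak[OF st \<phi>] by (simp only: integral_neg)
      finally show "0 \<le> integral {s..t} (\<lambda>a. - y a * deriv \<phi> a + m a * y a * \<phi> a)" by simp
    qed
    ultimately show ?thesis by simp
  qed
  have int: "(\<lambda>a. - m a * y a) integrable_on {s..t}" if "0 \<le> s" "t \<le> b" for s t
    using set_lebesgue_integral_eq_integral(1)[OF myi[OF that]] by (simp add: integrable_neg_iff)
  define G where "G t = y t - integral {0..t} (\<lambda>a. - m a * y a)" for t
  have split: "integral {0..t} (\<lambda>a. - m a * y a) - integral {0..s} (\<lambda>a. - m a * y a) = integral {s..t} (\<lambda>a. - m a * y a)"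
    if "0 \<le> s" "s \<le> t" "t \<le> b" for s t
    using hk_integral_combine[of 0 s t "\<lambda>a. - m a * y a"] int[of 0 t] that by simp
  \<comment> \<open>\<open>inner\<close> makes \<open>G\<close> constant at inner ages; continuity
    adds the ages 0 and \<open>b\<close>, which the test functions do not reach.\<close>
  have Gc: "G t = G (b / 2)" if t: "t \<in> {0..b}" for t
  proof (rule continuous_constant_on_closure[of "{0<..<b}" G "G (b / 2)"])
    have "continuous_on {0..b} (\<lambda>t. integral {0..t} (\<lambda>a. - m a * y a))"
      by (rule indefinite_integral_continuous_1[OF int]) auto
    then have "continuous_on {0..b} G" unfolding G_def by (intro continuous_intros cy)
    then show "continuous_on (closure {0<..<b}) G" using b_pos by simp
    have "G s = G t" if "0 < s" "s < t" "t < b" for s t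
      using inner[OF that] split[of s t] that by (simp add: G_def)
    then show "G t = G (b / 2)" if "t \<in> {0<..<b}" for t
      using that b_pos by (cases t "b / 2" rule: linorder_cases) force+
  qed (use t b_pos in simp)
  have lp: "lip_primitive 0 b y (\<lambda>r. - m r * y r)"
    unfolding lip_primitive_def
  proof (intro conjI allI impI)
    have "y \<in> borel_measurable (lebesgue_on {0..b})"
      by (intro continuous_imp_measurable_on_sets_lebesgue cy) auto
    then show "(\<lambda>r. - m r * y r) \<in> borel_measurable (lebesgue_on {0..b})"
      using m_lebesgue_on by (intro borel_measurable_times borel_measurable_uminus)
    obtain P where P: "\<And>r. r \<in> {0..b} \<Longrightarrow> \<bar>y r\<bar> \<le> P"
      by (rule continuous_on_Icc_abs_bound[OF cy], rule that, assumption)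
    show "\<exists>P. \<forall>r\<in>{0..b}. \<bar>- m r * y r\<bar> \<le> P"
    proof (intro exI[of _ "M * P"] ballI)
      fix r assume "r \<in> {0..b}"
      then show "\<bar>- m r * y r\<bar> \<le> M * P"
        using P[of r] m_abs[of r] by (simp add: abs_mult) (intro mult_mono; linarith)
    qed
    fix s t assume "0 \<le> s" "s \<le> t" "t \<le> b"
    then show "y t - y s = integral {s..t} (\<lambda>r. - m r * y r)"
      using Gc[of s] Gc[of t] split[of s t] by (simp add: G_def)
  qed
  have sol: "y a = y 0 * survival a" if "a \<in> {0..b}" for a
    unfolding survival_def using b_pos m_abs that by (intro linear_ode_unique[OF lp _ m_lebesgue_on]) auto
  then show "w a x0 = w 0 x0 * survival a" if "a \<in> {0..b}" for a using that unfolding y_def .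
  show "0 < w 0 x0" using ypos[of 0] b_pos by (simp add: y_def)
  show "f x0 (offspring * w 0 x0) = w 0 x0"
    using init births_of_survivors[of y "y 0"] sol by (simp add: y_def)
qed

end

section \<open>Consequences of the regularity of the birth function\<close>

lemma at_within_atLeast_nontrivial: "0 \<le> (u::real) \<Longrightarrow> at u within {0..} \<noteq> bot"
proof
  assume u: "0 \<le> u" and bot: "at u within {0..} = bot"
  have "at_right u \<le> at u within {0..}" using u by (intro at_le) auto
  then show False using bot by (simp add: bot_unique)
qed

text \<open>\<open>partial_u\<close> is a selected derivative; it is the true one because the filter
  is nontrivial, even at \<open>u = 0\<close>, where the derivative is one-sided.\<close>

lemma C21_partial_u:
  assumes "C21_on {0..1} {0..} f" "x \<in> {0..1}" "0 \<le> u"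
  shows "(f x has_real_derivative partial_u f x u) (at u within {0..})"
proof -
  obtain D where D: "(f x has_real_derivative D) (at u within {0..})"
    using assms unfolding C21_on_def by fastforce
  then have "vector_derivative (f x) (at u within {0..}) = D"
    by (intro vector_derivative_within at_within_atLeast_nontrivial assms(3))
      (simp add: has_real_derivative_iff_has_vector_derivative)
  then show ?thesis using D by (simp add: partial_u_def)
qed

lemma increasing_if_partial_u_pos:
  assumes f: "C21_on {0..1} {0..} f" and pos: "\<forall>x\<in>{0..1}. \<forall>u\<ge>0. 0 < partial_u f x u"
    and x: "x \<in> {0..1}" and uv: "0 \<le> u" "u \<le> v"
  shows "f x u \<le> f x v"
proof (cases "u = v")
  case False
  have d: "(f x has_real_derivative partial_u f x w) (at w)" if "0 < w" for w
  proof -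
    have "at w within {0..} = at w" using that by (intro at_within_open_subset[of w "{0<..}"]) auto
    then show ?thesis using C21_partial_u[OF f x, of w] that by simp
  qed
  have "continuous_on {0..} (f x)"
    unfolding continuous_on_eq_continuous_within
    by (intro ballI DERIV_continuous[OF C21_partial_u[OF f x]]) simp
  then have cont: "continuous_on {u..v} (f x)" using uv by (elim continuous_on_subset) auto
  have "\<exists>y. (f x has_real_derivative y) (at w) \<and> 0 < y" if "u < w" for w
    using d[of w] pos x that uv by auto
  then have "f x u < f x v"
    using False uv by (intro DERIV_pos_imp_increasing_open[OF _ _ cont]) auto
  then show ?thesis by simp
qed simp

lemma partial_u_0_limit:
  assumes f: "C21_on {0..1} {0..} f" and x: "x \<in> {0..1}" and zero: "f x 0 = 0"
  shows "((\<lambda>u. f x u / u) \<longlongrightarrow> partial_u f x 0) (at_right 0)"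
proof -
  have "((\<lambda>u. f x u / u) \<longlongrightarrow> partial_u f x 0) (at 0 within {0..})"
    using C21_partial_u[OF f x, of 0] zero by (simp add: has_field_derivative_iff)
  then show ?thesis by (rule tendsto_within_subset) auto
qed

lemma positive_limit_solution_cong:
  assumes "\<And>a. v a x = w a x"
  shows "positive_limit_solution b \<beta> \<mu> f {x} v \<longleftrightarrow> positive_limit_solution b \<beta> \<mu> f {x} w"
  unfolding positive_limit_solution_def by (simp only: ball_simps assms)

text \<open>Both alternatives are decided at a single \<open>x0\<close>. The solution is given as a
  function \<open>v\<close> of age alone, so that the solutions for different points can be chosen
  independently and glued.\<close>

lemma pointwise_limit:
  fixes a_m :: ereal and a_c b x0 :: real and \<beta> \<mu> f :: "real \<Rightarrow> real \<Rightarrow> real"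
  assumes beta_nonneg: "\<forall>a\<in>ages a_m. \<forall>x\<in>{0..1}. 0 \<le> \<beta> a x"
    and beta_cont: "cont_into_Linf (ages a_m) {0..1} \<beta>"
    and a_c: "0 < a_c"
    and beta_zero: "\<forall>a x. a_c \<le> a \<and> ereal a < a_m \<and> x \<in> {0..1} \<longrightarrow> \<beta> a x = 0"
    and mu_nonneg: "\<forall>a\<in>ages a_m. \<forall>x\<in>{0..1}. 0 \<le> \<mu> a x"
    and mu_cont: "cont_into_Linf {0<..<b} {0..1} \<mu>"
    and f_C21: "C21_on {0..1} {0..} f"
    and f_u_pos: "\<forall>x\<in>{0..1}. \<forall>u\<ge>0. 0 < partial_u f x u"
    and f_zero: "\<forall>x\<in>{0..1}. f x 0 = 0"
    and f_quot: "\<forall>x\<in>{0..1}. strict_antimono_on {0<..} (\<lambda>u. f x u / u)"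
    and f_bdd: "\<exists>L>0. \<forall>x\<in>{0..1}. \<forall>u\<ge>0. f x u \<le> L"
    and ustar: "\<forall>d\<in>admissible_diffusion a_m \<beta> \<mu> f. positive_equilibrium a_m \<beta> \<mu> f d (ustar d)"
    and b: "a_c \<le> b" "ereal b < a_m" and x0: "x0 \<in> {0<..<1}"
  shows "1 < Gam a_c \<beta> \<mu> f x0 \<Longrightarrow> \<exists>v. positive_limit_solution b \<beta> \<mu> f {x0} (\<lambda>a x. v a) \<and>
      (\<forall>w. positive_limit_solution b \<beta> \<mu> f {x0} w \<longrightarrow> (\<forall>a\<in>{0..b}. w a x0 = v a)) \<and>
      (\<forall>a\<in>{0..b}. ((\<lambda>d. ustar d a x0) \<longlongrightarrow> v a) (at 0 within admissible_diffusion a_m \<beta> \<mu> f))"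
    "Gam a_c \<beta> \<mu> f x0 \<le> 1 \<Longrightarrow>
      \<forall>a\<in>{0..b}. ((\<lambda>d. ustar d a x0) \<longlongrightarrow> 0) (at 0 within admissible_diffusion a_m \<beta> \<mu> f)"
proof -
  have x01: "x0 \<in> {0..1}" using x0 by auto
  obtain L where L: "0 < L" "\<forall>x\<in>{0..1}. \<forall>u\<ge>0. f x u \<le> L" using f_bdd by blast
  have mu_Linf: "in_Linf {0<..<b} (\<lambda>a. \<mu> a x0)" using mu_cont x01 by (auto simp: cont_into_Linf_def)
  have b_meas: "{0<..<b} \<in> sets lebesgue" by simp
  have mu_pos: "0 \<le> \<mu> a x0" if "a \<in> {0<..<b}" for a
    using mu_nonneg ages_Ioo_subset[OF b(2)] x01 that by blast
  obtain m M where m: "m \<in> borel_measurable borel" "\<And>r. 0 \<le> m r" "\<And>r. m r \<le> M"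
    "AE a in lebesgue. a \<in> {0<..<b} \<longrightarrow> m a = \<mu> a x0"
    by (rule in_Linf_borel_representative[OF mu_Linf b_meas mu_pos], assumption, rule that, assumption+)
  have f_cont: "continuous_on ({0..1} \<times> {0..}) (case_prod f)" using f_C21 unfolding C21_on_def by blast
  note f_mono = increasing_if_partial_u_pos[OF f_C21 f_u_pos]
  have f_zero': "\<And>x. x \<in> {0..1} \<Longrightarrow> f x 0 = 0"
    and f_quot': "\<And>x. x \<in> {0..1} \<Longrightarrow> strict_antimono_on {0<..} (\<lambda>u. f x u / u)"
    and f_bdd': "\<And>x u. x \<in> {0..1} \<Longrightarrow> 0 \<le> u \<Longrightarrow> f x u \<le> L"
    using f_zero f_quot L(2) by blast+
  interpret local_problem a_m a_c b \<beta> \<mu> f x0 M L m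
    by unfold_locales (fact a_c b beta_nonneg beta_cont beta_zero mu_nonneg mu_cont f_cont f_mono
        f_zero' f_quot' f_bdd' L(1) x0 m)+
  have Gam: "Gam a_c \<beta> \<mu> f x0 = partial_u f x0 0 * offspring"
  proof -
    have "(LINT s:{0<..<a}|lebesgue. \<mu> s x0) = integral {0..a} m" if "a \<in> {0<..<a_c}" for a
      using that a_c(2) by (intro set_integral_AE_eq_integral[OF m(1) m_abs m_mu]) auto
    then have "(LINT a:{0<..<a_c}|lebesgue. \<beta> a x0 * exp (- (LINT s:{0<..<a}|lebesgue. \<mu> s x0))) = offspring"
      unfolding offspring_def survival_def by (intro set_lebesgue_integral_cong) auto
    then show ?thesis by (simp add: Gam_def)
  qed
  have x00: "f x0 0 = 0" using f_zero x01 by blast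
  note D = partial_u_0_limit[OF f_C21 x01 x00]
  show "\<forall>a\<in>{0..b}. ((\<lambda>d. ustar d a x0) \<longlongrightarrow> 0) (at 0 within admissible_diffusion a_m \<beta> \<mu> f)"
    if "Gam a_c \<beta> \<mu> f x0 \<le> 1"
  proof
    fix a assume "a \<in> {0..b}"
    then show "((\<lambda>d. ustar d a x0) \<longlongrightarrow> 0) (at 0 within admissible_diffusion a_m \<beta> \<mu> f)"
      using equilibrium_limit[OF ustar order_refl fixed_point(2)[OF D that[unfolded Gam]]] by simp
  qed
  assume "1 < Gam a_c \<beta> \<mu> f x0"
  from fixed_point(1)[OF D this[unfolded Gam]] obtain s where s: "0 < s" "f x0 (offspring * s) = s"
    and above: "\<And>S. s < S \<Longrightarrow> f x0 (offspring * S) < S"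
    and below: "\<And>S. 0 < S \<Longrightarrow> S < s \<Longrightarrow> S < f x0 (offspring * S)" by blast
  show "\<exists>v. positive_limit_solution b \<beta> \<mu> f {x0} (\<lambda>a x. v a) \<and>
      (\<forall>w. positive_limit_solution b \<beta> \<mu> f {x0} w \<longrightarrow> (\<forall>a\<in>{0..b}. w a x0 = v a)) \<and>
      (\<forall>a\<in>{0..b}. ((\<lambda>d. ustar d a x0) \<longlongrightarrow> v a) (at 0 within admissible_diffusion a_m \<beta> \<mu> f))"
  proof (intro exI[of _ "\<lambda>a. s * survival a"] conjI allI impI ballI)
    show "positive_limit_solution b \<beta> \<mu> f {x0} (\<lambda>a x. s * survival a)"
      by (rule survivors_solve[OF s]) simp
    show "w a x0 = s * survival a" if w: "positive_limit_solution b \<beta> \<mu> f {x0} w" and "a \<in> {0..b}" for w a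
    proof -
      \<comment> \<open>\<open>above\<close> and \<open>below\<close> exclude every positive fixed
        point other than \<open>s\<close>.\<close>
      have "w 0 x0 = s"
        using solution_is_survivors(2,3)[OF w] above[of "w 0 x0"] below[of "w 0 x0"]
        by (cases "w 0 x0" s rule: linorder_cases) auto
      then show ?thesis using solution_is_survivors(1)[OF w that(2)] by simp
    qed
    show "((\<lambda>d. ustar d a x0) \<longlongrightarrow> s * survival a) (at 0 within admissible_diffusion a_m \<beta> \<mu> f)"
      if "a \<in> {0..b}" for a
      by (rule equilibrium_limit[OF ustar less_imp_le[OF s(1)] above below that])
  qed
qed

theorem theorem2p7:
  fixes a_m :: ereal and a_c a_plus :: real
    and \<beta> \<mu> f :: "real \<Rightarrow> real \<Rightarrow> real"
    and ustar :: "real \<Rightarrow> real \<Rightarrow> real \<Rightarrow> real"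
    and I :: "real set"
  assumes a_m: "0 < a_m"
    and beta_nonneg: "\<forall>a\<in>ages a_m. \<forall>x\<in>{0..1}. 0 \<le> \<beta> a x"
    and beta_C2: "C2_into_Linf (ages a_m) {0..1} \<beta>"
    and a_c: "0 < a_c" "ereal a_c < a_m"
    and beta_zero: "\<forall>a x. a_c \<le> a \<and> ereal a < a_m \<and> x \<in> {0..1} \<longrightarrow> \<beta> a x = 0"
    and beta_min: "\<forall>a\<in>{0..<a_c}. 0 < (LINT l:{a<..<a_c}|lebesgue. (INF x\<in>{0..1}. \<beta> l x))"
    and mu_nonneg: "\<forall>a\<in>ages a_m. \<forall>x\<in>{0..1}. 0 \<le> \<mu> a x"
    and mu_cont: "\<forall>b. 0 < b \<and> ereal b < a_m \<longrightarrow> cont_into_Linf {0<..<b} {0..1} \<mu>"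
    and f_C21: "C21_on {0..1} {0..} f"
    and f_u_pos: "\<forall>x\<in>{0..1}. \<forall>u\<ge>0. 0 < partial_u f x u"
    and f_zero: "\<forall>x\<in>{0..1}. f x 0 = 0"
    and f_quot: "\<forall>x\<in>{0..1}. strict_antimono_on {0<..} (\<lambda>u. f x u / u)"
    and f_bdd: "\<exists>L>0. \<forall>x\<in>{0..1}. \<forall>u\<ge>0. f x u \<le> L"
    and ustar: "\<forall>d\<in>admissible_diffusion a_m \<beta> \<mu> f. positive_equilibrium a_m \<beta> \<mu> f d (ustar d)"
    and a_plus: "a_c \<le> a_plus" "ereal a_plus < a_m"
    and I: "compact I" "I \<subseteq> {0<..<1}"
  shows
    "((\<forall>x\<in>I. 1 < Gam a_c \<beta> \<mu> f x) \<longrightarrow>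
       (\<exists>vstar. positive_limit_solution a_plus \<beta> \<mu> f I vstar \<and>
          (\<forall>w. positive_limit_solution a_plus \<beta> \<mu> f I w \<longrightarrow>
             (\<forall>a\<in>{0..a_plus}. \<forall>x\<in>I. w a x = vstar a x)) \<and>
          (\<forall>a\<in>{0..a_plus}. \<forall>x\<in>I.
             ((\<lambda>d. ustar d a x) \<longlongrightarrow> vstar a x) (at 0 within admissible_diffusion a_m \<beta> \<mu> f)))) \<and>
     ((\<forall>x\<in>I. Gam a_c \<beta> \<mu> f x \<le> 1) \<longrightarrow>
       (\<forall>a\<in>{0..a_plus}. \<forall>x\<in>I.
          ((\<lambda>d. ustar d a x) \<longlongrightarrow> 0) (at 0 within admissible_diffusion a_m \<beta> \<mu> f)))"
proof -
  have beta_cont: "cont_into_Linf (ages a_m) {0..1} \<beta>" using beta_C2 unfolding C2_into_Linf_def by blast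
  have mu_cont': "cont_into_Linf {0<..<a_plus} {0..1} \<mu>" using mu_cont a_c a_plus by auto
  note pw = pointwise_limit[OF beta_nonneg beta_cont a_c(1) beta_zero mu_nonneg mu_cont' f_C21 f_u_pos
      f_zero f_quot f_bdd ustar a_plus]
  have I': "x \<in> {0<..<1}" if "x \<in> I" for x using I that by blast
  show ?thesis
  proof (intro conjI impI)
    assume G: "\<forall>x\<in>I. 1 < Gam a_c \<beta> \<mu> f x"
    let ?P = "\<lambda>x v. positive_limit_solution a_plus \<beta> \<mu> f {x} (\<lambda>a y. v a) \<and>
      (\<forall>w. positive_limit_solution a_plus \<beta> \<mu> f {x} w \<longrightarrow> (\<forall>a\<in>{0..a_plus}. w a x = v a)) \<and>
      (\<forall>a\<in>{0..a_plus}. ((\<lambda>d. ustar d a x) \<longlongrightarrow> v a) (at 0 within admissible_diffusion a_m \<beta> \<mu> f))"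
    have "\<forall>x\<in>I. \<exists>v. ?P x v" using pw(1)[OF I'] G by blast
    \<comment> \<open>The solutions chosen point by point form \<open>vstar\<close>, because the
      limit problem contains no condition linking different \<open>x\<close>.\<close>
    then obtain V where V: "\<forall>x\<in>I. ?P x (V x)" by (rule bchoice[THEN exE])
    have "positive_limit_solution a_plus \<beta> \<mu> f {x} (\<lambda>a y. V y a)" if "x \<in> I" for x
      using V that positive_limit_solution_cong[of "\<lambda>a y. V x a" x "\<lambda>a y. V y a"] by blast
    then have "positive_limit_solution a_plus \<beta> \<mu> f I (\<lambda>a x. V x a)"
      using positive_limit_solution_pointwise by blast
    moreover have "w a x = V x a"
      if "positive_limit_solution a_plus \<beta> \<mu> f I w" "a \<in> {0..a_plus}" "x \<in> I" for w a x
      using V that positive_limit_solution_pointwise by blast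
    moreover have "((\<lambda>d. ustar d a x) \<longlongrightarrow> V x a) (at 0 within admissible_diffusion a_m \<beta> \<mu> f)"
      if "a \<in> {0..a_plus}" "x \<in> I" for a x
      using V that by blast
    ultimately show "\<exists>vstar. positive_limit_solution a_plus \<beta> \<mu> f I vstar \<and>
          (\<forall>w. positive_limit_solution a_plus \<beta> \<mu> f I w \<longrightarrow>
             (\<forall>a\<in>{0..a_plus}. \<forall>x\<in>I. w a x = vstar a x)) \<and>
          (\<forall>a\<in>{0..a_plus}. \<forall>x\<in>I.
             ((\<lambda>d. ustar d a x) \<longlongrightarrow> vstar a x) (at 0 within admissible_diffusion a_m \<beta> \<mu> f))"
      by (intro exI[of _ "\<lambda>a x. V x a"]) (intro conjI allI impI ballI; assumption)
  next
    assume "\<forall>x\<in>I. Gam a_c \<beta> \<mu> f x \<le> 1"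
    then show "\<forall>a\<in>{0..a_plus}. \<forall>x\<in>I.
          ((\<lambda>d. ustar d a x) \<longlongrightarrow> 0) (at 0 within admissible_diffusion a_m \<beta> \<mu> f)"
      using pw(2)[OF I'] by blast
  qed
qed

end
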